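(* Let $G$ be a non-planar $K_{3,3}$-subdivision-free toroidal graph with $n$ vertices and $m$ edges. Then $m\le 3n-5$ if $n=5$ or $n=8$, and $$m\le 3n-6\quad\text{if } n\ge 6 \text{ and } n\neq 8.$$
   Context: All graphs are finite, undirected and simple. A graph is toroidal if it can be embedded on the torus, and $K_{3,3}$-subdivision-free if it contains no subdivision of $K_{3,3}$ as a subgraph. *)

theory Defs
  imports "HOL-Analysis.Analysis" "Graph_Theory.Graph_Theory"
begin

text \<open>
  A finite simple undirected graph is a \<^locale>\<open>pair_graph\<close>: a finite loop-free digraph whose
  arcs form a symmetric set of ordered pairs. Each undirected edge thus occurs as two arcs, and
  is counted once as the unordered pair of its ends.
\<close>

definition uedges :: "'a pair_pre_digraph \<Rightarrow> 'a set set" where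
  "uedges G = {{u, v} | u v. (u, v) \<in> parcs G}"

text \<open>
  Topological embedding of a graph in a subset \<open>S\<close> of a topological space: distinct vertices are
  sent to distinct points, edges to simple arcs joining the images of their ends, an arc contains
  no vertex image besides its two ends, and two different arcs meet only in the image of a common
  end. Since the graphs are finite, this is the same as embedding the geometric realization. The
  embedding need not be cellular.
\<close>

definition embeddable_in :: "'a pair_pre_digraph \<Rightarrow> 's::topological_space set \<Rightarrow> bool" where
  "embeddable_in G S \<longleftrightarrow>
    (\<exists>(\<phi> :: 'a \<Rightarrow> 's) (\<gamma> :: 'a set \<Rightarrow> real \<Rightarrow> 's).
      inj_on \<phi> (pverts G) \<and> \<phi> ` pverts G \<subseteq> S \<and>
      (\<forall>e \<in> uedges G.
        arc (\<gamma> e) \<and> path_image (\<gamma> e) \<subseteq> S \<and>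
        {pathstart (\<gamma> e), pathfinish (\<gamma> e)} = \<phi> ` e \<and>
        path_image (\<gamma> e) \<inter> \<phi> ` pverts G = \<phi> ` e) \<and>
      (\<forall>e \<in> uedges G. \<forall>f \<in> uedges G. e \<noteq> f \<longrightarrow>
        path_image (\<gamma> e) \<inter> path_image (\<gamma> f) = \<phi> ` (e \<inter> f)))"

definition planar :: "'a pair_pre_digraph \<Rightarrow> bool" where
  "planar G \<longleftrightarrow> embeddable_in G (UNIV :: complex set)"

definition torus :: "(complex \<times> complex) set" where
  "torus = sphere 0 1 \<times> sphere 0 1"

definition toroidal :: "'a pair_pre_digraph \<Rightarrow> bool" where
  "toroidal G \<longleftrightarrow> embeddable_in G torus"

definition K33_subdivision_free :: "'a pair_pre_digraph \<Rightarrow> bool" where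
  "K33_subdivision_free G \<longleftrightarrow>
    \<not> (\<exists>H K. subgraph (with_proj H) (with_proj G) \<and> subdivision_pair K H \<and>
        K\<^bsub>3,3\<^esub> (with_proj K))"

end

theory Submission
  imports Defs "HOL-Complex_Analysis.Complex_Analysis"
begin

hide_const (open) Digraph_Component.connected

text \<open>
  \<^emph>\<open>Combinatorial part.\<close> As in Mader's argument, contracting edges that lie in at most two triangles shows
  that a graph with \<open>n\<close> vertices, at least \<open>3n - 5\<close> edges and no \<open>K\<^bsub>3,3\<^esub>\<close> minor is a tree of copies of \<open>K\<^sub>5\<close>
  glued along edges. In particular it has exactly \<open>3n - 5\<close> edges, \<open>n \<equiv> 2\<close> modulo \<open>3\<close>, and for \<open>n \<ge> 11\<close> it contains
  three copies of \<open>K\<^sub>5\<close>, two of which share at most a vertex or all of which share an edge.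

  \<^emph>\<open>Topological part.\<close> Neither configuration can be drawn on the torus. The complement of an essential simple closed
  curve is planar, so a triangle disjoint from a \<open>K\<^sub>5\<close> is null-homotopic. A \<open>K\<^sub>4\<close> all of whose triangles are
  null-homotopic lifts to the plane, where one of its vertices is enclosed by the other three; whatever is connected to that
  vertex is trapped in a disc, which a \<open>K\<^sub>5\<close> cannot be. This excludes the first configuration, and in the second one it
  yields an essential triangle along which the torus is cut open. Instead of homology classes or covering maps the proof uses
  continuous arguments of circle-valued functions.
\<close>

section \<open>Graphs without a \<open>K\<^bsub>3,3\<^esub>\<close> minor\<close>

text \<open>Since K33 has maximum degree three, containing it as a minor and containing a
  subdivision of it agree. Minors pull back along contractions, so the induction is run with minors
  and subdivisions are recovered afterwards. The number \<open>3n - 5\<close> is the count of a K5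
  (10 edges on 5 vertices) that gluing along an edge preserves (3 new vertices, 9 new edges);
  contracting an edge in at most two triangles costs one vertex and at most three edges, so it never
  falls below this count. The orders attained are 2, 5, 8, 11 and so on, and 11 is the first with
  three copies of K5, whence the exceptions 5 and 8. An embedding in the torus need not be cellular,
  so no faces are counted there. The tool is one planar fact: a connected set that avoids a plane
  drawing of K4 cannot accumulate at all four of its vertices. Every topological contradiction comes
  down to it, directly or through the nonplanarity of K5.\<close>

definition graph_on :: "'a set \<Rightarrow> 'a rel \<Rightarrow> bool" where
  "graph_on V R \<longleftrightarrow> finite V \<and> R \<subseteq> V \<times> V \<and> sym R \<and> irrefl R"

definition conn :: "'a rel \<Rightarrow> 'a set \<Rightarrow> bool" where
  "conn R X \<longleftrightarrow> X \<noteq> {} \<and> (\<forall>a\<in>X. \<forall>b\<in>X. (a, b) \<in> (Restr R X)\<^sup>*)"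

definition adjacent :: "'a rel \<Rightarrow> 'a set \<Rightarrow> 'a set \<Rightarrow> bool" where
  "adjacent R X Y \<longleftrightarrow> (\<exists>x\<in>X. \<exists>y\<in>Y. (x, y) \<in> R)"

text \<open>The six branch sets of a \<open>K\<^bsub>3,3\<^esub>\<close> minor are indexed by \<open>0,\<dots>,5\<close>; the sides are
  \<open>{0,1,2}\<close> and \<open>{3,4,5}\<close>.\<close>

definition opp :: "nat \<Rightarrow> nat \<Rightarrow> bool" where
  "opp i j \<longleftrightarrow> i < 6 \<and> j < 6 \<and> (i < 3) \<noteq> (j < 3)"

definition K33_model :: "'a set \<Rightarrow> 'a rel \<Rightarrow> (nat \<Rightarrow> 'a set) \<Rightarrow> bool" where
  "K33_model V R B \<longleftrightarrow> (\<forall>i<6. conn R (B i) \<and> B i \<subseteq> V) \<and>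
     (\<forall>i<6. \<forall>j<6. i \<noteq> j \<longrightarrow> B i \<inter> B j = {}) \<and>
     (\<forall>i j. opp i j \<longrightarrow> adjacent R (B i) (B j))"

definition K33_minor :: "'a set \<Rightarrow> 'a rel \<Rightarrow> bool" where
  "K33_minor V R \<longleftrightarrow> (\<exists>B. K33_model V R B)"

definition clique :: "'a set \<Rightarrow> 'a rel" where
  "clique S = {(x, y). x \<in> S \<and> y \<in> S \<and> x \<noteq> y}"

definition dels :: "'a set \<Rightarrow> 'a rel \<Rightarrow> 'a rel" where
  "dels S R = {(x, y) \<in> R. x \<notin> S \<and> y \<notin> S}"

text \<open>The merged vertex keeps the name \<open>u\<close>, so the contracted graph lives on
  \<open>V - {v}\<close> in the same type. Parallel edges merge by themselves, and removing
  \<open>u\<close> from the neighbours of \<open>v\<close> prevents a loop.\<close>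

definition contr :: "'a \<Rightarrow> 'a \<Rightarrow> 'a rel \<Rightarrow> 'a rel" where
  "contr u v R = dels {v} R \<union> {u} \<times> (R `` {v} - {u}) \<union> (R `` {v} - {u}) \<times> {u}"

lemma graph_onD:
  assumes "graph_on V R"
  shows "finite V" "finite R" "(x, y) \<in> R \<Longrightarrow> x \<in> V" "(x, y) \<in> R \<Longrightarrow> y \<in> V"
    "(x, y) \<in> R \<Longrightarrow> (y, x) \<in> R" "(x, x) \<notin> R" "finite (R `` {x})"
proof -
  show f: "finite V" using assms by (simp add: graph_on_def)
  show "finite R" using assms f unfolding graph_on_def by (meson finite_SigmaI finite_subset)
  then show "finite (R `` {x})" by (simp add: finite_Image)
qed (use assms in \<open>auto simp: graph_on_def irrefl_def dest: symD\<close>)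

lemma graph_on_dels: "graph_on V R \<Longrightarrow> graph_on (V - S) (dels S R)"
  unfolding graph_on_def dels_def sym_def irrefl_def by auto

lemma graph_on_contr:
  assumes "graph_on V R" "(u, v) \<in> R" shows "graph_on (V - {v}) (contr u v R)"
  using assms unfolding graph_on_def contr_def dels_def sym_def irrefl_def by auto

lemma conn_mono: "conn R X \<Longrightarrow> R \<subseteq> R' \<Longrightarrow> conn R' X"
  unfolding conn_def by (meson Int_mono order_refl rtrancl_mono subsetD)

lemma conn_single [simp]: "conn R {x}"
  by (simp add: conn_def)

lemma conn_insert:
  assumes "conn R X" "x \<in> X" "(x, z) \<in> R" "(z, x) \<in> R"
  shows "conn R (insert z X)"
proof -
  let ?R = "Restr R (insert z X)"
  have X: "(a, b) \<in> ?R\<^sup>*" if "a \<in> X" "b \<in> X" for a b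
  proof -
    have "(a, b) \<in> (Restr R X)\<^sup>*" using assms(1) that unfolding conn_def by auto
    moreover have "Restr R X \<subseteq> ?R" by auto
    ultimately show ?thesis by (meson rtrancl_mono subsetD)
  qed
  have xz: "(x, z) \<in> ?R\<^sup>*" "(z, x) \<in> ?R\<^sup>*" using assms by auto
  have "(a, b) \<in> ?R\<^sup>*" if "a \<in> insert z X" "b \<in> insert z X" for a b
  proof -
    have "(a, x) \<in> ?R\<^sup>*" using that(1) X xz assms(2) by auto
    moreover have "(x, b) \<in> ?R\<^sup>*" using that(2) X xz assms(2) by auto
    ultimately show ?thesis by (rule rtrancl_trans)
  qed
  then show ?thesis unfolding conn_def by auto
qed

lemma K33_minor_mono:
  assumes "K33_minor V R" "V \<subseteq> V'" "R \<subseteq> R'"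
  shows "K33_minor V' R'"
proof -
  from assms(1) obtain B where B: "K33_model V R B" by (auto simp: K33_minor_def)
  have "K33_model V' R' B"
    using B assms(2,3) conn_mono[OF _ assms(3)] unfolding K33_model_def adjacent_def
    by (meson order_trans subsetD)
  then show ?thesis by (auto simp: K33_minor_def)
qed

text \<open>A step of the contracted graph that is not an edge of \<open>R\<close> has
  \<open>u\<close> as an end and stands for an edge at \<open>v\<close>; a detour along
  \<open>uv\<close> simulates it.\<close>

lemma conn_contr:
  assumes g: "graph_on V R" "(u, v) \<in> R" and X: "conn (contr u v R) X" "X \<subseteq> V - {v}"
  shows "conn R (if u \<in> X then insert v X else X)"
proof (cases "u \<in> X")
  case False
  have eq: "Restr (contr u v R) X \<subseteq> Restr R X"
    using False X(2) by (auto simp: contr_def dels_def)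
  have "(a, b) \<in> (Restr R X)\<^sup>*" if "a \<in> X" "b \<in> X" for a b
    using X(1) that rtrancl_mono[OF eq] unfolding conn_def by blast
  then show ?thesis using X(1) False unfolding conn_def by simp
next
  case True
  let ?R = "Restr R (insert v X)"
  have uv: "(u, v) \<in> ?R" "(v, u) \<in> ?R" using g True graph_onD(5)[OF g(1)] by auto
  have st: "(a, b) \<in> ?R\<^sup>*" if "(a, b) \<in> Restr (contr u v R) X" for a b
  proof -
    have "(a, b) \<in> R \<or> (a = u \<and> (v, b) \<in> R) \<or> (b = u \<and> (v, a) \<in> R)" and ab: "a \<in> X" "b \<in> X"
      using that by (auto simp: contr_def dels_def)
    then consider "(a, b) \<in> ?R" | "a = u" "(v, b) \<in> ?R" | "b = u" "(a, v) \<in> ?R"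
      using graph_onD(5)[OF g(1)] by auto
    then show ?thesis
    proof cases
      case 1 then show ?thesis by auto
    next
      case 2 then show ?thesis using uv by (meson converse_rtrancl_into_rtrancl r_into_rtrancl)
    next
      case 3 then show ?thesis using uv by (meson converse_rtrancl_into_rtrancl r_into_rtrancl)
    qed
  qed
  have XX: "(a, b) \<in> ?R\<^sup>*" if "a \<in> X" "b \<in> X" for a b
  proof -
    have "(a, b) \<in> (Restr (contr u v R) X)\<^sup>*" using X(1) that by (auto simp: conn_def)
    then show ?thesis
    proof (induct rule: rtrancl_induct)
      case (step y z)
      then show ?case using st[of y z] by (meson rtrancl_trans)
    qed simp
  qed
  have "(a, b) \<in> ?R\<^sup>*" if "a \<in> insert v X" "b \<in> insert v X" for a b
  proof -
    have "(a, u) \<in> ?R\<^sup>*" using that(1) XX True r_into_rtrancl[OF uv(2)] by blast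
    moreover have "(u, b) \<in> ?R\<^sup>*" using that(2) XX True r_into_rtrancl[OF uv(1)] by blast
    ultimately show ?thesis by (rule rtrancl_trans)
  qed
  then show ?thesis using True by (simp add: conn_def)
qed

lemma K33_minor_contr:
  assumes g: "graph_on V R" "(u, v) \<in> R" and "K33_minor (V - {v}) (contr u v R)"
  shows "K33_minor V R"
proof -
  from assms(3) obtain B where B: "K33_model (V - {v}) (contr u v R) B" by (auto simp: K33_minor_def)
  define B' where "B' i = (if u \<in> B i then insert v (B i) else B i)" for i
  have v: "v \<in> V" "u \<noteq> v" using g graph_onD[OF g(1)] by auto
  have sub: "B i \<subseteq> V - {v}" and con: "conn (contr u v R) (B i)" if "i < 6" for i
    using B that by (auto simp: K33_model_def)
  have disj: "B i \<inter> B j = {}" if "i < 6" "j < 6" "i \<noteq> j" for i j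
    using B that by (auto simp: K33_model_def)
  have 1: "conn R (B' i) \<and> B' i \<subseteq> V" if "i < 6" for i
    using conn_contr[OF g con[OF that] sub[OF that]] sub[OF that] v unfolding B'_def by auto
  have 2: "B' i \<inter> B' j = {}" if "i < 6" "j < 6" "i \<noteq> j" for i j
    using disj[OF that] sub[OF that(1)] sub[OF that(2)] unfolding B'_def by auto
  have 3: "adjacent R (B' i) (B' j)" if "opp i j" for i j
  proof -
    from B that obtain x y where xy: "x \<in> B i" "y \<in> B j" "(x, y) \<in> contr u v R"
      unfolding K33_model_def adjacent_def by blast
    then consider "(x, y) \<in> R" | "x = u" "(v, y) \<in> R" | "y = u" "(v, x) \<in> R"
      by (auto simp: contr_def dels_def)
    then show ?thesis
    proof cases
      case 1 then show ?thesis using xy unfolding adjacent_def B'_def by auto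
    next
      case 2 then show ?thesis using xy unfolding adjacent_def B'_def by auto
    next
      case 3 then show ?thesis using xy graph_onD(5)[OF g(1)] unfolding adjacent_def B'_def by auto
    qed
  qed
  have "K33_model V R B'" unfolding K33_model_def using 1 2 3 by blast
  then show ?thesis by (auto simp: K33_minor_def)
qed

section \<open>Criteria for a K33 minor\<close>

lemma less6: "i < (6::nat) \<longleftrightarrow> i = 0 \<or> i = 1 \<or> i = 2 \<or> i = 3 \<or> i = 4 \<or> i = 5"
  by presburger

lemma opp_cases: "opp i j \<longleftrightarrow> i \<in> {0,1,2} \<and> j \<in> {3,4,5} \<or> i \<in> {3,4,5} \<and> j \<in> {0,1,2}"
  unfolding opp_def insert_iff empty_iff by presburger

lemma adjacent_sym: "sym R \<Longrightarrow> adjacent R X Y \<Longrightarrow> adjacent R Y X"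
  unfolding adjacent_def by (meson symD)

lemma all6: "(\<forall>i<6. P i) \<longleftrightarrow> P 0 \<and> P (Suc 0) \<and> P 2 \<and> P 3 \<and> P 4 \<and> P (5::nat)"
  unfolding less6 One_nat_def by blast

text \<open>Every K33 model that is built by hand has at most one branch set with more than one
  vertex. The sides are \<open>C\<close>, \<open>x1\<close>, \<open>x2\<close> and
  \<open>y1\<close>, \<open>y2\<close>, \<open>y3\<close>.\<close>

lemma K33_minorI:
  assumes "graph_on V R" "distinct [x1, x2, y1, y2, y3]"
    and "conn R C" "C \<subseteq> V" "C \<inter> {x1, x2, y1, y2, y3} = {}"
    and "{x1, x2} \<times> {y1, y2, y3} \<subseteq> R"
    and "\<And>y. y \<in> {y1, y2, y3} \<Longrightarrow> \<exists>c\<in>C. (c, y) \<in> R"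
  shows "K33_minor V R"
proof -
  define B where "B i = [C, {x1}, {x2}, {y1}, {y2}, {y3}] ! i" for i
  have B: "B 0 = C" "B (Suc 0) = {x1}" "B 2 = {x2}" "B 3 = {y1}" "B 4 = {y2}" "B 5 = {y3}"
    by (simp_all add: B_def)
  have s: "sym R" using assms(1) by (simp add: graph_on_def)
  have xy: "(x1, y1) \<in> R" "(x1, y2) \<in> R" "(x1, y3) \<in> R" "(x2, y1) \<in> R" "(x2, y2) \<in> R" "(x2, y3) \<in> R"
    using assms(6) by auto
  have cy: "\<exists>c\<in>C. (c, y1) \<in> R" "\<exists>c\<in>C. (c, y2) \<in> R" "\<exists>c\<in>C. (c, y3) \<in> R" using assms(7) by auto
  have V: "x1 \<in> V" "x2 \<in> V" "y1 \<in> V" "y2 \<in> V" "y3 \<in> V"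
    using xy graph_onD(3,4)[OF assms(1)] by blast+
  have d: "x1 \<noteq> x2" "x1 \<noteq> y1" "x1 \<noteq> y2" "x1 \<noteq> y3" "x2 \<noteq> y1" "x2 \<noteq> y2" "x2 \<noteq> y3" "y1 \<noteq> y2" "y1 \<noteq> y3" "y2 \<noteq> y3"
    "x1 \<notin> C" "x2 \<notin> C" "y1 \<notin> C" "y2 \<notin> C" "y3 \<notin> C" using assms(2,5) by auto
  have adj: "adjacent R (B i) (B j)" if "i \<in> {0,1,2}" "j \<in> {3,4,5}" for i j
    using that xy cy unfolding adjacent_def One_nat_def
    by (elim insertE) (simp_all only: B bex_simps empty_iff, blast+)
  have 1: "\<forall>i<6. conn R (B i) \<and> B i \<subseteq> V" unfolding all6 B using assms(3,4) V by simp
  have 2: "\<forall>i<6. \<forall>j<6. i \<noteq> j \<longrightarrow> B i \<inter> B j = {}" unfolding all6 B using d by simp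
  have 3: "\<forall>i j. opp i j \<longrightarrow> adjacent R (B i) (B j)"
    using adj adjacent_sym[OF s] unfolding opp_cases by blast
  show ?thesis using 1 2 3 unfolding K33_minor_def K33_model_def by blast
qed

lemma clique_sub: "clique S \<subseteq> R \<longleftrightarrow> (\<forall>x\<in>S. \<forall>y\<in>S. x \<noteq> y \<longrightarrow> (x, y) \<in> R)"
  by (auto simp: clique_def)

text \<open>A vertex of a K5 has been split into the adjacent halves \<open>u\<close> and
  \<open>v\<close>, both still joined to \<open>x1\<close> and \<open>x2\<close>. The halves go to
  opposite sides of the K33: if one half sees both \<open>x3\<close> and \<open>x4\<close>, these
  join the other half, and otherwise each of \<open>x3\<close>, \<open>x4\<close> is put opposite to
  the half that sees it.\<close>

lemma K33_minor_split:
  assumes g: "graph_on V R" and d: "distinct [u, v, x1, x2, x3, x4]" and uv: "(u, v) \<in> R"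
    and c: "clique {x1, x2, x3, x4} \<subseteq> R"
    and a: "(u, x1) \<in> R" "(v, x1) \<in> R" "(u, x2) \<in> R" "(v, x2) \<in> R"
      "(u, x3) \<in> R \<or> (v, x3) \<in> R" "(u, x4) \<in> R \<or> (v, x4) \<in> R"
  shows "K33_minor V R"
proof -
  note s = graph_onD(5)[OF g]
  have V: "u \<in> V" "v \<in> V" "x1 \<in> V" "x2 \<in> V" "x3 \<in> V" "x4 \<in> V"
    using uv a c graph_onD(3,4)[OF g] d by (auto simp: clique_sub)
  have c': "(x1, x2) \<in> R" "(x1, x3) \<in> R" "(x1, x4) \<in> R" "(x2, x3) \<in> R" "(x2, x4) \<in> R" "(x3, x4) \<in> R"
    using c d by (auto simp: clique_sub)
  note r = V uv a(1-4) c' s[OF uv] s[OF a(1)] s[OF a(2)] s[OF a(3)] s[OF a(4)] c'[THEN s]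
  consider "(u, x3) \<in> R" "(u, x4) \<in> R" | "(v, x3) \<in> R" "(v, x4) \<in> R"
    | "(u, x3) \<in> R" "(v, x4) \<in> R" | "(v, x3) \<in> R" "(u, x4) \<in> R" using a by blast
  then show ?thesis
  proof cases
    case 1
    then have "(x3, u) \<in> R" "(x4, u) \<in> R" using s by auto
    then show ?thesis using d r
      by (intro K33_minorI[OF g, of x3 x4 u x1 x2 "{v}"]) auto
  next
    case 2
    then have "(x3, v) \<in> R" "(x4, v) \<in> R" using s by auto
    then show ?thesis using d r
      by (intro K33_minorI[OF g, of x3 x4 v x1 x2 "{u}"]) auto
  next
    case 3
    then have "(x4, v) \<in> R" using s by auto
    then show ?thesis using d r 3
      by (intro K33_minorI[OF g, of x1 x4 x2 v x3 "{u}"]) auto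
  next
    case 4
    then have "(x3, v) \<in> R" using s by auto
    then show ?thesis using d r 4
      by (intro K33_minorI[OF g, of x1 x3 x2 v x4 "{u}"]) auto
  qed
qed

lemma card_ge_obtain2:
  assumes "2 \<le> card S" obtains x y where "x \<in> S" "y \<in> S" "x \<noteq> y"
  using assms by (metis card_2_iff' ex_card subset_iff)

lemma K33_minor_split_clique:
  assumes g: "graph_on V R" and uv: "(u, v) \<in> R" "u \<notin> S" "v \<notin> S"
    and S: "card S = 4" "clique S \<subseteq> R" "\<And>x. x \<in> S \<Longrightarrow> (u, x) \<in> R \<or> (v, x) \<in> R"
    and two: "2 \<le> card (R `` {u} \<inter> R `` {v} \<inter> S)"
  shows "K33_minor V R"
proof -
  obtain x1 x2 where x: "x1 \<in> S" "x2 \<in> S" "x1 \<noteq> x2"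
    and e: "(u, x1) \<in> R" "(v, x1) \<in> R" "(u, x2) \<in> R" "(v, x2) \<in> R"
    using card_ge_obtain2[OF two] by (metis Image_singleton_iff IntE)
  have fS: "finite S" using S(1) by (metis card.infinite zero_neq_numeral)
  have "card (S - {x1, x2}) = 2" using x S(1) fS by (simp add: card_Diff_subset)
  then obtain x3 x4 where x34: "S - {x1, x2} = {x3, x4}" "x3 \<noteq> x4" by (meson card_2_iff)
  then have SS: "S = {x1, x2, x3, x4}" "x3 \<notin> {x1, x2}" "x4 \<notin> {x1, x2}" using x by blast+
  have "u \<noteq> v" using uv(1) graph_onD(6)[OF g] by auto
  then show ?thesis using SS x34(2) x uv e S
    by (intro K33_minor_split[OF g, of u v x1 x2 x3 x4]) auto
qed

section \<open>Arc counts under deletion and contraction\<close>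

lemma card_dels:
  assumes "graph_on V R" shows "card R = card (dels {v} R) + 2 * card (R `` {v})"
proof -
  note G = graph_onD[OF assms]
  let ?N = "R `` {v}"
  have eq: "R = dels {v} R \<union> ({v} \<times> ?N \<union> ?N \<times> {v})" using G(5) by (auto simp: dels_def)
  have fin: "finite (dels {v} R)" using G(2) by (rule rev_finite_subset) (auto simp: dels_def)
  have "v \<notin> ?N" using G(6) by auto
  then have "card ({v} \<times> ?N \<union> ?N \<times> {v}) = card ?N + card ?N"
    using G(7) by (subst card_Un_disjoint) (auto simp: card_cartesian_product)
  moreover have "card R = card (dels {v} R) + card ({v} \<times> ?N \<union> ?N \<times> {v})"
    using fin G(7) by (subst eq, subst card_Un_disjoint) (auto simp: dels_def)
  ultimately show ?thesis by simp
qed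

text \<open>Contraction loses the edge \<open>uv\<close> and, for each common neighbour, one of two
  edges that become parallel; both orientations are counted. \<open>M\<close> is the set of
  neighbours that \<open>u\<close> gains.\<close>

lemma card_contr:
  assumes g: "graph_on V R" and uv: "(u, v) \<in> R"
  shows "card R = card (contr u v R) + 2 + 2 * card (R `` {u} \<inter> R `` {v})"
proof -
  note G = graph_onD[OF g]
  define M where "M = R `` {v} - {u} - R `` {u}"
  have fM: "finite M" using G(7) by (simp add: M_def)
  have fin: "finite (dels {v} R)" using G(2) by (rule rev_finite_subset) (auto simp: dels_def)
  have eq: "contr u v R = dels {v} R \<union> ({u} \<times> M \<union> M \<times> {u})"
    using G(5,6) uv by (auto simp: contr_def dels_def M_def)
  have "card ({u} \<times> M \<union> M \<times> {u}) = card M + card M"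
    using fM by (subst card_Un_disjoint) (auto simp: card_cartesian_product M_def)
  moreover have "card (contr u v R) = card (dels {v} R) + card ({u} \<times> M \<union> M \<times> {u})"
    using fin fM G(5) unfolding eq by (subst card_Un_disjoint) (auto simp: dels_def M_def)
  moreover have "card (R `` {v}) = Suc (card M + card (R `` {u} \<inter> R `` {v}))"
  proof -
    have "R `` {v} = insert u (M \<union> (R `` {u} \<inter> R `` {v}))" using G(5)[OF uv] by (auto simp: M_def)
    moreover have "u \<notin> M \<union> (R `` {u} \<inter> R `` {v})" using G(6) by (auto simp: M_def)
    ultimately have "card (R `` {v}) = Suc (card (M \<union> (R `` {u} \<inter> R `` {v})))"
      using fM G(7) by (metis card_insert_disjoint finite_Int finite_UnI)
    also have "card (M \<union> (R `` {u} \<inter> R `` {v})) = card M + card (R `` {u} \<inter> R `` {v})"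
      using fM G(7) by (intro card_Un_disjoint) (auto simp: M_def)
    finally show ?thesis .
  qed
  ultimately show ?thesis using card_dels[OF g, of v] by simp
qed

section \<open>Trees of complete graphs on five vertices\<close>

text \<open>Starting from a single edge rather than from a K5 makes the arc count tight from the
  beginning (2 + 10 = 6 * 2) and gives the inductions a trivial base. Attaching edges are
  kept.\<close>

inductive K5tree :: "'a set \<Rightarrow> 'a rel \<Rightarrow> bool" where
  edge: "p \<noteq> q \<Longrightarrow> K5tree {p, q} {(p, q), (q, p)}"
| glue: "K5tree V R \<Longrightarrow> (p, q) \<in> R \<Longrightarrow> distinct [a, b, c] \<Longrightarrow> {a, b, c} \<inter> V = {} \<Longrightarrow>
    K5tree (V \<union> {a, b, c}) (R \<union> clique {a, b, c, p, q})"

lemma clique_eq_times: "clique S = S \<times> S - Id_on S"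
  by (auto simp: clique_def)

lemma card_clique: "finite S \<Longrightarrow> card (clique S) = card S * card S - card S"
proof -
  assume f: "finite S"
  have "Id_on S = (\<lambda>x. (x, x)) ` S" by auto
  then have "card (Id_on S) = card S" by (simp add: card_image inj_on_def)
  then show ?thesis unfolding clique_eq_times using f
    by (subst card_Diff_subset) (auto simp: card_cartesian_product Id_on_def)
qed

lemma graph_on_clique: "finite S \<Longrightarrow> graph_on S (clique S)"
  by (auto simp: graph_on_def clique_def sym_def irrefl_def)

lemma graph_on_Un: "graph_on V R \<Longrightarrow> graph_on W S \<Longrightarrow> graph_on (V \<union> W) (R \<union> S)"
  unfolding graph_on_def sym_def irrefl_def by blast

text \<open>Each gluing adds 3 vertices and 18 arcs: the 20 arcs of a K5 less the two of the
  attaching edge.\<close>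

lemma K5tree_graph: "K5tree V R \<Longrightarrow> graph_on V R \<and> card R + 10 = 6 * card V"
proof (induct rule: K5tree.induct)
  case (edge p q)
  have "graph_on {p, q} {(p, q), (q, p)}" using edge by (auto simp: graph_on_def sym_def irrefl_def)
  then show ?case using edge by simp
next
  case (glue V R p q a b c)
  then have g: "graph_on V R" and e: "card R + 10 = 6 * card V" by auto
  note G = graph_onD[OF g]
  let ?Q = "{a, b, c, p, q}"
  have pq: "p \<in> V" "q \<in> V" "p \<noteq> q" "(q, p) \<in> R" using glue(3) G by auto
  have "graph_on (V \<union> ?Q) (R \<union> clique ?Q)" by (intro graph_on_Un g graph_on_clique) simp
  moreover have "V \<union> ?Q = V \<union> {a, b, c}" using pq by auto
  ultimately have 1: "graph_on (V \<union> {a, b, c}) (R \<union> clique ?Q)" by simp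
  have ne: "p \<notin> {a, b, c}" "q \<notin> {a, b, c}" using glue(5) pq by blast+
  have Q: "card ?Q = 5" using glue(4) ne pq by (auto simp: card_insert_if)
  have "R \<inter> clique ?Q = {(p, q), (q, p)}"
    using glue(3,5) pq G(3,4) G(6) by (auto simp: clique_def)
  then have i: "card (R \<inter> clique ?Q) = 2" using pq by simp
  have fc: "finite (clique ?Q)" using graph_onD(2)[OF graph_on_clique[of ?Q]] by simp
  have "card (clique ?Q) = 20" using Q by (simp add: card_clique)
  then have "card (R \<union> clique ?Q) = card R + 18"
    using card_Un_Int[OF G(2) fc] i by simp
  moreover have "card (V \<union> {a, b, c}) = card V + 3"
    using glue(4,5) G(1) by (subst card_Un_disjoint) auto
  ultimately show ?case using 1 e by simp
qed

lemma K5tree_finite: "K5tree V R \<Longrightarrow> finite V" "K5tree V R \<Longrightarrow> 2 \<le> card V"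
proof -
  show "K5tree V R \<Longrightarrow> finite V" using K5tree_graph graph_onD(1) by blast
  show "K5tree V R \<Longrightarrow> 2 \<le> card V" using K5tree_graph by fastforce
qed

lemma card_clique_common:
  assumes "card Q = 5" "clique Q \<subseteq> R" "x \<in> Q" "y \<in> Q" "finite (R `` {x})"
  shows "3 \<le> card (R `` {x} \<inter> R `` {y})"
proof -
  have "Q - {x, y} \<subseteq> R `` {x} \<inter> R `` {y}" using assms(2-4) by (auto simp: clique_sub)
  then have "card (Q - {x, y}) \<le> card (R `` {x} \<inter> R `` {y})" using assms(5) by (intro card_mono) auto
  moreover have "card Q - card {x, y} \<le> card (Q - {x, y})" by (intro diff_card_le_card_Diff) simp
  moreover have "card {x, y} \<le> 2" by (simp add: card_insert_if)
  ultimately show ?thesis using assms(1) by linarith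
qed

lemma K5tree_card2:
  assumes "K5tree V R" "card V \<le> 2" "(p, q) \<in> R"
  shows "V = {p, q} \<and> R = {(p, q), (q, p)}"
proof -
  have g: "graph_on V R" using K5tree_graph[OF assms(1)] by simp
  note G = graph_onD[OF g]
  have pq: "p \<in> V" "q \<in> V" "p \<noteq> q" using assms(3) G by auto
  have "{p, q} = V" using pq G(1) assms(2) by (intro card_seteq) auto
  then have V: "V = {p, q}" by simp
  have "R \<subseteq> {(p, q), (q, p)}" using V G(3,4,6) by fastforce
  then show ?thesis using V assms(3) G(5) by auto
qed

text \<open>Each edge lies in a copy of K5, whose other three vertices are common neighbours. Edges
  in only two triangles are refuted by this.\<close>

lemma K5tree_common:
  assumes "K5tree V R" "card V > 2" "(x, y) \<in> R"
  shows "3 \<le> card (R `` {x} \<inter> R `` {y})"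
  using assms
proof (induct rule: K5tree.induct)
  case (edge p q) then show ?case by (simp add: card_insert_if split: if_splits)
next
  case (glue V R p q a b c)
  let ?Q = "{a, b, c, p, q}" let ?R = "R \<union> clique ?Q"
  have t: "K5tree (V \<union> {a, b, c}) ?R" by (rule K5tree.glue) (use glue in auto)
  have g: "graph_on V R" using K5tree_graph[OF glue(1)] by simp
  have g': "graph_on (V \<union> {a, b, c}) ?R" using K5tree_graph[OF t] by simp
  note G = graph_onD[OF g] note G' = graph_onD[OF g']
  have pq: "p \<in> V" "q \<in> V" "p \<noteq> q" using glue(3) G by auto
  have ne: "p \<notin> {a, b, c}" "q \<notin> {a, b, c}" using glue(5) pq by blast+
  have Q: "card ?Q = 5" using glue(4) ne pq by (auto simp: card_insert_if)
  show ?case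
  proof (cases "x \<in> ?Q \<and> y \<in> ?Q")
    case True
    then show ?thesis using card_clique_common[OF Q, of ?R x y] G'(7)[of x] by blast
  next
    case False
    then have xy: "(x, y) \<in> R" using glue(7) by (auto simp: clique_def)
    have "card V > 2"
    proof (rule ccontr)
      assume "\<not> 2 < card V"
      then have "V = {p, q}" using K5tree_card2[OF glue(1)] glue(3) by auto
      then show False using False xy G(3,4) by auto
    qed
    then have "3 \<le> card (R `` {x} \<inter> R `` {y})" using glue xy by blast
    also have "\<dots> \<le> card (?R `` {x} \<inter> ?R `` {y})" using G'(7) by (intro card_mono) auto
    finally show ?thesis .
  qed
qed

lemma distinct3_of_card:
  assumes "card S = 3" obtains a b c where "S = {a, b, c}" "distinct [a, b, c]"
  using assms by (auto simp: card_3_iff)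

lemma K5tree_add_clique:
  assumes "K5tree V R" "(p, q) \<in> R" "card Q = 5" "p \<in> Q" "q \<in> Q" "Q \<inter> V = {p, q}"
  shows "K5tree (V \<union> Q) (R \<union> clique Q)"
proof -
  have g: "graph_on V R" using K5tree_graph[OF assms(1)] by simp
  have pq: "p \<noteq> q" using assms(2) graph_onD(6)[OF g] by auto
  have "card (Q - {p, q}) = 3" using assms(3-5) pq
    by (subst card_Diff_subset) (auto simp: card_insert_if)
  then obtain a b c where S: "Q - {p, q} = {a, b, c}" "distinct [a, b, c]" by (rule distinct3_of_card)
  have Q: "Q = {a, b, c, p, q}" using S(1) assms(4,5) by auto
  have "{a, b, c} \<inter> V = {}" using S(1) assms(6) by blast
  then have "K5tree (V \<union> {a, b, c}) (R \<union> clique {a, b, c, p, q})"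
    using assms(1,2) S(2) by (intro K5tree.glue)
  moreover have "V \<union> Q = V \<union> {a, b, c}" using Q assms(6) by blast
  ultimately show ?thesis using Q by simp
qed

text \<open>Induction on the second tree, with the first one arbitrary. If \<open>pq\<close> is
  older than the last copy of K5, that copy is glued at the end. Otherwise \<open>pq\<close> lies in
  that copy, which is first glued to the first tree along \<open>pq\<close>; the rest of the second
  tree then meets the enlarged tree in the edge \<open>rs\<close>.\<close>

lemma K5tree_amalgamate:
  assumes "K5tree V2 R2" "K5tree V1 R1" "V1 \<inter> V2 = {p, q}" "(p, q) \<in> R1" "(p, q) \<in> R2"
  shows "K5tree (V1 \<union> V2) (R1 \<union> R2)"
  using assms
proof (induct arbitrary: V1 R1 p q rule: K5tree.induct)
  case (edge p' q')
  have g: "graph_on V1 R1" using K5tree_graph[OF edge(2)] by simp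
  note G = graph_onD[OF g]
  have "{p', q'} = {p, q}" using edge G(6) by auto
  then have "V1 \<union> {p', q'} = V1" "R1 \<union> {(p', q'), (q', p')} = R1"
    using edge(3,4) G(5) by (auto simp: doubleton_eq_iff)
  then show ?case using edge by simp
next
  case (glue V R r s a b c)
  let ?Q = "{a, b, c, r, s}"
  have g: "graph_on V R" using K5tree_graph[OF glue(1)] by simp
  note G = graph_onD[OF g]
  have g1: "graph_on V1 R1" using K5tree_graph[OF glue(6)] by simp
  have rs: "r \<in> V" "s \<in> V" "r \<noteq> s" using glue(3) G by auto
  have ne: "r \<notin> {a, b, c}" "s \<notin> {a, b, c}" using glue(5) rs by blast+
  have Q: "card ?Q = 5" using glue(4) ne rs by (auto simp: card_insert_if)
  have pq: "p \<in> V1" "q \<in> V1" "p \<noteq> q" using glue(8) graph_onD[OF g1] by auto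
  show ?case
  proof (cases "(p, q) \<in> R")
    case True
    then have pqV: "p \<in> V" "q \<in> V" using G by auto
    have "V1 \<inter> V = {p, q}" using glue(7) pqV pq by blast
    then have t: "K5tree (V1 \<union> V) (R1 \<union> R)" using glue(2)[OF glue(6) _ glue(8) True] by blast
    have "{a, b, c} \<inter> (V1 \<union> V) = {}" using glue(5,7) pqV by blast
    then have "K5tree (V1 \<union> V \<union> {a, b, c}) (R1 \<union> R \<union> clique ?Q)"
      using t glue(3,4) by (intro K5tree.glue) auto
    then show ?thesis by (simp add: Un_assoc)
  next
    case False
    then have pqQ: "p \<in> ?Q" "q \<in> ?Q" using glue(9) by (auto simp: clique_def)
    have sub: "?Q \<subseteq> V \<union> {a, b, c}" using rs by auto
    have "?Q \<inter> V1 = {p, q}" using glue(7) pqQ pq sub by blast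
    then have t: "K5tree (V1 \<union> ?Q) (R1 \<union> clique ?Q)"
      by (intro K5tree_add_clique[OF glue(6,8) Q pqQ])
    have QV: "?Q \<inter> V = {r, s}" using glue(5) rs by auto
    have "(V1 \<union> ?Q) \<inter> V = (V1 \<inter> V) \<union> {r, s}" using QV by blast
    moreover have "V1 \<inter> V \<subseteq> {r, s}" using QV glue(7) pqQ by blast
    ultimately have "(V1 \<union> ?Q) \<inter> V = {r, s}" by blast
    moreover have "(r, s) \<in> R1 \<union> clique ?Q" using rs by (auto simp: clique_def)
    ultimately have "K5tree (V1 \<union> ?Q \<union> V) (R1 \<union> clique ?Q \<union> R)"
      using glue(2)[OF t _ _ glue(3)] by blast
    moreover have "V1 \<union> ?Q \<union> V = V1 \<union> (V \<union> {a, b, c})" using rs by blast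
    moreover have "R1 \<union> clique ?Q \<union> R = R1 \<union> (R \<union> clique ?Q)" by blast
    ultimately show ?thesis by simp
  qed
qed

text \<open>One notion for both configurations excluded on the torus: if \<open>e = f\<close>, three
  copies share an edge; otherwise \<open>A\<close> and \<open>C\<close> share at most a vertex and
  are linked through \<open>B\<close>.\<close>

definition K5_chain :: "'a rel \<Rightarrow> 'a set \<Rightarrow> 'a set \<Rightarrow> 'a set \<Rightarrow> 'a set \<Rightarrow> 'a set \<Rightarrow> bool" where
  "K5_chain R A B C e f \<longleftrightarrow> card A = 5 \<and> card B = 5 \<and> card C = 5 \<and> card e = 2 \<and> card f = 2 \<and>
     clique A \<subseteq> R \<and> clique B \<subseteq> R \<and> clique C \<subseteq> R \<and>
     A \<inter> B = e \<and> B \<inter> C = f \<and> A \<inter> C = e \<inter> f"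

lemma K5tree_cases2:
  assumes "K5tree V R" "card V > 2"
  obtains V' R' p q Q where "K5tree V' R'" "(p, q) \<in> R'" "p \<noteq> q" "card Q = 5" "Q \<inter> V' = {p, q}"
    "V = V' \<union> Q" "R = R' \<union> clique Q" "card V = card V' + 3"
  using assms(1)
proof cases
  case (edge p q) then show ?thesis using assms(2) by simp
next
  case (glue V' R' p q a b c)
  have g: "graph_on V' R'" using K5tree_graph[OF glue(3)] by simp
  note G = graph_onD[OF g]
  have pq: "p \<in> V'" "q \<in> V'" "p \<noteq> q" using glue(4) G by auto
  have ne: "p \<notin> {a, b, c}" "q \<notin> {a, b, c}" using glue(6) pq by blast+
  show ?thesis
  proof (rule that[OF glue(3,4) pq(3), of "{a, b, c, p, q}"])
    show "card {a, b, c, p, q} = 5" using glue(5) ne pq by (auto simp: card_insert_if)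
    show "{a, b, c, p, q} \<inter> V' = {p, q}" "V = V' \<union> {a, b, c, p, q}"
      using glue(1,6) pq by auto
    show "card V = card V' + 3" using glue(5,6) G(1) unfolding glue(1) by (subst card_Un_disjoint) auto
  qed (rule glue(2))
qed

text \<open>In the smallest case, taking away the last three copies leaves only an edge. Then
  \<open>A\<close> is the first copy, \<open>B\<close> is attached to it, and \<open>C\<close> is
  attached along an edge of \<open>A\<close> or of \<open>B\<close>; the copy containing this edge
  becomes the middle of the chain.\<close>

lemma K5tree_chain:
  assumes "K5tree V R" "card V \<ge> 11"
  shows "\<exists>A B C e f. K5_chain R A B C e f"
  using assms
proof (induct "card V" arbitrary: V R rule: less_induct)
  case less
  obtain V3 R3 p3 q3 C where s3: "K5tree V3 R3" "(p3, q3) \<in> R3" "p3 \<noteq> q3" "card C = 5" "C \<inter> V3 = {p3, q3}"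
    "V = V3 \<union> C" "R = R3 \<union> clique C" "card V = card V3 + 3"
    by (rule K5tree_cases2[OF less(2)]) (use less(3) in simp)
  show ?case
  proof (cases "card V3 \<ge> 11")
    case True
    then obtain A B C' e f where "K5_chain R3 A B C' e f" using less(1)[OF _ s3(1) True] s3(8) by auto
    then have "K5_chain R A B C' e f" using s3(7) unfolding K5_chain_def by blast
    then show ?thesis by blast
  next
    case False
    have "card R3 + 10 = 6 * card V3" using K5tree_graph[OF s3(1)] by simp
    obtain V2 R2 p2 q2 B where s2: "K5tree V2 R2" "(p2, q2) \<in> R2" "p2 \<noteq> q2" "card B = 5" "B \<inter> V2 = {p2, q2}"
      "V3 = V2 \<union> B" "R3 = R2 \<union> clique B" "card V3 = card V2 + 3"
      by (rule K5tree_cases2[OF s3(1)]) (use less(3) s3(8) in simp)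
    obtain V1 R1 p1 q1 A where s1: "K5tree V1 R1" "(p1, q1) \<in> R1" "p1 \<noteq> q1" "card A = 5" "A \<inter> V1 = {p1, q1}"
      "V2 = V1 \<union> A" "R2 = R1 \<union> clique A" "card V2 = card V1 + 3"
      by (rule K5tree_cases2[OF s2(1)]) (use less(3) s3(8) s2(8) in simp)
    \<comment> \<open>At most 10 vertices, less three private ones for each of two copies; one more
      copy would need 5.\<close>
    have c2: "card V1 \<le> 4" using False s2(8) s1(8) by simp
    have "card V1 \<le> 2"
    proof (rule ccontr)
      assume a: "\<not> card V1 \<le> 2"
      have "2 < card V1" using a by simp
      then obtain V0 R0 p q Q where V0: "K5tree V0 R0" "(p, q) \<in> R0" "p \<noteq> q" "card Q = 5" "Q \<inter> V0 = {p, q}"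
        "V1 = V0 \<union> Q" "R1 = R0 \<union> clique Q" "card V1 = card V0 + 3"
        by (rule K5tree_cases2[OF s1(1)])
      then show False using c2 V0(8) K5tree_finite(2)[OF V0(1)] by simp
    qed
    then have "V1 = {p1, q1}" "R1 = {(p1, q1), (q1, p1)}" using K5tree_card2[OF s1(1) _ s1(2)] by auto
    then have A: "V2 = A" "R2 = clique A" using s1 by (auto simp: clique_def)
    have BA: "B \<inter> A = {p2, q2}" using s2 A by auto
    have "(p3, q3) \<in> clique A \<union> clique B" using s3(2) s2(7) A by simp
    then show ?thesis
    proof
      assume "(p3, q3) \<in> clique B"
      then have "{p3, q3} \<subseteq> B" by (auto simp: clique_def)
      then have "K5_chain R A B C {p2, q2} {p3, q3}"
        unfolding K5_chain_def using s3(3-7) s2(3-7) s1(4) A BA by auto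
      then show ?thesis by blast
    next
      assume "(p3, q3) \<in> clique A"
      then have "{p3, q3} \<subseteq> A" by (auto simp: clique_def)
      then have "K5_chain R B A C {p2, q2} {p3, q3}"
        unfolding K5_chain_def using s3(3-7) s2(3-7) s1(4) A BA by auto
      then show ?thesis by blast
    qed
  qed
qed


section \<open>The extremal theorem for graphs without a K33 minor\<close>

lemma K33_minor_dels: "K33_minor (V - S) (dels S R) \<Longrightarrow> K33_minor V R"
  by (erule K33_minor_mono) (auto simp: dels_def)

lemma clique_minus: "clique (S - T) = dels T (clique S)"
  by (auto simp: clique_def dels_def)

text \<open>The critical case of the contraction step, where the edge count leaves no slack. The
  private part of a K5 glued last is deleted from the uncontracted graph. What remains is smaller
  and at most one edge too sparse; once that edge is supplied, the induction hypothesis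
  \<open>IH\<close> makes it a tree of K5s, where \<open>uv\<close> would have three common
  neighbours instead of two.\<close>

lemma K33_minor_of_contr_K5tree:
  fixes V :: "'a set"
  assumes g: "graph_on V R" and uv: "(u, v) \<in> R"
    and t: "K5tree (V - {v}) (contr u v R)" and cm: "card (R `` {u} \<inter> R `` {v}) = 2"
    and IH: "\<And>(W :: 'a set) S. graph_on W S \<Longrightarrow> card W < card V \<Longrightarrow> 2 \<le> card W \<Longrightarrow> 6 * card W \<le> card S + 10 \<Longrightarrow>
        \<not> K33_minor W S \<Longrightarrow> K5tree W S"
  shows "K33_minor V R"
proof (rule ccontr)
  assume nm: "\<not> K33_minor V R"
  note G = graph_onD[OF g]
  define N where "N = R `` {u} \<inter> R `` {v}"
  have fN: "finite N" using G(7) by (simp add: N_def)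
  have N: "N \<subseteq> V" "u \<notin> N" "v \<notin> N" using G(4,6) by (auto simp: N_def)
  have uvV: "u \<in> V" "v \<in> V" "u \<noteq> v" using uv G by auto
  have "card (N \<union> {u, v}) \<le> card V" using N uvV G(1) by (intro card_mono) auto
  moreover have "card (N \<union> {u, v}) = 4"
    using cm[folded N_def] N uvV fN by (subst card_Un_disjoint) auto
  ultimately have n4: "4 \<le> card V" by simp
  have nV: "card (V - {v}) = card V - 1" using uvV G(1) by simp
  obtain V' R' p0 q0 Q where s: "K5tree V' R'" "(p0, q0) \<in> R'" "p0 \<noteq> q0" "card Q = 5" "Q \<inter> V' = {p0, q0}"
      "V - {v} = V' \<union> Q" "contr u v R = R' \<union> clique Q" "card (V - {v}) = card V' + 3"
    by (rule K5tree_cases2[OF t]) (use nV n4 in simp)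
  \<comment> \<open>The vertices private to the last copy; in the contracted graph all their
    neighbours lie in \<open>Q\<close>.\<close>
  define P where "P = Q - {p0, q0}"
  have fQ: "finite Q" using s(4) by (metis card.infinite zero_neq_numeral)
  have pqQ: "p0 \<in> Q" "q0 \<in> Q" using s(5) by auto
  have P: "card P = 3" "P \<inter> V' = {}" "P \<subseteq> Q" "finite P" "P \<subseteq> V" "v \<notin> P"
    using s(3-6) pqQ fQ unfolding P_def by (auto simp: card_Diff_subset)
  have g': "graph_on V' R'" using K5tree_graph[OF s(1)] by simp
  have vQ: "v \<notin> Q" using s(6) by auto
  have nbP: "y \<in> Q" if "x \<in> P" "(x, y) \<in> contr u v R" for x y
    using that P s(7) graph_onD(3)[OF g'] by (auto simp: clique_def)
  have cQ: "(x, y) \<in> contr u v R" if "x \<in> Q" "y \<in> Q" "x \<noteq> y" for x y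
    using that s(7) by (auto simp: clique_def)
  \<comment> \<open>With two common neighbours in \<open>Q\<close>, the vertices of \<open>Q\<close>
    together with \<open>v\<close> form a split K5.\<close>
  have few: "card (N \<inter> Q) \<le> 1" if "u \<in> Q"
  proof (rule ccontr)
    assume a: "\<not> card (N \<inter> Q) \<le> 1"
    have eq: "N \<inter> (Q - {u}) = N \<inter> Q" using N by auto
    have "K33_minor V R"
    proof (rule K33_minor_split_clique[OF g uv, of "Q - {u}"])
      show "v \<notin> Q - {u}" using vQ by simp
      show "card (Q - {u}) = 4" using that s(4) by simp
      show "clique (Q - {u}) \<subseteq> R" using cQ vQ unfolding clique_sub
        by (auto simp: contr_def dels_def)
      show "(u, x) \<in> R \<or> (v, x) \<in> R" if "x \<in> Q - {u}" for x
        using cQ[of u x] that \<open>u \<in> Q\<close> by (auto simp: contr_def dels_def)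
      show "2 \<le> card (R `` {u} \<inter> R `` {v} \<inter> (Q - {u}))" using a eq unfolding N_def by simp
    qed simp
    then show False using nm by simp
  qed
  have uP: "u \<notin> P"
  proof
    assume "u \<in> P"
    then have "N \<subseteq> Q" using nbP[of u] N by (auto simp: N_def contr_def)
    then have "N \<inter> Q = N" by auto
    then show False using few \<open>u \<in> P\<close> P(3) cm[folded N_def] by auto
  qed
  define W where "W = V - P" define S where "S = dels P R"
  have gW: "graph_on W S" unfolding W_def S_def by (rule graph_on_dels[OF g])
  have uvS: "(u, v) \<in> S" using uv uP P(6) by (auto simp: S_def dels_def)
  have cW: "card W = card V - 3" unfolding W_def using P by (simp add: card_Diff_subset)
  have n3: "card V \<ge> 6" using s(8) nV K5tree_finite(2)[OF s(1)] by simp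
  have cS: "contr u v S = R'"
  proof -
    have "contr u v S = dels P (contr u v R)"
      using uP P(6) by (auto simp: S_def contr_def dels_def)
    also have "\<dots> = dels P R' \<union> clique {p0, q0}"
    proof -
      have "Q - P = {p0, q0}" using pqQ by (auto simp: P_def)
      then have "dels P (clique Q) = clique {p0, q0}" using clique_minus[of Q P] by simp
      then show ?thesis unfolding s(7) by (auto simp: dels_def)
    qed
    also have "\<dots> = R'"
      using P(2) graph_onD(3,4,5)[OF g'] s(2) by (auto simp: dels_def clique_def)
    finally show ?thesis .
  qed
  have NS: "S `` {u} \<inter> S `` {v} = N - P" using uP P(6) by (auto simp: S_def dels_def N_def)
  \<comment> \<open>Deleting \<open>P\<close> commutes with the contraction, so the tight count of
    \<open>R'\<close> determines the count of \<open>S\<close>: tight if both common neighbours of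
    \<open>u\<close> and \<open>v\<close> survive, one edge short if one of them is lost.\<close>
  have "card S = card R' + 2 + 2 * card (N - P)" using card_contr[OF gW uvS] cS NS by simp
  moreover have "card R' + 10 = 6 * card V'" using K5tree_graph[OF s(1)] by simp
  moreover have "card V' + 1 = card W" using s(8) nV cW n3 by simp
  ultimately have S: "card S + 14 = 6 * card W + 2 * card (N - P)" by simp
  have nmW: "\<not> K33_minor W S" using nm K33_minor_dels unfolding W_def S_def by blast
  have cNP: "card N = card (N - P) + card (N \<inter> P)" using fN by (metis Int_commute card_Diff_subset_Int card_mono finite_Int inf_le1 le_add_diff_inverse2)
  have key: False if "K5tree W S'" "(u, v) \<in> S'" "card (S' `` {u} \<inter> S' `` {v}) \<le> 2" "card W > 2" for S'
    using K5tree_common[OF that(1,4,2)] that(3) by simp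
  have W3: "card W > 2" using n3 cW by simp
  have NP1: "card (N \<inter> P) \<le> 1"
  proof (cases "u \<in> Q")
    case True
    have "card (N \<inter> P) \<le> card (N \<inter> Q)" using P(3) fN by (intro card_mono) auto
    then show ?thesis using few True by simp
  next
    case False
    have "N \<inter> P = {}"
    proof (rule ccontr)
      assume "N \<inter> P \<noteq> {}"
      then obtain x where x: "x \<in> N" "x \<in> P" by auto
      then have "(x, u) \<in> contr u v R" using N P(6) uvV G(5) by (auto simp: N_def contr_def dels_def)
      then show False using nbP x False by blast
    qed
    then show ?thesis by simp
  qed
  consider "card (N \<inter> P) = 0" | "card (N \<inter> P) = 1" using NP1 by linarith
  then show False
  proof cases
    case 1
    then have NP: "card (N - P) = 2" using cNP cm[folded N_def] by simp
    then have "K5tree W S" using S W3 cW n3 nmW by (intro IH[OF gW]) auto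
    then show False using key[of S] uvS NS NP W3 by simp
  next
    case 2
    then have NP: "card (N - P) = 1" using cNP cm[folded N_def] by simp
    obtain a where a: "N \<inter> P = {a}" using 2 by (auto simp: card_1_singleton_iff)
    then have aP: "a \<in> P" and aR: "(u, a) \<in> R" "(v, a) \<in> R" by (auto simp: N_def)
    have auv: "a \<noteq> u" "a \<noteq> v" using aP uP P(6) by auto
    have "(a, u) \<in> contr u v R" using aR auv G(5) uvV by (auto simp: contr_def dels_def)
    then have uQ: "u \<in> Q" using nbP aP by blast
    then have "u \<in> {p0, q0}" using uP unfolding P_def by auto
    \<comment> \<open>\<open>u\<close> is one end of the edge along which \<open>Q\<close> was
      glued; \<open>q\<close> is the other.\<close>
    then obtain q where q: "{p0, q0} = {u, q}" "u \<noteq> q" using s(3) by auto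
    have qQ: "q \<in> Q" "q \<notin> P" using pqQ q(1) unfolding P_def by auto
    have "N \<inter> Q = {a}"
    proof -
      have "{a} \<subseteq> N \<inter> Q" using a P(3) by auto
      then show ?thesis using few[OF uQ] fN by (metis card_1_singleton_iff card_seteq finite_Int One_nat_def card.empty card_insert_disjoint empty_iff finite.emptyI)
    qed
    then have qN: "q \<notin> N" using qQ aP by auto
    have qv: "q \<noteq> v" using qQ vQ by auto
    have qa: "(a, q) \<in> R"
      using cQ[of a q] aP P(3) qQ auv qv q(2) by (auto simp: contr_def dels_def)
    obtain z where z: "N - P = {z}" using NP by (auto simp: card_1_singleton_iff)
    text \<open>Contracting an edge from \<open>a\<close> to the end of \<open>uv\<close> not adjacent to \<open>q\<close> makes up for the
      one edge missing for the induction hypothesis.\<close>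
    have main: False if xy: "{x, y} = {u, v}" "(x, q) \<notin> R" for x y
    proof -
      have xW: "x \<noteq> a" "x \<notin> P" "x \<noteq> q" using xy(1) auv uP P(6) q(2) qv by (auto simp: doubleton_eq_iff)
      have xa: "(x, a) \<in> R" using xy(1) aR by (auto simp: doubleton_eq_iff)
      let ?T = "dels (P - {a}) R"
      have gT: "graph_on (V - (P - {a})) ?T" by (rule graph_on_dels[OF g])
      have xaT: "(x, a) \<in> ?T" using xa xW by (auto simp: dels_def)
      have Wa: "V - (P - {a}) - {a} = W" using aP by (auto simp: W_def)
      define S' where "S' = S \<union> {(x, q), (q, x)}"
      \<comment> \<open>With the other private vertices gone, \<open>a\<close> sees only
        \<open>u\<close>, \<open>v\<close> and \<open>q\<close>, so contracting \<open>xa\<close>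
        adds exactly the edge \<open>xq\<close> to \<open>S\<close>.\<close>
      have na: "?T `` {a} = {u, v, q}"
      proof -
        have "y \<in> {u, v, q}" if "(a, y) \<in> ?T" for y
        proof (cases "y = v")
          case False
          have "(a, y) \<in> R" "y \<notin> P - {a}" "y \<noteq> a" using that G(6) by (auto simp: dels_def)
          then have "(a, y) \<in> contr u v R" using False auv by (auto simp: contr_def dels_def)
          then have "y \<in> Q - P" using nbP[OF aP] \<open>y \<notin> P - {a}\<close> \<open>y \<noteq> a\<close> by auto
          then show ?thesis using q(1) unfolding P_def by auto
        qed simp
        moreover have "(a, u) \<in> ?T" "(a, v) \<in> ?T" "(a, q) \<in> ?T"
          using aR G(5) uP P(6) qa qQ by (auto simp: dels_def)
        ultimately show ?thesis by blast
      qed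
      have S': "contr x a ?T = S'"
      proof -
        have "dels {a} ?T = S" using aP by (auto simp: dels_def S_def)
        moreover have "?T `` {a} - {x} = {y, q}" using na xy(1) xW q(2) qv uvV(3) by (auto simp: doubleton_eq_iff)
        moreover have "(x, y) \<in> S" "(y, x) \<in> S" using uvS graph_onD(5)[OF gW uvS] xy(1) by (auto simp: doubleton_eq_iff)
        ultimately show ?thesis unfolding contr_def S'_def by auto
      qed
      have g': "graph_on W S'" using graph_on_contr[OF gT xaT] Wa S' by simp
      have "\<not> K33_minor W S'"
      proof
        assume "K33_minor W S'"
        then have "K33_minor (V - (P - {a})) ?T" using K33_minor_contr[OF gT xaT] Wa S' by simp
        then show False using K33_minor_dels nm by blast
      qed
      moreover have "card S' = card S + 2"
      proof -
        have "(x, q) \<notin> S" "(q, x) \<notin> S" using xy(2) G(5) by (auto simp: S_def dels_def)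
        then show ?thesis unfolding S'_def using graph_onD(2)[OF gW] xW by (subst card_Un_disjoint) auto
      qed
      ultimately have "K5tree W S'" using S NP W3 cW n3 by (intro IH[OF g']) auto
      moreover have "(u, v) \<in> S'" using uvS by (simp add: S'_def)
      \<comment> \<open>Besides the surviving common neighbour \<open>z\<close>, only
        \<open>q\<close> can become one through the new edge.\<close>
      moreover have "card (S' `` {u} \<inter> S' `` {v}) \<le> 2"
      proof -
        have "S' `` {u} \<inter> S' `` {v} \<subseteq> {z, q}"
          using NS z xy(1) xW q(2) qv uvV(3) by (auto simp: S'_def doubleton_eq_iff)
        then have "card (S' `` {u} \<inter> S' `` {v}) \<le> card {z, q}" by (intro card_mono) auto
        also have "\<dots> \<le> 2" by (simp add: card_insert_if)
        finally show ?thesis .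
      qed
      ultimately show False using key[of S'] W3 by blast
    qed
    have "(u, q) \<notin> R \<or> (v, q) \<notin> R" using qN by (auto simp: N_def)
    then show False using main[of u v] main[of v u] by auto
  qed
qed

lemma sum_card_Image:
  assumes "graph_on V R" shows "(\<Sum>x\<in>V. card (R `` {x})) = card R"
proof -
  note G = graph_onD[OF assms]
  have "R = Sigma V (\<lambda>x. R `` {x})" using G(3) by auto
  then have "card R = card (Sigma V (\<lambda>x. R `` {x}))" by simp
  also have "\<dots> = (\<Sum>x\<in>V. card (R `` {x}))" using G(1,7) by (intro card_SigmaI) auto
  finally show ?thesis by simp
qed

text \<open>Among the five neighbours of \<open>v\<close>, each is nonadjacent to at most one other.
  Take \<open>y1\<close>, \<open>y2\<close> to be a nonadjacent pair, or any pair if there is none: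
  both are adjacent to the remaining three, and so is \<open>v\<close>.\<close>

lemma K33_minor_apex5:
  assumes g: "graph_on V R" and c5: "card (R `` {v}) = 5"
    and cm: "\<And>x. (v, x) \<in> R \<Longrightarrow> 3 \<le> card (R `` {v} \<inter> R `` {x})"
  shows "K33_minor V R"
proof -
  note G = graph_onD[OF g]
  define N where "N = R `` {v}"
  have fN: "finite N" using G(7) by (simp add: N_def)
  have N5: "card N = 5" using c5 by (simp add: N_def)
  have one: "y = z" if "x \<in> N" "y \<in> N" "z \<in> N" "x \<noteq> y" "x \<noteq> z" "(x, y) \<notin> R" "(x, z) \<notin> R" for x y z
  proof (rule ccontr)
    assume "y \<noteq> z"
    have "N \<inter> R `` {x} \<subseteq> N - {x, y, z}" using that G(6) by auto
    then have "card (N \<inter> R `` {x}) \<le> card (N - {x, y, z})" using fN by (intro card_mono) auto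
    also have "\<dots> = 2" using that \<open>y \<noteq> z\<close> N5 fN by (subst card_Diff_subset) auto
    finally show False using cm[of x] that(1) by (simp add: N_def)
  qed
  obtain y1 y2 where y: "y1 \<in> N" "y2 \<in> N" "y1 \<noteq> y2"
    and all: "\<And>x. x \<in> N - {y1, y2} \<Longrightarrow> (y1, x) \<in> R \<and> (y2, x) \<in> R"
  proof (cases "\<exists>y1\<in>N. \<exists>y2\<in>N. y1 \<noteq> y2 \<and> (y1, y2) \<notin> R")
    case True
    then obtain y1 y2 where y: "y1 \<in> N" "y2 \<in> N" "y1 \<noteq> y2" "(y1, y2) \<notin> R" by auto
    then have y': "(y2, y1) \<notin> R" using G(5) by blast
    have "(y1, x) \<in> R \<and> (y2, x) \<in> R" if x: "x \<in> N - {y1, y2}" for x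
    proof
      show "(y1, x) \<in> R" using one[of y1 y2 x] y x by blast
      show "(y2, x) \<in> R" using one[of y2 y1 x] y(1,2,3) y' x by blast
    qed
    then show ?thesis using that[OF y(1-3)] by blast
  next
    case False
    then have F: "(a, b) \<in> R" if "a \<in> N" "b \<in> N" "a \<noteq> b" for a b using that by blast
    have "2 \<le> card N" using N5 by simp
    then obtain y1 y2 where y: "y1 \<in> N" "y2 \<in> N" "y1 \<noteq> y2" by (rule card_ge_obtain2)
    have "(y1, x) \<in> R \<and> (y2, x) \<in> R" if x: "x \<in> N - {y1, y2}" for x
      using F[of y1 x] F[of y2 x] x y by auto
    then show ?thesis by (rule that[OF y])
  qed
  have "card (N - {y1, y2}) = 3" using y fN N5 by (subst card_Diff_subset) auto
  then obtain z1 z2 z3 where z: "N - {y1, y2} = {z1, z2, z3}" "distinct [z1, z2, z3]" by (rule distinct3_of_card)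
  have zN: "z \<in> N" "z \<noteq> y1" "z \<noteq> y2" "(y1, z) \<in> R" "(y2, z) \<in> R" if "z \<in> {z1, z2, z3}" for z
    using that z(1) all by blast+
  have vN: "v \<notin> N" using G(6) by (simp add: N_def)
  show ?thesis
  proof (rule K33_minorI[OF g, of y1 y2 z1 z2 z3 "{v}"])
    show "distinct [y1, y2, z1, z2, z3]" using y z(2) zN(2,3) by auto
    show "{v} \<subseteq> V" using y(1) G(3) by (auto simp: N_def)
    show "{v} \<inter> {y1, y2, z1, z2, z3} = {}" using vN y zN(1) by auto
    show "{y1, y2} \<times> {z1, z2, z3} \<subseteq> R" using zN(4,5) by auto
    show "\<exists>c\<in>{v}. (c, x) \<in> R" if "x \<in> {z1, z2, z3}" for x using zN(1)[OF that] by (simp add: N_def)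
  qed simp
qed

lemma conn_component:
  assumes "sym R" "z \<in> W"
  defines "C \<equiv> {y. (z, y) \<in> (Restr R W)\<^sup>*}"
  shows "conn R C" "C \<subseteq> W" "z \<in> C" "\<And>x y. x \<in> C \<Longrightarrow> (x, y) \<in> R \<Longrightarrow> y \<in> W \<Longrightarrow> y \<in> C"
proof -
  show z: "z \<in> C" by (simp add: C_def)
  show CW: "C \<subseteq> W"
  proof
    fix y assume "y \<in> C"
    then have "(z, y) \<in> (Restr R W)\<^sup>*" by (simp add: C_def)
    then show "y \<in> W" using assms(2) by (induct rule: rtrancl_induct) auto
  qed
  show cl: "y \<in> C" if "x \<in> C" "(x, y) \<in> R" "y \<in> W" for x y
  proof -
    have "(z, x) \<in> (Restr R W)\<^sup>*" "(x, y) \<in> Restr R W" using that CW by (auto simp: C_def)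
    then show ?thesis unfolding C_def by (auto intro: rtrancl_into_rtrancl)
  qed
  have zy: "(z, y) \<in> (Restr R C)\<^sup>*" if "y \<in> C" for y
  proof -
    have "(z, y) \<in> (Restr R W)\<^sup>*" using that by (simp add: C_def)
    then show ?thesis
    proof (induct rule: rtrancl_induct)
      case (step x y)
      have "x \<in> C" using step(1) by (simp add: C_def)
      then have "(x, y) \<in> Restr R C" using step(2) cl by auto
      then show ?case using step(3) by (auto intro: rtrancl_into_rtrancl)
    qed simp
  qed
  have "sym (Restr R C)" using assms(1) by (auto simp: sym_def)
  then have "sym ((Restr R C)\<^sup>*)" by (rule sym_rtrancl)
  then have "(y, z) \<in> (Restr R C)\<^sup>*" if "y \<in> C" for y using zy[OF that] by (auto dest: symD)
  then show "conn R C" using zy z unfolding conn_def by (blast intro: rtrancl_trans)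
qed

text \<open>A component of the complement of a \<open>K\<^sub>5\<close> is attached to at most two of its vertices, which
  splits the graph along an edge of the \<open>K\<^sub>5\<close>.\<close>

lemma clique5_separation:
  assumes g: "graph_on V R" and Q: "card Q = 5" "clique Q \<subseteq> R" "Q \<subseteq> V" and z: "z \<in> V" "z \<notin> Q"
    and nm: "\<not> K33_minor V R"
  obtains V1 V2 p q where "V1 \<union> V2 = V" "V1 \<inter> V2 = {p, q}" "(p, q) \<in> R" "card V1 < card V" "card V2 < card V"
    "R = Restr R V1 \<union> Restr R V2"
proof -
  note G = graph_onD[OF g]
  have fQ: "finite Q" using Q(1) by (metis card.infinite zero_neq_numeral)
  define C where "C = {y. (z, y) \<in> (Restr R (V - Q))\<^sup>*}"
  have "sym R" using g by (simp add: graph_on_def)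
  note C = conn_component[OF this, of z "V - Q", folded C_def]
  have zVQ: "z \<in> V - Q" using z by simp
  define At where "At = {q \<in> Q. \<exists>c\<in>C. (c, q) \<in> R}"
  \<comment> \<open>Three attached vertices would be one side of a K33, with \<open>C\<close> and
    the other two vertices of \<open>Q\<close> as the opposite side.\<close>
  have "card At \<le> 2"
  proof (rule ccontr)
    assume "\<not> card At \<le> 2"
    then obtain T where T: "T \<subseteq> At" "card T = 3" by (metis ex_card not_less_eq_eq numeral_2_eq_2 numeral_3_eq_3)
    obtain y1 y2 y3 where y: "T = {y1, y2, y3}" "distinct [y1, y2, y3]" using distinct3_of_card[OF T(2)] by metis
    have TQ: "T \<subseteq> Q" using T(1) by (auto simp: At_def)
    have "card (Q - T) = 2" using TQ T(2) Q(1) fQ by (simp add: card_Diff_subset finite_subset)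
    then obtain x1 x2 where x: "Q - T = {x1, x2}" "x1 \<noteq> x2" by (meson card_2_iff)
    have xQ: "x1 \<in> Q" "x2 \<in> Q" "x1 \<notin> T" "x2 \<notin> T" using x(1) by auto
    have "K33_minor V R"
    proof (rule K33_minorI[OF g, of x1 x2 y1 y2 y3 C])
      show "distinct [x1, x2, y1, y2, y3]" using x(2) xQ y by auto
      show "C \<subseteq> V" "C \<inter> {x1, x2, y1, y2, y3} = {}" using C(2)[OF zVQ] xQ TQ y(1) by auto
      show "{x1, x2} \<times> {y1, y2, y3} \<subseteq> R" using Q(2) xQ TQ y(1) unfolding clique_sub by auto
      show "\<exists>c\<in>C. (c, y) \<in> R" if "y \<in> {y1, y2, y3}" for y using that T(1) y(1) by (auto simp: At_def)
      show "conn R C" by (rule C(1)[OF zVQ])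
    qed
    then show False using nm by simp
  qed
  \<comment> \<open>The attachment set is padded to exactly two vertices, so that the cut is always
    an edge of the K5.\<close>
  obtain D where D: "At \<subseteq> D" "D \<subseteq> Q" "card D = 2"
    using exists_subset_between[of At 2 Q] \<open>card At \<le> 2\<close> Q(1) fQ by (auto simp: At_def)
  obtain p q where pq: "D = {p, q}" "p \<noteq> q" using D(3) by (meson card_2_iff)
  have pqQ: "p \<in> Q" "q \<in> Q" using pq D by auto
  have CV: "C \<subseteq> V" "C \<inter> Q = {}" using C(2)[OF zVQ] by auto
  have nb: "y \<in> C \<or> y \<in> {p, q}" if "x \<in> C" "(x, y) \<in> R" for x y
    using C(4)[OF zVQ that] that G(4)[OF that(2)] D(1) pq(1) by (auto simp: At_def)
  show ?thesis
  proof (rule that[of "V - C" "C \<union> {p, q}" p q])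
    show "V - C \<union> (C \<union> {p, q}) = V" using CV pqQ Q(3) by auto
    show "(V - C) \<inter> (C \<union> {p, q}) = {p, q}" using CV pqQ Q(3) by auto
    show "(p, q) \<in> R" using Q(2) pqQ pq(2) by (auto simp: clique_sub)
    show "card (V - C) < card V" using C(3) z G(1) by (intro psubset_card_mono) auto
    have "card (Q - {p, q}) = 3" using pqQ pq(2) Q(1) fQ by (subst card_Diff_subset) auto
    then have "Q - {p, q} \<noteq> {}" by (metis card.empty zero_neq_numeral)
    then show "card (C \<union> {p, q}) < card V" using CV pqQ Q(3) G(1) by (intro psubset_card_mono) auto
    show "R = Restr R (V - C) \<union> Restr R (C \<union> {p, q})"
    proof -
      have "(x, y) \<in> Restr R (V - C) \<union> Restr R (C \<union> {p, q})" if "(x, y) \<in> R" for x y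
        using that nb[of x y] nb[of y x] G(3,4,5)[OF that] by blast
      then show ?thesis by auto
    qed
  qed
qed

lemma graph_on_Restr: "graph_on V R \<Longrightarrow> W \<subseteq> V \<Longrightarrow> graph_on W (Restr R W)"
  unfolding graph_on_def sym_def irrefl_def by (auto intro: finite_subset)

text \<open>The outer induction is on vertices, the inner one on arcs. If every edge lies in three
  triangles, the inner hypothesis bounds the edges from above, so some vertex has degree at most 5,
  and its triangles make the degree at least 4. Degree 5 yields a K33. Degree 4 yields a K5, which
  is the whole graph or provides an edge along which the graph splits into two smaller ones.\<close>

theorem K5tree_if_many_edges:
  assumes "graph_on V R" "2 \<le> card V" "6 * card V \<le> card R + 10" "\<not> K33_minor V R"
  shows "K5tree V R"
  using assms
proof (induct "card V" arbitrary: V R rule: less_induct)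
  case less
  have IH: "K5tree W S" if "graph_on W S" "card W < card V" "2 \<le> card W"
    "6 * card W \<le> card S + 10" "\<not> K33_minor W S" for W :: "'a set" and S
    using less(1)[OF that(2,1,3-5)] .
  show ?case using less(2-5)
  proof (induct "card R" arbitrary: R rule: less_induct)
    case (less R)
    note g = less(2) note G = graph_onD[OF g]
    have mono: "\<not> K33_minor W S" if "W \<subseteq> V" "S \<subseteq> R" for W S
      using less(5) that K33_minor_mono by blast
    have "R \<noteq> {}" using less(3,4) by auto
    then obtain x0 y0 where e0: "(x0, y0) \<in> R" by auto
    consider (two) "card V = 2"
      | (contr) "card V > 2" "\<exists>u v. (u, v) \<in> R \<and> card (R `` {u} \<inter> R `` {v}) \<le> 2"
      | (tri) "\<And>u v. (u, v) \<in> R \<Longrightarrow> 3 \<le> card (R `` {u} \<inter> R `` {v})"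
      using less(3) by (metis le_neq_implies_less not_less_eq_eq numeral_2_eq_2 numeral_3_eq_3)
    then show ?case
    proof cases
      case two
      have e: "x0 \<in> V" "y0 \<in> V" "x0 \<noteq> y0" using e0 G by auto
      have V: "{x0, y0} = V" using two e G(1) by (intro card_seteq) auto
      then have "R \<subseteq> {(x0, y0), (y0, x0)}" using G(3,4,6) by fastforce
      then have "R = {(x0, y0), (y0, x0)}" using e0 G(5) by blast
      then show ?thesis using V e(3) K5tree.edge[of x0 y0] by simp
    next
      case contr
      then obtain u v where uv: "(u, v) \<in> R" "card (R `` {u} \<inter> R `` {v}) \<le> 2" by auto
      have uvV: "u \<in> V" "v \<in> V" "u \<noteq> v" using uv(1) G by auto
      have gc: "graph_on (V - {v}) (contr u v R)" by (rule graph_on_contr[OF g uv(1)])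
      have nmc: "\<not> K33_minor (V - {v}) (contr u v R)" using K33_minor_contr[OF g uv(1)] less(5) by blast
      have cV: "card (V - {v}) + 1 = card V" using uvV(2) G(1) by (metis Suc_eq_plus1 card_Suc_Diff1)
      note cc = card_contr[OF g uv(1)]
      have c2: "2 \<le> card (V - {v})" using cV contr(1) by linarith
      have t: "K5tree (V - {v}) (contr u v R)"
        using cc cV uv(2) less(4) by (intro IH[OF gc _ c2 _ nmc]) linarith+
      then have "card (contr u v R) + 10 = 6 * card (V - {v})" using K5tree_graph by blast
      then have "card (R `` {u} \<inter> R `` {v}) = 2" using cc cV uv(2) less(4) by linarith
      then have "K33_minor V R" using IH by (intro K33_minor_of_contr_K5tree[OF g uv(1) t]) blast+
      then show ?thesis using less(5) by simp
    next
      case tri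
      \<comment> \<open>With a surplus of more than one edge, deleting an edge leaves a surplus; but
        the inner hypothesis turns the remaining graph into a tree of K5s, which has none.\<close>
      have small: "card R + 10 \<le> 6 * card V + 2"
      proof (rule ccontr)
        assume a: "\<not> ?thesis"
        define R' where "R' = R - {(x0, y0), (y0, x0)}"
        have ne: "x0 \<noteq> y0" using e0 G(6) by auto
        have "card R' = card R - card {(x0, y0), (y0, x0)}"
          unfolding R'_def using e0 G(5) by (intro card_Diff_subset) auto
        then have cR': "card R' + 2 = card R" using ne a less(3) by simp
        have "graph_on V R'" using g unfolding graph_on_def R'_def sym_def irrefl_def by auto
        then have "K5tree V R'"
          using less(1)[of R'] cR' a less(3) mono[of V R'] unfolding R'_def by simp
        then show False using K5tree_graph cR' a by fastforce
      qed
      have "\<exists>v\<in>V. card (R `` {v}) \<le> 5"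
      proof (rule ccontr)
        assume a: "\<not> ?thesis"
        have "6 \<le> card (R `` {x})" if "x \<in> V" for x
          using that a by fastforce
        then have "(\<Sum>x\<in>V. 6) \<le> (\<Sum>x\<in>V. card (R `` {x}))" by (intro sum_mono) blast
        then show False using sum_card_Image[OF g] small by simp
      qed
      then obtain v where v: "v \<in> V" "card (R `` {v}) \<le> 5" by auto
      have n5: "5 \<le> card V"
      proof -
        have "R `` {x0} \<inter> R `` {y0} \<subseteq> V - {x0, y0}" using G(4,6) by auto
        then have "card (R `` {x0} \<inter> R `` {y0}) \<le> card (V - {x0, y0})" using G(1) by (intro card_mono) auto
        moreover have "card (V - {x0, y0}) = card V - 2"
          using G(3,4)[OF e0] e0 G(6) by (subst card_Diff_subset) (auto simp: card_insert_if)
        ultimately show ?thesis using tri[OF e0] by linarith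
      qed
      \<comment> \<open>Discarding an isolated vertex would raise the count above the tight
        one.\<close>
      have "R `` {v} \<noteq> {}"
      proof
        assume a: "R `` {v} = {}"
        have "graph_on (V - {v}) (dels {v} R)" by (rule graph_on_dels[OF g])
        moreover have "dels {v} R = R" using a G(5) by (auto simp: dels_def)
        moreover have cV: "card (V - {v}) + 1 = card V" using v(1) G(1) by (metis Suc_eq_plus1 card_Suc_Diff1)
        ultimately have "K5tree (V - {v}) R" using less(4) n5 mono[of "V - {v}" R] by (intro IH) auto
        then show False using K5tree_graph[of "V - {v}" R] cV less(4) by simp
      qed
      then obtain w where w: "(v, w) \<in> R" by auto
      have "card (R `` {v} \<inter> R `` {x}) \<le> card (R `` {v} - {x})" for x
        using G(6,7) by (intro card_mono) auto
      then have d3: "3 \<le> card (R `` {v} - {x})" if "(v, x) \<in> R" for x using tri[OF that] by (meson order_trans)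
      have "card (R `` {v} - {w}) = card (R `` {v}) - 1" using w G(7) by simp
      then have "card (R `` {v}) = 4 \<or> card (R `` {v}) = 5" using d3[OF w] v(2) by linarith
      then show ?thesis
      proof
        assume "card (R `` {v}) = 5"
        then have "K33_minor V R" using tri by (intro K33_minor_apex5[OF g]) auto
        then show ?thesis using less(5) by simp
      next
        assume d4: "card (R `` {v}) = 4"
        define Q where "Q = insert v (R `` {v})"
        have vN: "v \<notin> R `` {v}" using G(6) by auto
        have Q5: "card Q = 5" unfolding Q_def using d4 vN G(7) by simp
        have QV: "Q \<subseteq> V" using v(1) G(4) by (auto simp: Q_def)
        \<comment> \<open>A neighbour with three common neighbours among the four is adjacent to all
          the others.\<close>
        have NN: "(x, y) \<in> R" if "(v, x) \<in> R" "(v, y) \<in> R" "x \<noteq> y" for x y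
        proof -
          have "R `` {v} \<inter> R `` {x} = R `` {v} - {x}"
            using tri[OF that(1)] d4 that(1) G(6,7) by (intro card_seteq) auto
          then show ?thesis using that by blast
        qed
        have cQ: "clique Q \<subseteq> R" using NN G(5) unfolding clique_sub Q_def by blast
        show ?thesis
        proof (cases "Q = V")
          case True
          have "R \<subseteq> clique Q" using True G(3,4,6) by (auto simp: clique_def)
          then have R: "R = clique Q" using cQ by simp
          have "K5tree {v, w} {(v, w), (w, v)}" using w G(6) by (intro K5tree.edge) auto
          then have "K5tree ({v, w} \<union> Q) ({(v, w), (w, v)} \<union> clique Q)"
            by (rule K5tree_add_clique[of _ _ v w]) (use Q5 w in \<open>auto simp: Q_def\<close>)
          moreover have "{v, w} \<union> Q = Q" "{(v, w), (w, v)} \<union> clique Q = clique Q"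
            using w G(6) by (auto simp: Q_def clique_def)
          ultimately show ?thesis using True R by simp
        next
          case False
          then obtain z where z: "z \<in> V" "z \<notin> Q" using QV by auto
          obtain V1 V2 p q where s: "V1 \<union> V2 = V" "V1 \<inter> V2 = {p, q}" "(p, q) \<in> R"
            "card V1 < card V" "card V2 < card V" "R = Restr R V1 \<union> Restr R V2"
            by (rule clique5_separation[OF g Q5 cQ QV z less(5)])
          let ?R1 = "Restr R V1" let ?R2 = "Restr R V2"
          have pq: "p \<noteq> q" using s(3) G(6) by auto
          have sub: "V1 \<subseteq> V" "V2 \<subseteq> V" using s(1) by auto
          have fV: "finite V1" "finite V2" using sub G(1) finite_subset by auto
          have g12: "graph_on V1 ?R1" "graph_on V2 ?R2" using graph_on_Restr[OF g] sub by auto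
          have "{p, q} \<subseteq> V1" "{p, q} \<subseteq> V2" using s(2) by auto
          then have "card {p, q} \<le> card V1" "card {p, q} \<le> card V2" using fV card_mono by blast+
          then have two: "2 \<le> card V1" "2 \<le> card V2" using pq by simp_all
          have cV: "card V1 + card V2 = card V + 2"
            using card_Un_Int[OF fV] s(1,2) pq by simp
          have "?R1 \<inter> ?R2 = Restr R {p, q}" using s(2) by blast
          also have "\<dots> = {(p, q), (q, p)}" using s(3) G(5)[OF s(3)] G(6) by auto
          finally have "card (?R1 \<inter> ?R2) = 2" using pq by simp
          moreover have "card ?R1 + card ?R2 = card (?R1 \<union> ?R2) + card (?R1 \<inter> ?R2)"
            using G(2) by (intro card_Un_Int) auto
          ultimately have cR: "card ?R1 + card ?R2 = card R + 2" using s(6) by simp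
          have t1: "K5tree V1 ?R1" if "6 * card V1 \<le> card ?R1 + 10"
            using that by (intro IH[OF g12(1) s(4) two(1)] mono sub) auto
          have t2: "K5tree V2 ?R2" if "6 * card V2 \<le> card ?R2 + 10"
            using that by (intro IH[OF g12(2) s(5) two(2)] mono sub) auto
          \<comment> \<open>By the induction hypothesis neither side exceeds the tight count. The
            counts of the sides add up to at least twice the tight value, since the doubly counted
            vertices and edge balance, so both sides are tight.\<close>
          have le1: "card ?R1 + 10 \<le> 6 * card V1"
            using t1 K5tree_graph[of V1 ?R1] by (cases "6 * card V1 \<le> card ?R1 + 10") auto
          have le2: "card ?R2 + 10 \<le> 6 * card V2"
            using t2 K5tree_graph[of V2 ?R2] by (cases "6 * card V2 \<le> card ?R2 + 10") auto
          have eq: "6 * card V1 \<le> card ?R1 + 10" "6 * card V2 \<le> card ?R2 + 10"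
            using le1 le2 cV cR less(4) by linarith+
          have "(p, q) \<in> ?R1" "(p, q) \<in> ?R2" using s(2,3) by auto
          then have "K5tree (V1 \<union> V2) (?R1 \<union> ?R2)"
            by (intro K5tree_amalgamate[OF t2[OF eq(2)] t1[OF eq(1)] s(2)])
          then show ?thesis using s(1,6) by simp
        qed
      qed
    qed
  qed
qed

section \<open>From a \<open>K\<^bsub>3,3\<^esub>\<close> minor to a subdivision\<close>

text \<open>A proper connected subset containing \<open>r\<close> of maximal size, enlarged by a
  neighbour \<open>b\<close> of it in \<open>X\<close>, must be all of \<open>X\<close>; hence
  \<open>b\<close> can be removed.\<close>

lemma conn_noncut:
  assumes X: "finite X" "conn R X" "r \<in> X" "2 \<le> card X" and s: "sym R"
  obtains l where "l \<in> X" "l \<noteq> r" "conn R (X - {l})"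
proof -
  define F where "F = {S. S \<subset> X \<and> r \<in> S \<and> conn R S}"
  have fin: "finite F" using X(1) by (auto simp: F_def intro: finite_subset[of _ "Pow X"])
  have "{r} \<noteq> X" using X(4) by auto
  then have "{r} \<in> F" using X(3) by (auto simp: F_def)
  then have "Max (card ` F) \<in> card ` F" using fin by (intro Max_in) auto
  then obtain S where S: "S \<in> F" "card S = Max (card ` F)" by auto
  have max: "card T \<le> card S" if "T \<in> F" for T unfolding S(2) using fin that by simp
  have SX: "S \<subset> X" "r \<in> S" "conn R S" using S(1) by (auto simp: F_def)
  then obtain w where w: "w \<in> X" "w \<notin> S" by auto
  have "(r, w) \<in> (Restr R X)\<^sup>*" using X(2,3) w(1) by (auto simp: conn_def)
  then have "\<exists>a b. a \<in> S \<and> b \<notin> S \<and> (a, b) \<in> Restr R X"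
    using w(2) by (induct rule: rtrancl_induct) (use SX(2) in blast)+
  then obtain a b where ab: "a \<in> S" "b \<notin> S" "(a, b) \<in> R" "b \<in> X" by auto
  have c: "conn R (insert b S)" using conn_insert[OF SX(3) ab(1,3)] ab(3) s by (auto dest: symD)
  have "insert b S = X"
  proof (rule ccontr)
    assume "insert b S \<noteq> X"
    then have "insert b S \<in> F" using c SX ab by (auto simp: F_def)
    then have "card (insert b S) \<le> card S" by (rule max)
    moreover have "finite S" using SX(1) X(1) finite_subset by blast
    ultimately show False using ab(2) by simp
  qed
  then have "X - {b} = S" using ab(2) by auto
  then show ?thesis using that[of b] ab SX by auto
qed

lemma card_opp: "i < 6 \<Longrightarrow> card {j. opp i j} = 3"
proof -
  assume i: "i < 6"
  have "{j. opp i j} = (if i < 3 then {3..<6} else {..<3})" using i by (auto simp: opp_def)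
  then show ?thesis by simp
qed

lemma opp_sym: "opp i j \<Longrightarrow> opp j i" by (auto simp: opp_def)

lemma K33_subdivision_if_singletons:
  assumes g: "graph_on V R" and m: "K33_model V R B" and one: "\<And>i. i < 6 \<Longrightarrow> card (B i) = 1"
  shows "\<exists>H K. pverts H \<subseteq> V \<and> parcs H \<subseteq> R \<and> subdivision_pair K H \<and> K\<^bsub>3,3\<^esub> (with_proj K)"
proof -
  have "\<forall>i. \<exists>b. i < 6 \<longrightarrow> B i = {b}" using one by (metis card_1_singletonE)
  then obtain b where b: "\<And>i. i < 6 \<Longrightarrow> B i = {b i}" by metis
  have inj: "inj_on b {..<6}"
  proof (rule inj_onI)
    fix i j assume ij: "i \<in> {..<6}" "j \<in> {..<(6::nat)}" "b i = b j"
    then have "B i \<inter> B j \<noteq> {}" using b by auto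
    then show "i = j" using m ij unfolding K33_model_def by blast
  qed
  define U where "U = b ` {..<3}" define W where "W = b ` {3..<6}"
  define K where "K = \<lparr>pverts = U \<union> W, parcs = U \<times> W \<union> W \<times> U\<rparr>"
  have cU: "card U = 3" unfolding U_def using inj by (subst card_image) (auto intro: inj_on_subset)
  have cW: "card W = 3" unfolding W_def using inj by (subst card_image) (auto intro: inj_on_subset)
  have UW: "U \<inter> W = {}"
  proof -
    have "b ` ({..<3} \<inter> {3..<6}) = b ` {..<3} \<inter> b ` {3..<6}"
      by (rule inj_on_image_Int[OF inj]) auto
    then show ?thesis unfolding U_def W_def by auto
  qed
  have K33: "K\<^bsub>3,3\<^esub> (with_proj K)"
    unfolding complete_bipartite_digraph_pair_def
    using cU cW UW by (auto simp: K_def U_def W_def)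
  then have "pair_graph K" by (rule pair_graphI_complete_bipartite)
  then interpret K: pair_graph K .
  have "subdivision_pair K K" by (rule subdivision_pair_base) unfold_locales
  moreover have "pverts K \<subseteq> V"
  proof -
    have "b i \<in> V" if "i < 6" for i using m b[OF that] that unfolding K33_model_def by blast
    then show ?thesis by (auto simp: K_def U_def W_def)
  qed
  moreover have "parcs K \<subseteq> R"
  proof -
    have "(b i, b j) \<in> R" if "opp i j" for i j
    proof -
      have "i < 6" "j < 6" using that by (auto simp: opp_def)
      then show ?thesis using m that b[of i] b[of j] unfolding K33_model_def adjacent_def by fastforce
    qed
    then show ?thesis by (auto simp: K_def U_def W_def opp_def)
  qed
  ultimately show ?thesis using K33 by blast
qed

lemma K33_model_remove:
  assumes m: "K33_model V R B" and i: "i < 6" and X: "conn R X" "X \<subseteq> B i"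
    and a: "\<And>j. opp i j \<Longrightarrow> adjacent R X (B j)" and s: "sym R"
  shows "K33_model V R (B(i := X))"
proof -
  have con: "conn R (B k)" "B k \<subseteq> V" if "k < 6" for k using m that unfolding K33_model_def by auto
  have disj: "B j \<inter> B k = {}" if "j < 6" "k < 6" "j \<noteq> k" for j k
    using m that unfolding K33_model_def by blast
  have adj: "adjacent R (B j) (B k)" if "opp j k" for j k using m that unfolding K33_model_def by blast
  have 1: "conn R ((B(i := X)) k) \<and> (B(i := X)) k \<subseteq> V" if "k < 6" for k
    using con[OF that] X con(2)[OF i] by (cases "k = i") auto
  have 2: "(B(i := X)) j \<inter> (B(i := X)) k = {}" if "j < 6" "k < 6" "j \<noteq> k" for j k
    using disj[OF that] that X(2) by (cases "j = i"; cases "k = i") auto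
  have 3: "adjacent R ((B(i := X)) j) ((B(i := X)) k)" if o: "opp j k" for j k
  proof -
    have "j \<noteq> k" using o by (auto simp: opp_def)
    then show ?thesis
      using adj[OF o] a[of k] adjacent_sym[OF s a[of j]] o opp_sym[OF o] by (cases "j = i"; cases "k = i") auto
  qed
  show ?thesis unfolding K33_model_def using 1 2 3 by blast
qed

text \<open>Induction on the total size of the branch sets: if a branch set has two vertices, then some
  non-cut vertex of it can be deleted, or has degree two in the model and can be suppressed.\<close>

lemma K33_model_subdivision:
  assumes "graph_on V R" "K33_model V R B"
  shows "\<exists>H K. pverts H \<subseteq> V \<and> parcs H \<subseteq> R \<and> subdivision_pair K H \<and> K\<^bsub>3,3\<^esub> (with_proj K)"
  using assms
proof (induct "\<Sum>i<6. card (B i)" arbitrary: V R B rule: less_induct)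
  case less
  note g = less(2) note m = less(3)
  note G = graph_onD[OF g]
  have s: "sym R" using g by (simp add: graph_on_def)
  have BV: "B i \<subseteq> V" and con: "conn R (B i)" if "i < 6" for i using m that by (auto simp: K33_model_def)
  have fB: "finite (B i)" if "i < 6" for i using BV[OF that] G(1) finite_subset by blast
  have disj: "B i \<inter> B j = {}" if "i < 6" "j < 6" "i \<noteq> j" for i j
    using m that by (auto simp: K33_model_def)
  have decr: "(\<Sum>k<6. card ((B(i := B i - {l})) k)) < (\<Sum>k<6. card (B k))" if "i < 6" "l \<in> B i" for i l
  proof (rule sum_strict_mono_ex1)
    show "\<forall>k\<in>{..<6}. card ((B(i := B i - {l})) k) \<le> card (B k)" using fB by (auto intro: card_mono)
    have "card (B i - {l}) < card (B i)" using that fB[OF that(1)] by (intro psubset_card_mono) auto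
    then show "\<exists>k\<in>{..<6}. card ((B(i := B i - {l})) k) < card (B k)" using that(1) by (intro bexI[of _ i]) auto
  qed simp
  show ?case
  proof (cases "\<forall>i<6. card (B i) = 1")
    case True
    then show ?thesis using K33_subdivision_if_singletons[OF g m] by blast
  next
    case False
    then obtain i where i: "i < 6" "card (B i) \<noteq> 1" by auto
    have "B i \<noteq> {}" using con[OF i(1)] by (auto simp: conn_def)
    then have "card (B i) \<noteq> 0" using fB[OF i(1)] by simp
    then have c2: "2 \<le> card (B i)" using i(2) by linarith
    obtain r where r: "r \<in> B i" using \<open>B i \<noteq> {}\<close> by auto
    obtain l1 where l1: "l1 \<in> B i" "conn R (B i - {l1})"
      by (rule conn_noncut[OF fB[OF i(1)] con[OF i(1)] r c2 s])
    \<comment> \<open>Prescribing \<open>l1\<close> as the vertex to keep makes the second removable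
      vertex a different one.\<close>
    obtain l2 where l2: "l2 \<in> B i" "l2 \<noteq> l1" "conn R (B i - {l2})"
      by (rule conn_noncut[OF fB[OF i(1)] con[OF i(1)] l1(1) c2 s])
    define J where "J l = {j. opp i j \<and> \<not> adjacent R (B i - {l}) (B j)}" for l
    have fJ: "finite (J l)" and Jsub: "J l \<subseteq> {j. opp i j}" for l
      using card_opp[OF i(1)] unfolding J_def by (auto intro!: finite_subset[of _ "{..<6}"] simp: opp_def)
    have "J l1 \<inter> J l2 = {}"
    proof (rule ccontr)
      assume "J l1 \<inter> J l2 \<noteq> {}"
      then obtain j where j: "j \<in> J l1" "j \<in> J l2" by auto
      then have "adjacent R (B i) (B j)" using m by (auto simp: J_def K33_model_def)
      then obtain x y where "x \<in> B i" "y \<in> B j" "(x, y) \<in> R" by (auto simp: adjacent_def)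
      then show False using j l2(2) unfolding J_def adjacent_def by blast
    qed
    moreover have "J l1 \<union> J l2 \<subseteq> {j. opp i j}" using Jsub by auto
    moreover have "finite {j. opp i j}" using card_opp[OF i(1)] by (metis card.infinite zero_neq_numeral)
    ultimately have c3: "card (J l1) + card (J l2) \<le> 3"
      using card_opp[OF i(1)] fJ card_mono card_Un_disjoint by metis
    obtain l where l: "l \<in> B i" "conn R (B i - {l})" "card (J l) \<le> 1"
    proof (cases "card (J l1) \<le> 1")
      case True then show ?thesis using that l1 by blast
    next
      case False then show ?thesis using that[of l2] l2 c3 by linarith
    qed
    show ?thesis
    proof (cases "J l = {}")
      case True
      then have a: "adjacent R (B i - {l}) (B j)" if "opp i j" for j using that by (auto simp: J_def)
      have "K33_model V R (B(i := B i - {l}))"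
        by (rule K33_model_remove[OF m i(1) l(2) _ a s]) auto
      then show ?thesis using less(1)[OF decr[OF i(1) l(1)] g] by blast
    next
      case False
      then obtain j where J: "J l = {j}" using l(3) fJ[of l] by (metis card_0_eq card_1_singletonE le_SucE le_zero_eq One_nat_def)
      have j: "opp i j" "\<not> adjacent R (B i - {l}) (B j)" using J by (auto simp: J_def)
      have j6: "j < 6" "j \<noteq> i" using j(1) by (auto simp: opp_def)
      have "adjacent R (B i) (B j)" using m j(1) by (auto simp: K33_model_def)
      then obtain y where y: "y \<in> B j" "(l, y) \<in> R" using j(2) unfolding adjacent_def by blast
      have ne: "B i - {l} \<noteq> {}" using l(2) by (auto simp: conn_def)
      obtain p where p: "p \<in> B i" "p \<noteq> l" "(l, p) \<in> R"
      proof -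
        obtain x where x: "x \<in> B i" "x \<noteq> l" using ne by auto
        then have "(l, x) \<in> (Restr R (B i))\<^sup>*" using con[OF i(1)] l(1) by (auto simp: conn_def)
        then obtain z where "(l, z) \<in> Restr R (B i)" using x(2) by (auto elim: converse_rtranclE)
        then show ?thesis using that[of z] G(6) by auto
      qed
      have pj: "p \<noteq> y" "y \<noteq> l" using disj[OF i(1) j6(1)] j6(2) l(1) p(1) y(1) by auto
      define V' where "V' = V - {l}"
      \<comment> \<open>Only \<open>B j\<close> still needs \<open>l\<close>, so the path from
        \<open>p\<close> through \<open>l\<close> to \<open>y\<close> is replaced by an
        edge.\<close>
      define R' where "R' = dels {l} R \<union> {(p, y), (y, p)}"
      have pV: "p \<in> V'" "y \<in> V'" using p y pj BV[OF i(1)] BV[OF j6(1)] by (auto simp: V'_def)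
      have g': "graph_on V' R'"
        unfolding R'_def
      proof -
        have "graph_on {p, y} {(p, y), (y, p)}" using pj by (auto simp: graph_on_def sym_def irrefl_def)
        then have "graph_on (V' \<union> {p, y}) (dels {l} R \<union> {(p, y), (y, p)})"
          using graph_on_dels[OF g, of "{l}"] unfolding V'_def by (intro graph_on_Un)
        then show "graph_on V' (dels {l} R \<union> {(p, y), (y, p)})" using pV by (simp add: insert_absorb)
      qed
      have lB: "l \<notin> B k" if "k < 6" "k \<noteq> i" for k using disj[OF i(1) that(1)] that(2) l(1) by auto
      have conn': "conn R' X" if "conn R X" "l \<notin> X" for X
      proof -
        have "Restr R X \<subseteq> Restr R' X" using that(2) by (auto simp: R'_def dels_def)
        then have "(Restr R X)\<^sup>* \<subseteq> (Restr R' X)\<^sup>*" by (rule rtrancl_mono)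
        then show ?thesis using that(1) unfolding conn_def by blast
      qed
      have adj': "adjacent R' X Y" if "adjacent R X Y" "l \<notin> X" "l \<notin> Y" for X Y
        using that unfolding adjacent_def R'_def dels_def by blast
      define B' where "B' = B(i := B i - {l})"
      have s': "sym R'" using g' by (simp add: graph_on_def)
      have ad: "adjacent R' (B i - {l}) (B k)" if "opp i k" for k
      proof (cases "k = j")
        case True
        have "(p, y) \<in> R'" by (simp add: R'_def)
        then show ?thesis using p y True unfolding adjacent_def by auto
      next
        case False
        then have "k \<notin> J l" using J by auto
        then have "adjacent R (B i - {l}) (B k)" using that by (auto simp: J_def)
        moreover have "l \<notin> B k" using lB[of k] that by (auto simp: opp_def)
        ultimately show ?thesis by (intro adj') auto
      qed
      have m': "K33_model V' R' B'"
        unfolding K33_model_def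
      proof (intro conjI allI impI)
        fix k :: nat assume k: "k < 6"
        show "conn R' (B' k)" using conn'[OF l(2)] conn'[OF con[OF k]] lB[OF k] by (auto simp: B'_def)
        show "B' k \<subseteq> V'" using BV[OF k] lB[OF k] by (auto simp: B'_def V'_def)
      next
        fix k n :: nat assume "k < 6" "n < 6" "k \<noteq> n"
        then show "B' k \<inter> B' n = {}" using disj[of k n] by (auto simp: B'_def)
      next
        fix k n assume kn: "opp k n"
        then have k6: "k < 6" "n < 6" "k \<noteq> n" by (auto simp: opp_def)
        consider "k = i" | "n = i" "k \<noteq> i" | "k \<noteq> i" "n \<noteq> i" by blast
        then show "adjacent R' (B' k) (B' n)"
        proof cases
          case 1 then show ?thesis using ad[of n] kn k6 by (auto simp: B'_def)
        next
          case 2 then show ?thesis using adjacent_sym[OF s' ad[of k]] opp_sym[OF kn] by (auto simp: B'_def)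
        next
          case 3
          have "adjacent R (B k) (B n)" using m kn by (auto simp: K33_model_def)
          then show ?thesis using 3 adj' lB k6 by (auto simp: B'_def)
        qed
      qed
      have "(\<Sum>k<6. card (B' k)) < (\<Sum>k<6. card (B k))" unfolding B'_def by (rule decr[OF i(1) l(1)])
      from less(1)[OF this g' m'] obtain H K where H: "pverts H \<subseteq> V'" "parcs H \<subseteq> R'"
        and sub: "subdivision_pair K H" and K: "K\<^bsub>3,3\<^esub> (with_proj K)" by blast
      have "pair_graph K" using K by (rule pair_graphI_complete_bipartite)
      then have "pair_graph H" using sub by (rule pair_graph.pair_graph_subdivision)
      then interpret H: pair_graph H .
      show ?thesis
      proof (cases "(p, y) \<in> parcs H")
        case True
        define H' where "H' = subdivide H (p, y) l"
        have lH: "l \<notin> pverts H" using H(1) by (auto simp: V'_def)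
        have "subdivision_pair K H'" unfolding H'_def by (rule subdivision_pair_divide[OF True lH sub])
        moreover have "pverts H' \<subseteq> V" using H(1) l(1) BV[OF i(1)] by (auto simp: H'_def V'_def)
        moreover have "parcs H' \<subseteq> R"
          using H(2) p y G(5)[OF p(3)] G(5)[OF y(2)] by (auto simp: H'_def R'_def dels_def)
        ultimately show ?thesis using K by blast
      next
        case False
        then have "(y, p) \<notin> parcs H" using H.arcs_symmetric by blast
        then have "parcs H \<subseteq> R" using H(2) False by (auto simp: R'_def dels_def)
        moreover have "pverts H \<subseteq> V" using H(1) by (auto simp: V'_def)
        ultimately show ?thesis using sub K by blast
      qed
    qed
  qed
qed

lemma pair_graph_graph_on:
  assumes "pair_graph G" shows "graph_on (pverts G) (parcs G)"
proof -
  interpret G: pair_graph G by fact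
  show ?thesis
    unfolding graph_on_def irrefl_def
  proof (intro conjI allI)
    show "(x, x) \<notin> parcs G" for x using G.no_loops'[of x x] by blast
    show "sym (parcs G)" using G.arcs_symmetric by (auto intro: symI)
  qed (use G.pair_finite_verts G.wellformed' in auto)
qed

lemma K33_subdivision_free_imp_no_minor:
  assumes "pair_graph G" "K33_subdivision_free G"
  shows "\<not> K33_minor (pverts G) (parcs G)"
proof
  interpret G: pair_graph G by fact
  assume "K33_minor (pverts G) (parcs G)"
  then obtain B where B: "K33_model (pverts G) (parcs G) B" by (auto simp: K33_minor_def)
  from K33_model_subdivision[OF pair_graph_graph_on[OF assms(1)] B] obtain H K where H: "pverts H \<subseteq> pverts G" "parcs H \<subseteq> parcs G"
    and sub: "subdivision_pair K H" and K: "K\<^bsub>3,3\<^esub> (with_proj K)" by blast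
  have "pair_graph K" using K by (rule pair_graphI_complete_bipartite)
  then have "pair_graph H" using sub by (rule pair_graph.pair_graph_subdivision)
  then interpret H: pair_graph H .
  have "subgraph (with_proj H) (with_proj G)"
    unfolding subgraph_def using H by (auto simp: compatible_def G.wf_digraph H.wf_digraph)
  then show False using assms(2) sub K unfolding K33_subdivision_free_def by blast
qed


section \<open>Theta curves and plane drawings of \<open>K\<^sub>4\<close>\<close>

definition arc_between :: "'s::topological_space set \<Rightarrow> 's \<Rightarrow> 's \<Rightarrow> bool" where
  "arc_between A a b \<longleftrightarrow> (\<exists>g. arc g \<and> pathstart g = a \<and> pathfinish g = b \<and> path_image g = A)"

definition simple_closed_curve :: "'s::topological_space set \<Rightarrow> bool" where
  "simple_closed_curve J \<longleftrightarrow> (\<exists>c. simple_path c \<and> pathfinish c = pathstart c \<and> path_image c = J)"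

lemma arc_between_sym: "arc_between A a b \<Longrightarrow> arc_between A b a"
  unfolding arc_between_def using arc_reversepath by (metis path_image_reversepath pathfinish_reversepath pathstart_reversepath)

lemma arc_betweenD:
  assumes "arc_between (A :: 's::t2_space set) a b"
  shows "a \<in> A" "b \<in> A" "a \<noteq> b" "connected A" "compact A"
  using assms unfolding arc_between_def
  by (auto simp: arc_distinct_ends arc_imp_path connected_path_image compact_path_image dest: arc_distinct_ends)

lemma arc_between_interior:
  fixes A :: "'s::t2_space set"
  assumes "arc_between A a b"
  shows "connected (A - {a, b})" "A - {a, b} \<noteq> {}" "A \<subseteq> closure (A - {a, b})"
proof -
  obtain g where g: "arc g" "g 0 = a" "g 1 = b" "path_image g = A"
    using assms unfolding arc_between_def pathstart_def pathfinish_def by auto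
  have inj: "inj_on g {0..1}" and cont: "continuous_on {0..1} g"
    using g(1) by (auto simp: arc_def path_def)
  have eq: "A - {a, b} = g ` {0<..<1}"
  proof -
    have "g ` ({0..1} - {0, 1}) = g ` {0..1} - g ` {0, 1}"
      by (rule inj_on_image_set_diff[OF inj]) auto
    moreover have "{0..1} - {0, 1::real} = {0<..<1}" by auto
    ultimately show ?thesis using g(2-4) by (simp add: path_image_def)
  qed
  show "connected (A - {a, b})" unfolding eq
    by (intro connected_continuous_image continuous_on_subset[OF cont]) auto
  show "A - {a, b} \<noteq> {}" unfolding eq by auto
  have "g ` closure {0<..<1} \<subseteq> closure (g ` {0<..<1})"
    by (intro image_closure_subset closed_closure closure_subset) (use cont in simp)
  then show "A \<subseteq> closure (A - {a, b})" unfolding eq using g(4) by (simp add: path_image_def)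
qed

lemma arc_between_half:
  fixes A :: "'s::t2_space set"
  assumes "arc_between A a b"
  shows "connected (A - {b})" "a \<in> A - {b}" "b \<in> closure (A - {b})"
proof -
  note D = arc_betweenD[OF assms] and I = arc_between_interior[OF assms]
  have sub: "A - {a, b} \<subseteq> A - {b}" by auto
  have "A - {b} \<subseteq> closure (A - {a, b})" using I(3) by auto
  with sub show "connected (A - {b})" using I(1) connected_intermediate_closure by blast
  show "a \<in> A - {b}" using D by auto
  show "b \<in> closure (A - {b})" using I(3) D(2) closure_mono[OF sub] by auto
qed

lemma arc_between_join:
  assumes "arc_between A a b" "arc_between B b c" "A \<inter> B = {b}"
  shows "arc_between (A \<union> B) a c"
proof -
  obtain g h where g: "arc g" "pathstart g = a" "pathfinish g = b" "path_image g = A"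
    and h: "arc h" "pathstart h = b" "pathfinish h = c" "path_image h = B"
    using assms unfolding arc_between_def by metis
  have "arc (g +++ h)" using g h assms(3) by (subst arc_join_eq) auto
  then show ?thesis unfolding arc_between_def using g h
    by (intro exI[of _ "g +++ h"]) (auto simp: path_image_join)
qed

lemma simple_closed_curve_Un:
  assumes "arc_between A a b" "arc_between B a b" "A \<inter> B = {a, b}"
  shows "simple_closed_curve (A \<union> B)"
proof -
  obtain g h where g: "arc g" "pathstart g = a" "pathfinish g = b" "path_image g = A"
    and h: "arc h" "pathstart h = b" "pathfinish h = a" "path_image h = B"
    using assms arc_between_sym[OF assms(2)] unfolding arc_between_def by metis
  have "simple_path (g +++ h)" using g h assms(3) by (subst simple_path_join_loop_eq) auto
  then show ?thesis unfolding simple_closed_curve_def using g h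
    by (intro exI[of _ "g +++ h"]) (auto simp: path_image_join)
qed

lemma simple_closed_curve_image:
  assumes "simple_closed_curve J" "continuous_on J f" "inj_on f J"
  shows "simple_closed_curve (f ` J)"
proof -
  obtain c where c: "simple_path c" "pathfinish c = pathstart c" "path_image c = J"
    using assms(1) unfolding simple_closed_curve_def by auto
  have "simple_path (f \<circ> c)" using c assms by (intro simple_path_continuous_image) auto
  then show ?thesis unfolding simple_closed_curve_def using c
    by (intro exI[of _ "f \<circ> c"]) (auto simp: path_image_compose pathfinish_compose pathstart_compose)
qed

lemma arc_between_image:
  assumes "arc_between A a b" "continuous_on A f" "inj_on f A"
  shows "arc_between (f ` A) (f a) (f b)"
proof -
  obtain g where g: "arc g" "pathstart g = a" "pathfinish g = b" "path_image g = A"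
    using assms(1) unfolding arc_between_def by auto
  have "arc (f \<circ> g)" unfolding arc_def
  proof
    show "path (f \<circ> g)" using g assms(2) by (intro path_continuous_image) (auto simp: arc_def)
    show "inj_on (f \<circ> g) {0..1}" using g assms(3) unfolding arc_def path_image_def by (auto intro: comp_inj_on)
  qed
  then show ?thesis unfolding arc_between_def using g
    by (intro exI[of _ "f \<circ> g"]) (auto simp: path_image_compose pathfinish_compose pathstart_compose)
qed

lemma simple_closed_curveD:
  assumes "simple_closed_curve (J :: 's::t2_space set)"
  shows "compact J" "connected J" "J \<noteq> {}"
  using assms unfolding simple_closed_curve_def
  by (auto simp: simple_path_imp_path connected_path_image compact_path_image)

lemma Jordan_curve_inside_outside:
  fixes J :: "complex set"
  assumes "simple_closed_curve J"
  shows "inside J \<noteq> {}" "open (inside J)" "connected (inside J)" "open (outside J)" "connected (outside J)"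
    "bounded (inside J)" "frontier (inside J) = J" "frontier (outside J) = J"
    "closure (inside J) = J \<union> inside J" "closure (outside J) = J \<union> outside J"
proof -
  obtain c where c: "simple_path c" "pathfinish c = pathstart c" "path_image c = J"
    using assms unfolding simple_closed_curve_def by auto
  note * = Jordan_inside_outside[OF c(1,2), unfolded c(3)]
  show "inside J \<noteq> {}" "open (inside J)" "connected (inside J)" "open (outside J)" "connected (outside J)"
    "bounded (inside J)" "frontier (inside J) = J" "frontier (outside J) = J"
    using * by auto
  then show "closure (inside J) = J \<union> inside J" "closure (outside J) = J \<union> outside J"
    using closure_Un_frontier by blast+
qed

lemma connected_inside_or_outside:
  assumes "connected W" "W \<inter> J = {}" "w \<in> W" "w \<in> inside J" shows "W \<subseteq> inside J"
proof (rule ccontr)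
  assume "\<not> W \<subseteq> inside J"
  then obtain x where "x \<in> W" "x \<in> outside J" using assms(2) outside_inside[of J] by auto
  then show False using inside_outside_intersect_connected[OF assms(1), of J] assms(2-4) by auto
qed

section \<open>Theta curves in the plane\<close>

definition theta_curve :: "complex set \<Rightarrow> complex set \<Rightarrow> complex set \<Rightarrow> complex \<Rightarrow> complex \<Rightarrow> bool" where
  "theta_curve A B C a b \<longleftrightarrow> arc_between A a b \<and> arc_between B a b \<and> arc_between C a b \<and>
     A \<inter> B = {a, b} \<and> A \<inter> C = {a, b} \<and> B \<inter> C = {a, b}"

lemma theta_curve_perm: "theta_curve A B C a b \<Longrightarrow> theta_curve A C B a b"
  "theta_curve A B C a b \<Longrightarrow> theta_curve B A C a b"
  "theta_curve A B C a b \<Longrightarrow> theta_curve B C A a b"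
  "theta_curve A B C a b \<Longrightarrow> theta_curve C A B a b"
  by (auto simp: theta_curve_def)

lemma theta_curve_split:
  assumes "theta_curve A B C a b" "C \<inter> inside (A \<union> B) \<noteq> {}"
  shows "inside (A \<union> C) \<inter> inside (B \<union> C) = {}"
    "inside (A \<union> C) \<union> inside (B \<union> C) \<union> (C - {a, b}) = inside (A \<union> B)"
proof -
  obtain g h k where g: "arc g" "pathstart g = a" "pathfinish g = b" "path_image g = A"
    and h: "arc h" "pathstart h = a" "pathfinish h = b" "path_image h = B"
    and k: "arc k" "pathstart k = a" "pathfinish k = b" "path_image k = C"
    using assms(1) unfolding theta_curve_def arc_between_def by metis
  have ab: "a \<noteq> b" using g arc_distinct_ends by metis
  have "inside (A \<union> C) \<inter> inside (B \<union> C) = {} \<and>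
    inside (A \<union> C) \<union> inside (B \<union> C) \<union> (C - {a, b}) = inside (A \<union> B)"
    by (rule split_inside_simple_closed_curve[of g a b h k, unfolded g(4) h(4) k(4)])
      (use assms g h k ab in \<open>auto simp: theta_curve_def arc_imp_simple_path\<close>)
  then show "inside (A \<union> C) \<inter> inside (B \<union> C) = {}"
    "inside (A \<union> C) \<union> inside (B \<union> C) \<union> (C - {a, b}) = inside (A \<union> B)" by auto
qed

text \<open>A point inside \<open>A \<union> B\<close> but not on \<open>C\<close> has winding number \<open>\<plusminus>1\<close> around exactly one of
  \<open>A \<union> C\<close> and \<open>B \<union> C\<close>, by additivity of winding numbers.\<close>

lemma theta_curve_inside_cases:
  assumes t: "theta_curve A B C a b" and z: "z \<in> inside (A \<union> B)" "z \<notin> C"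
  shows "z \<in> inside (A \<union> C) \<or> z \<in> inside (B \<union> C)"
proof (rule ccontr)
  assume neg: "\<not> ?thesis"
  obtain g h k where g: "arc g" "pathstart g = a" "pathfinish g = b" "path_image g = A"
    and h: "arc h" "pathstart h = a" "pathfinish h = b" "path_image h = B"
    and k: "arc k" "pathstart k = a" "pathfinish k = b" "path_image k = C"
    using t unfolding theta_curve_def arc_between_def by metis
  have zn: "z \<notin> A" "z \<notin> B" using z(1) inside_no_overlap by blast+
  have out: "z \<in> outside (A \<union> C)" "z \<in> outside (B \<union> C)" using neg z(2) zn outside_inside by blast+
  have p: "path g" "path h" "path k" using g h k arc_imp_path by auto
  have w0: "winding_number (g +++ reversepath k) z = 0" "winding_number (h +++ reversepath k) z = 0"
    using out p g h k by (auto intro!: winding_number_zero_in_outside simp: path_image_join)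
  have w: "winding_number (p +++ reversepath q) z = winding_number p z - winding_number q z"
    if "path p" "path q" "pathfinish p = pathfinish q" "z \<notin> path_image p" "z \<notin> path_image q" for p q
    using that by (simp add: winding_number_join winding_number_reversepath)
  have "winding_number (g +++ reversepath h) z = 0"
    using w0 w[of g k] w[of h k] w[of g h] p g h k zn z(2) by simp
  moreover have "simple_path (g +++ reversepath h)"
    using g h t by (subst simple_path_join_loop_eq) (auto simp: theta_curve_def arc_reversepath)
  moreover have "path_image (g +++ reversepath h) = A \<union> B" using g h by (simp add: path_image_join)
  ultimately show False using simple_closed_path_norm_winding_number_inside[of "g +++ reversepath h" z] z(1) by simp
qed

lemma theta_curve_scc:
  assumes "theta_curve A B C a b"
  shows "simple_closed_curve (A \<union> B)" "simple_closed_curve (A \<union> C)" "simple_closed_curve (B \<union> C)"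
  using assms unfolding theta_curve_def by (auto intro: simple_closed_curve_Un)

lemma theta_curve_arc_inside:
  assumes t: "theta_curve A B C a b" and "C \<inter> inside (A \<union> B) \<noteq> {}"
  shows "C - {a, b} \<subseteq> inside (A \<union> B)"
  using theta_curve_split[OF assms] by auto

text \<open>Otherwise a point inside \<open>A \<union> B\<close> also lies inside a second of the
  three curves. The two insides are connected and each is free of the other curve, so they coincide;
  then their frontiers coincide, although each of the two curves contains the interior of an arc
  that the other lacks.\<close>

lemma theta_curve_middle:
  assumes t: "theta_curve A B C a b"
  shows "A - {a, b} \<subseteq> inside (B \<union> C) \<or> B - {a, b} \<subseteq> inside (A \<union> C) \<or> C - {a, b} \<subseteq> inside (A \<union> B)"
proof (rule ccontr)
  assume neg: "\<not> ?thesis"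
  have no: "A \<inter> inside (B \<union> C) = {}" "B \<inter> inside (A \<union> C) = {}" "C \<inter> inside (A \<union> B) = {}"
    using neg theta_curve_arc_inside[OF t] theta_curve_arc_inside[OF theta_curve_perm(1)[OF t]]
      theta_curve_arc_inside[OF theta_curve_perm(3)[OF t]] by blast+
  note s = theta_curve_scc[OF t]
  obtain z where z: "z \<in> inside (A \<union> B)" using Jordan_curve_inside_outside(1)[OF s(1)] by auto
  have eq: False if t: "theta_curve A B C a b" and no: "B \<inter> inside (A \<union> C) = {}" "C \<inter> inside (A \<union> B) = {}"
    and z: "z \<in> inside (A \<union> B)" "z \<in> inside (A \<union> C)" for A B C
  proof -
    note s = theta_curve_scc[OF t]
    have "inside (A \<union> B) \<inter> (A \<union> C) = {}" "inside (A \<union> C) \<inter> (A \<union> B) = {}"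
      using no inside_no_overlap[of "A \<union> B"] inside_no_overlap[of "A \<union> C"] by blast+
    then have "inside (A \<union> B) \<subseteq> inside (A \<union> C)" "inside (A \<union> C) \<subseteq> inside (A \<union> B)"
      using connected_inside_or_outside[OF Jordan_curve_inside_outside(3)[OF s(1)] _ z]
        connected_inside_or_outside[OF Jordan_curve_inside_outside(3)[OF s(2)] _ z(2,1)] by blast+
    then have e: "inside (A \<union> B) = inside (A \<union> C)" by (rule equalityI)
    have "A \<union> B = A \<union> C"
      using Jordan_curve_inside_outside(7)[OF s(1), unfolded e] Jordan_curve_inside_outside(7)[OF s(2)]
      by (rule trans[OF sym])
    then have "B - {a, b} = {}" using t by (auto simp: theta_curve_def)
    then show False using arc_between_interior(2)[of B a b] t by (auto simp: theta_curve_def)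
  qed
  have "z \<in> inside (A \<union> C) \<or> z \<in> inside (B \<union> C)"
    using theta_curve_inside_cases[OF t z] no(3) z by auto
  then show False
  proof
    assume "z \<in> inside (A \<union> C)" then show False using eq[OF t no(2,3) z] by blast
  next
    assume "z \<in> inside (B \<union> C)"
    then show False using eq[OF theta_curve_perm(2)[OF t] no(1)] no(3) z by (simp add: Un_commute)
  qed
qed

text \<open>\<open>C\<close> cuts the inside of \<open>A \<union> B\<close> into two regions. A
  connected set off the interior of \<open>C\<close> stays in one of them, so it can accumulate on
  the outer curve only along the arc that bounds this region. The separation arguments for K4 are
  instances of this.\<close>

lemma theta_curve_side:
  assumes t: "theta_curve A B C a b" and C: "C \<inter> inside (A \<union> B) \<noteq> {}"
    and W: "connected W" "W \<inter> C \<subseteq> {a, b}" "W \<subseteq> inside (A \<union> B)"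
  shows "W \<subseteq> inside (A \<union> C) \<and> closure W \<inter> (A \<union> B) \<subseteq> A \<or> W \<subseteq> inside (B \<union> C) \<and> closure W \<inter> (A \<union> B) \<subseteq> B"
proof -
  note sp = theta_curve_split[OF t C] and s = theta_curve_scc[OF t]
  have ab: "a \<in> A \<inter> B" "b \<in> A \<inter> B" using t by (auto simp: theta_curve_def)
  have "W \<inter> {a, b} = {}" using W(3) ab inside_no_overlap[of "A \<union> B"] by blast
  then have Wsub: "W \<subseteq> inside (A \<union> C) \<union> inside (B \<union> C)" using W sp(2) by blast
  have op: "open (inside (A \<union> C))" "open (inside (B \<union> C))" using s Jordan_curve_inside_outside(2) by auto
  have cl: "closure W \<inter> (A \<union> B) \<subseteq> A" if "W \<subseteq> inside (A \<union> C)"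
  proof -
    have "closure W \<subseteq> A \<union> C \<union> inside (A \<union> C)"
      using closure_mono[OF that] Jordan_curve_inside_outside(9)[OF s(2)] by auto
    moreover have "inside (A \<union> C) \<inter> (A \<union> B) = {}" using sp(2) inside_no_overlap[of "A \<union> B"] by blast
    moreover have "C \<inter> (A \<union> B) \<subseteq> {a, b}" using t by (auto simp: theta_curve_def)
    ultimately show ?thesis using ab by blast
  qed
  have cl': "closure W \<inter> (A \<union> B) \<subseteq> B" if "W \<subseteq> inside (B \<union> C)"
  proof -
    have "closure W \<subseteq> B \<union> C \<union> inside (B \<union> C)"
      using closure_mono[OF that] Jordan_curve_inside_outside(9)[OF s(3)] by auto
    moreover have "inside (B \<union> C) \<inter> (A \<union> B) = {}" using sp(2) inside_no_overlap[of "A \<union> B"] by blast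
    moreover have "C \<inter> (A \<union> B) \<subseteq> {a, b}" using t by (auto simp: theta_curve_def)
    ultimately show ?thesis using ab by blast
  qed
  have "inside (A \<union> C) \<inter> W = {} \<or> inside (B \<union> C) \<inter> W = {}"
    using connectedD[OF W(1) op] sp(1) Wsub by blast
  then show ?thesis using Wsub cl cl' by blast
qed

text \<open>Edges are drawn as point sets: \<open>d {u, v}\<close> is the image of an arc from \<open>\<phi> u\<close> to \<open>\<phi> v\<close>.\<close>

definition clique_drawing :: "('a \<Rightarrow> 's::topological_space) \<Rightarrow> ('a set \<Rightarrow> 's set) \<Rightarrow> 'a set \<Rightarrow> bool" where
  "clique_drawing \<phi> d X \<longleftrightarrow> inj_on \<phi> X \<and>
     (\<forall>u\<in>X. \<forall>v\<in>X. u \<noteq> v \<longrightarrow> arc_between (d {u, v}) (\<phi> u) (\<phi> v) \<and> d {u, v} \<inter> \<phi> ` X = \<phi> ` {u, v}) \<and>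
     (\<forall>e f. e \<subseteq> X \<longrightarrow> f \<subseteq> X \<longrightarrow> card e = 2 \<longrightarrow> card f = 2 \<longrightarrow> e \<noteq> f \<longrightarrow> d e \<inter> d f = \<phi> ` (e \<inter> f))"

definition drawn :: "('a set \<Rightarrow> 's set) \<Rightarrow> 'a set \<Rightarrow> 's set" where
  "drawn d X = \<Union> {d {u, v} |u v. u \<in> X \<and> v \<in> X \<and> u \<noteq> v}"

section \<open>Drawings of complete graphs; K4 and K5 in the plane\<close>

lemma clique_drawing_subset: "clique_drawing \<phi> d X \<Longrightarrow> Y \<subseteq> X \<Longrightarrow> clique_drawing \<phi> d Y"
proof -
  assume a: "clique_drawing \<phi> d X" "Y \<subseteq> X"
  have "d {u, v} \<inter> \<phi> ` Y = \<phi> ` {u, v}" if "u \<in> Y" "v \<in> Y" "u \<noteq> v" for u v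
  proof -
    have "d {u, v} \<inter> \<phi> ` X = \<phi> ` {u, v}" using a that unfolding clique_drawing_def by blast
    then show ?thesis using a(2) that by blast
  qed
  then show ?thesis using a unfolding clique_drawing_def
    by (meson inj_on_subset order_trans subsetD)
qed

lemma clique_drawingD:
  assumes "clique_drawing \<phi> d X"
  shows "u \<in> X \<Longrightarrow> v \<in> X \<Longrightarrow> u \<noteq> v \<Longrightarrow> arc_between (d {u, v}) (\<phi> u) (\<phi> v)"
    "u \<in> X \<Longrightarrow> v \<in> X \<Longrightarrow> u \<noteq> v \<Longrightarrow> \<phi> u \<noteq> \<phi> v"
    "u \<in> X \<Longrightarrow> v \<in> X \<Longrightarrow> w \<in> X \<Longrightarrow> distinct [u, v, w] \<Longrightarrow> \<phi> w \<notin> d {u, v}"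
    "u \<in> X \<Longrightarrow> v \<in> X \<Longrightarrow> w \<in> X \<Longrightarrow> distinct [u, v, w] \<Longrightarrow> d {u, v} \<inter> d {v, w} = {\<phi> v}"
    "u \<in> X \<Longrightarrow> v \<in> X \<Longrightarrow> w \<in> X \<Longrightarrow> x \<in> X \<Longrightarrow> distinct [u, v, w, x] \<Longrightarrow> d {u, v} \<inter> d {w, x} = {}"
proof -
  have inj: "inj_on \<phi> X" using assms by (simp add: clique_drawing_def)
  have "\<forall>e f. e \<subseteq> X \<longrightarrow> f \<subseteq> X \<longrightarrow> card e = 2 \<longrightarrow> card f = 2 \<longrightarrow> e \<noteq> f \<longrightarrow> d e \<inter> d f = \<phi> ` (e \<inter> f)"
    using assms by (simp add: clique_drawing_def)
  note d = this[rule_format]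
  show "u \<in> X \<Longrightarrow> v \<in> X \<Longrightarrow> u \<noteq> v \<Longrightarrow> arc_between (d {u, v}) (\<phi> u) (\<phi> v)"
    using assms by (simp add: clique_drawing_def)
  show ne: "u \<in> X \<Longrightarrow> v \<in> X \<Longrightarrow> u \<noteq> v \<Longrightarrow> \<phi> u \<noteq> \<phi> v" for u v using inj by (auto dest: inj_onD)
  show "\<phi> w \<notin> d {u, v}" if "u \<in> X" "v \<in> X" "w \<in> X" "distinct [u, v, w]"
  proof
    assume "\<phi> w \<in> d {u, v}"
    moreover have "d {u, v} \<inter> \<phi> ` X = \<phi> ` {u, v}"
      using assms that unfolding clique_drawing_def by auto
    ultimately have "\<phi> w \<in> {\<phi> u, \<phi> v}" using that(3) by auto
    then show False using ne[of w u] ne[of w v] that by auto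
  qed
  show "d {u, v} \<inter> d {v, w} = {\<phi> v}" if "u \<in> X" "v \<in> X" "w \<in> X" "distinct [u, v, w]"
  proof -
    have "{u, v} \<inter> {v, w} = {v}" "{u, v} \<noteq> {v, w}" using that(4) by auto
    then show ?thesis using d[of "{u, v}" "{v, w}"] that by auto
  qed
  show "d {u, v} \<inter> d {w, x} = {}" if "u \<in> X" "v \<in> X" "w \<in> X" "x \<in> X" "distinct [u, v, w, x]"
  proof -
    have "{u, v} \<inter> {w, x} = {}" "{u, v} \<noteq> {w, x}" using that(5) by auto
    then show ?thesis using d[of "{u, v}" "{w, x}"] that by auto
  qed
qed

lemma drawn_mono: "X \<subseteq> Y \<Longrightarrow> drawn d X \<subseteq> drawn d Y" by (auto simp: drawn_def)

lemma edge_subset_drawn: "u \<in> X \<Longrightarrow> v \<in> X \<Longrightarrow> u \<noteq> v \<Longrightarrow> d {u, v} \<subseteq> drawn d X"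
  by (auto simp: drawn_def)

lemma drawn3: "distinct [a, b, c] \<Longrightarrow> drawn d {a, b, c} = d {a, b} \<union> d {b, c} \<union> d {a, c}"
  unfolding drawn_def by (auto simp: insert_commute)

lemma drawn4: "distinct [a, b, c, e] \<Longrightarrow> drawn d {a, b, c, e} =
    d {a, b} \<union> d {b, c} \<union> d {a, c} \<union> d {a, e} \<union> d {b, e} \<union> d {c, e}"
  unfolding drawn_def by (auto simp: insert_commute)

text \<open>This is K4 without the edge \<open>ce\<close>: the edge \<open>ab\<close> and the two
  paths of length two between \<open>a\<close> and \<open>b\<close>.\<close>

lemma K4_theta:
  assumes cd: "clique_drawing \<phi> d X" and X: "a \<in> X" "b \<in> X" "c \<in> X" "e \<in> X" "distinct [a, b, c, e]"
  shows "theta_curve (d {a, b}) (d {a, c} \<union> d {c, b}) (d {a, e} \<union> d {e, b}) (\<phi> a) (\<phi> b)"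
proof -
  note D = clique_drawingD[OF cd]
  have ar: "arc_between (d {a, c} \<union> d {c, b}) (\<phi> a) (\<phi> b)" "arc_between (d {a, e} \<union> d {e, b}) (\<phi> a) (\<phi> b)"
    "arc_between (d {a, b}) (\<phi> a) (\<phi> b)"
    using X D(1) D(4)[of a c b] D(4)[of a e b]
    by (auto intro!: arc_between_join[of "d {a, c}" _ "\<phi> c"] arc_between_join[of "d {a, e}" _ "\<phi> e"])
  have c: "d {b, c} = d {c, b}" "d {b, e} = d {e, b}" "d {e, a} = d {a, e}" "d {c, a} = d {a, c}"
    "d {b, a} = d {a, b}" by (simp_all add: insert_commute)
  have i: "d {a, b} \<inter> d {c, b} = {\<phi> b}" "d {a, b} \<inter> d {a, c} = {\<phi> a}"
    "d {a, b} \<inter> d {e, b} = {\<phi> b}" "d {a, b} \<inter> d {a, e} = {\<phi> a}"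
    "d {a, c} \<inter> d {a, e} = {\<phi> a}" "d {c, b} \<inter> d {e, b} = {\<phi> b}"
    "d {a, c} \<inter> d {e, b} = {}" "d {c, b} \<inter> d {a, e} = {}"
    using D(4)[of a b c] D(4)[of b a c] D(4)[of a b e] D(4)[of b a e] D(4)[of c a e] D(4)[of c b e]
      D(5)[of a c e b] D(5)[of c b a e] X by (auto simp: c)
  have "d {a, b} \<inter> (d {a, c} \<union> d {c, b}) = {\<phi> a, \<phi> b}" "d {a, b} \<inter> (d {a, e} \<union> d {e, b}) = {\<phi> a, \<phi> b}"
    "(d {a, c} \<union> d {c, b}) \<inter> (d {a, e} \<union> d {e, b}) = {\<phi> a, \<phi> b}"
    by (simp_all only: Int_Un_distrib Int_Un_distrib2 i) auto
  then show ?thesis using ar unfolding theta_curve_def by blast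
qed


lemma connected_edge_interior:
  fixes \<phi> :: "'a \<Rightarrow> 's::t2_space"
  assumes "clique_drawing \<phi> d X" "u \<in> X" "v \<in> X" "u \<noteq> v"
  shows "connected (d {u, v} - {\<phi> u, \<phi> v})" "d {u, v} \<subseteq> closure (d {u, v} - {\<phi> u, \<phi> v})"
    "\<phi> u \<in> d {u, v}" "\<phi> v \<in> d {u, v}"
  using arc_between_interior[OF clique_drawingD(1)[OF assms]] arc_betweenD[OF clique_drawingD(1)[OF assms]]
  by auto

text \<open>Two theta curves are used, one omitting \<open>ce\<close> and one omitting
  \<open>ab\<close>. If no vertex is enclosed, the middle arc of each must be the one that is a
  single edge. So \<open>ab\<close> and \<open>ce\<close> both run inside the 4-cycle
  \<open>acbe\<close>, where \<open>ab\<close> separates \<open>c\<close> from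
  \<open>e\<close>.\<close>

lemma K4_vertex_inside:
  fixes \<phi> :: "'a \<Rightarrow> complex"
  assumes cd: "clique_drawing \<phi> d X" and X: "X = {a, b, c, e}" "distinct [a, b, c, e]"
  shows "\<exists>v\<in>X. \<phi> v \<in> inside (drawn d (X - {v}))"
proof (rule ccontr)
  assume neg: "\<not> ?thesis"
  note D = clique_drawingD[OF cd]
  have m: "a \<in> X" "b \<in> X" "c \<in> X" "e \<in> X" using X(1) by auto
  note E = connected_edge_interior[OF cd]
  have Xm: "X - {a} = {b, c, e}" "X - {b} = {a, c, e}" "X - {c} = {a, b, e}" "X - {e} = {a, b, c}"
    using X by auto
  have cm: "d {b, a} = d {a, b}" "d {c, a} = d {a, c}" "d {e, a} = d {a, e}" "d {c, b} = d {b, c}"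
    "d {e, b} = d {b, e}" "d {e, c} = d {c, e}" by (simp_all add: insert_commute)
  have dr: "drawn d (X - {a}) = d {b, c} \<union> d {c, e} \<union> d {b, e}"
    "drawn d (X - {b}) = d {a, c} \<union> d {c, e} \<union> d {a, e}"
    "drawn d (X - {c}) = d {a, b} \<union> d {b, e} \<union> d {a, e}"
    "drawn d (X - {e}) = d {a, b} \<union> d {b, c} \<union> d {a, c}"
    unfolding Xm by (rule drawn3; use X(2) in simp)+
  have t1: "theta_curve (d {a, b}) (d {a, c} \<union> d {b, c}) (d {a, e} \<union> d {b, e}) (\<phi> a) (\<phi> b)"
    using K4_theta[OF cd m(1,2,3,4)] X(2) by (simp only: cm)
  have t2: "theta_curve (d {c, e}) (d {a, c} \<union> d {a, e}) (d {b, c} \<union> d {b, e}) (\<phi> c) (\<phi> e)"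
    using K4_theta[OF cd m(3,4,1,2)] X(2) by (auto simp: cm)
  have neqs: "\<phi> u \<noteq> \<phi> v" if "u \<in> X" "v \<in> X" "u \<noteq> v" for u v using D(2)[OF that] .
  have in_c: "\<phi> c \<in> (d {a, c} \<union> d {b, c}) - {\<phi> a, \<phi> b}" and in_e: "\<phi> e \<in> (d {a, e} \<union> d {b, e}) - {\<phi> a, \<phi> b}"
    and in_a: "\<phi> a \<in> (d {a, c} \<union> d {a, e}) - {\<phi> c, \<phi> e}" and in_b: "\<phi> b \<in> (d {b, c} \<union> d {b, e}) - {\<phi> c, \<phi> e}"
    using E(3,4) neqs m X(2) by auto
  have nv: "\<phi> v \<notin> inside (drawn d (X - {v}))" if "v \<in> X" for v using neg that by blast
  have no: "\<phi> a \<notin> inside (d {c, e} \<union> (d {b, c} \<union> d {b, e}))" "\<phi> b \<notin> inside (d {c, e} \<union> (d {a, c} \<union> d {a, e}))"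
    "\<phi> c \<notin> inside (d {a, b} \<union> (d {a, e} \<union> d {b, e}))" "\<phi> e \<notin> inside (d {a, b} \<union> (d {a, c} \<union> d {b, c}))"
    using nv[OF m(1)] nv[OF m(2)] nv[OF m(3)] nv[OF m(4)] unfolding dr by (simp_all add: Un_ac)
  let ?Q = "d {a, c} \<union> d {b, c} \<union> (d {a, e} \<union> d {b, e})"
  have Q: "d {a, c} \<union> d {a, e} \<union> (d {b, c} \<union> d {b, e}) = ?Q" by blast
  have i1: "d {a, b} - {\<phi> a, \<phi> b} \<subseteq> inside ?Q"
    using theta_curve_middle[OF t1] in_c in_e no(3,4) by blast
  have i2: "d {c, e} - {\<phi> c, \<phi> e} \<subseteq> inside ?Q"
    using theta_curve_middle[OF t2] in_a in_b no(1,2) unfolding Q by blast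
  have ne: "d {a, b} \<inter> inside ?Q \<noteq> {}"
    using i1 arc_between_interior(2)[OF D(1)[OF m(1,2)]] X(2) by auto
  have dj: "d {c, e} \<inter> d {a, b} = {}" using D(5)[OF m(3,4,1,2)] X(2) by auto
  have cl: "\<phi> c \<in> closure (d {c, e} - {\<phi> c, \<phi> e})" "\<phi> e \<in> closure (d {c, e} - {\<phi> c, \<phi> e})"
    using E(2,3,4)[OF m(3,4)] X(2) by auto
  have nin: "\<phi> e \<notin> d {a, c} \<union> d {b, c}" "\<phi> c \<notin> d {a, e} \<union> d {b, e}"
    using D(3)[OF m(1,3,4)] D(3)[OF m(2,3,4)] D(3)[OF m(1,4,3)] D(3)[OF m(2,4,3)] X(2) by auto
  have "connected (d {c, e} - {\<phi> c, \<phi> e})" using E(1)[OF m(3,4)] X(2) by simp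
  moreover have "(d {c, e} - {\<phi> c, \<phi> e}) \<inter> d {a, b} \<subseteq> {\<phi> a, \<phi> b}" using dj by auto
  ultimately have "closure (d {c, e} - {\<phi> c, \<phi> e}) \<inter> ?Q \<subseteq> d {a, c} \<union> d {b, c} \<or>
     closure (d {c, e} - {\<phi> c, \<phi> e}) \<inter> ?Q \<subseteq> d {a, e} \<union> d {b, e}"
    using theta_curve_side[OF theta_curve_perm(3)[OF t1] ne] i2 by blast
  then show False using cl nin in_c in_e by blast
qed

text \<open>Every face of a plane drawing of \<open>K\<^sub>4\<close> is bounded by a triangle.\<close>

lemma K4_face:
  fixes \<phi> :: "'a \<Rightarrow> complex"
  assumes cd: "clique_drawing \<phi> d X" and X: "card X = 4"
    and W: "connected W" "W \<inter> drawn d X = {}" "\<phi> ` X \<subseteq> closure W"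
  shows False
proof -
  obtain a' b' c' e' where X0: "X = {a', b', c', e'}" "distinct [a', b', c', e']"
  proof -
    have "card X = Suc 3" using X by simp
    then obtain x S where "X = insert x S" "x \<notin> S" "card S = 3" using iffD1[OF card_Suc_eq] by blast
    moreover then obtain p q r where "S = {p, q, r}" "distinct [p, q, r]" by (auto simp: card_3_iff)
    ultimately show ?thesis by (intro that[of x p q r]) auto
  qed
  obtain e where e: "e \<in> X" "\<phi> e \<in> inside (drawn d (X - {e}))" using K4_vertex_inside[OF cd X0] by auto
  have fX: "finite X" using X0(1) by simp
  have "card (X - {e}) = 3" using X e(1) fX by simp
  then obtain a b c where abc: "X - {e} = {a, b, c}" "distinct [a, b, c]" by (auto simp: card_3_iff)
  have m: "a \<in> X" "b \<in> X" "c \<in> X" "e \<in> X" and dis: "distinct [a, b, c, e]" using abc e(1) by auto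
  note D = clique_drawingD[OF cd] and E = connected_edge_interior[OF cd]
  have cm: "d {b, a} = d {a, b}" "d {c, a} = d {a, c}" "d {e, a} = d {a, e}" "d {c, b} = d {b, c}"
    "d {e, b} = d {b, e}" "d {e, c} = d {c, e}" by (simp_all add: insert_commute)
  have t1: "theta_curve (d {a, b}) (d {a, c} \<union> d {b, c}) (d {a, e} \<union> d {b, e}) (\<phi> a) (\<phi> b)"
    using K4_theta[OF cd m(1,2,3,4)] dis by (simp only: cm)
  have t2: "theta_curve (d {c, e}) (d {a, c} \<union> d {a, e}) (d {b, c} \<union> d {b, e}) (\<phi> c) (\<phi> e)"
    using K4_theta[OF cd m(3,4,1,2)] dis by (auto simp: cm)
  let ?J = "d {a, b} \<union> (d {a, c} \<union> d {b, c})" let ?C = "d {a, e} \<union> d {b, e}"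
  have "drawn d (X - {e}) = ?J" unfolding abc(1) drawn3[OF abc(2)] by blast
  then have eJ: "\<phi> e \<in> inside ?J" using e(2) by simp
  have opJ: "open (inside ?J)" using theta_curve_scc(1)[OF t1] Jordan_curve_inside_outside(2) by blast
  have sub: "d {a, b} \<union> d {b, c} \<union> d {a, c} \<union> d {a, e} \<union> d {b, e} \<union> d {c, e} \<subseteq> drawn d X"
    by (intro Un_least edge_subset_drawn) (use m dis in auto)
  have WJ: "W \<inter> ?J = {}" "W \<inter> ?C = {}" "W \<inter> d {c, e} = {}" using W(2) sub by blast+
  have inJ: "S \<subseteq> inside ?J" if S: "connected S" "S \<inter> ?J = {}" "\<phi> e \<in> closure S" for S
  proof -
    have "inside ?J \<inter> S \<noteq> {}" using S(3) opJ eJ open_Int_closure_eq_empty[of "inside ?J" S] by blast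
    then show ?thesis using connected_inside_or_outside[OF S(1,2)] by blast
  qed
  have vcl: "\<phi> a \<in> closure W" "\<phi> b \<in> closure W" "\<phi> c \<in> closure W" "\<phi> e \<in> closure W"
    using W(3) m by auto
  \<comment> \<open>Accumulating at the enclosed vertex \<open>e\<close> forces \<open>W\<close>
    into the triangle \<open>abc\<close>; the edge \<open>ce\<close> is there for the same
    reason.\<close>
  have WinJ: "W \<subseteq> inside ?J" by (rule inJ[OF W(1) WJ(1) vcl(4)])
  let ?ce = "d {c, e} - {\<phi> c, \<phi> e}"
  have ce: "connected ?ce" "\<phi> c \<in> closure ?ce" "\<phi> e \<in> closure ?ce" using E[OF m(3,4)] dis by auto
  have ceJ: "?ce \<inter> ?J = {}" "?ce \<inter> ?C = {}"
    using D(5)[OF m(3,4,1,2)] D(4)[OF m(1,3,4)] D(4)[OF m(2,3,4)] D(4)[OF m(1,4,3)] D(4)[OF m(2,4,3)] dis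
    by (auto simp: cm)
  have ceinJ: "?ce \<subseteq> inside ?J" by (rule inJ[OF ce(1) ceJ(1) ce(3)])
  have Ce: "\<phi> e \<in> ?C" using E(4)[OF m(1,4)] dis by auto
  then have ne: "?C \<inter> inside ?J \<noteq> {}" using eJ by blast
  have cn: "\<phi> c \<notin> d {a, b}" using D(3)[OF m(1,2,3)] dis by simp
  have cin: "\<phi> c \<in> d {a, c} \<union> d {b, c}" using E(4)[OF m(1,3)] dis by auto
  let ?Q = "d {a, c} \<union> d {b, c} \<union> ?C"
  \<comment> \<open>The path \<open>aeb\<close> cuts the triangle in two. Accumulating at
    \<open>c\<close> puts both \<open>W\<close> and the edge \<open>ce\<close> into the part bounded
    by the 4-cycle \<open>?Q\<close>.\<close>
  have "W \<inter> ?C \<subseteq> {\<phi> a, \<phi> b}" "?ce \<inter> ?C \<subseteq> {\<phi> a, \<phi> b}" using WJ(2) ceJ(2) by auto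
  then have WQ: "W \<subseteq> inside ?Q" and ceQ: "?ce \<subseteq> inside ?Q"
    using theta_curve_side[OF t1 ne W(1) _ WinJ] theta_curve_side[OF t1 ne ce(1) _ ceinJ] cn cin vcl(3) ce(2)
    by blast+
  have Q: "d {a, c} \<union> d {a, e} \<union> (d {b, c} \<union> d {b, e}) = ?Q" by blast
  have "?ce \<noteq> {}" using arc_between_interior(2)[OF D(1)[OF m(3,4)]] dis by simp
  then have ne2: "d {c, e} \<inter> inside (d {a, c} \<union> d {a, e} \<union> (d {b, c} \<union> d {b, e})) \<noteq> {}"
    using ceQ unfolding Q by blast
  \<comment> \<open>Inside \<open>?Q\<close> the edge \<open>ce\<close> separates \<open>a\<close>
    from \<open>b\<close>, so \<open>W\<close> cannot accumulate at both.\<close>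
  have "closure W \<inter> ?Q \<subseteq> d {a, c} \<union> d {a, e} \<or> closure W \<inter> ?Q \<subseteq> d {b, c} \<union> d {b, e}"
    using theta_curve_side[OF theta_curve_perm(3)[OF t2] ne2 W(1)] WJ(3) WQ unfolding Q by blast
  moreover have "\<phi> a \<notin> d {b, c} \<union> d {b, e}" "\<phi> b \<notin> d {a, c} \<union> d {a, e}"
    using D(3)[OF m(2,3,1)] D(3)[OF m(2,4,1)] D(3)[OF m(1,3,2)] D(3)[OF m(1,4,2)] dis by auto
  moreover have "\<phi> a \<in> ?Q" "\<phi> b \<in> ?Q" using E(3)[OF m(1,3)] E(3)[OF m(2,3)] dis by auto
  ultimately show False using vcl(1,2) by blast
qed

lemma half_edge:
  fixes \<phi> :: "'a \<Rightarrow> 's::t2_space"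
  assumes "clique_drawing \<phi> d X" "u \<in> X" "v \<in> X" "u \<noteq> v"
  shows "connected (d {u, v} - {\<phi> v})" "\<phi> u \<in> d {u, v} - {\<phi> v}" "\<phi> v \<in> closure (d {u, v} - {\<phi> v})"
  using arc_between_half[OF clique_drawingD(1)[OF assms]] by auto

text \<open>One vertex with its four edges, stripped of their far ends, is a connected set
  accumulating at all vertices of the remaining K4.\<close>

lemma K5_not_in_plane:
  fixes \<phi> :: "'a \<Rightarrow> complex"
  assumes cd: "clique_drawing \<phi> d X" and X: "card X = 5"
  shows False
proof -
  obtain r where r: "r \<in> X" using X by fastforce
  have fX: "finite X" using X by (metis card.infinite zero_neq_numeral)
  define Y where "Y = X - {r}"
  have Y: "card Y = 4" "Y \<subseteq> X" "r \<notin> Y" using X r fX by (auto simp: Y_def)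
  note H = half_edge[OF cd r] and D = clique_drawingD[OF cd]
  define W where "W = (\<Union>v\<in>Y. d {r, v} - {\<phi> v})"
  have Yr: "v \<in> X" "r \<noteq> v" if "v \<in> Y" for v using that Y by auto
  have 1: "connected W" unfolding W_def
    using H(1,2)[OF Yr] by (intro connected_Union) blast+
  have 2: "W \<inter> drawn d Y = {}"
  proof -
    have "(d {r, v} - {\<phi> v}) \<inter> d {s, t} = {}" if "v \<in> Y" "s \<in> Y" "t \<in> Y" "s \<noteq> t" for v s t
    proof -
      consider "v = s" | "v = t" | "v \<noteq> s" "v \<noteq> t" by blast
      then show ?thesis
      proof cases
        case 1 then show ?thesis using D(4)[of r v t] r Yr that by auto
      next
        case 2 then show ?thesis using D(4)[of r v s] r Yr that by (auto simp: insert_commute)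
      next
        case 3 then show ?thesis using D(5)[of r v s t] r Yr that by auto
      qed
    qed
    then show ?thesis unfolding W_def drawn_def by blast
  qed
  have 3: "\<phi> ` Y \<subseteq> closure W"
  proof -
    have "\<phi> v \<in> closure W" if "v \<in> Y" for v
      using H(3)[OF Yr[OF that]] closure_mono[of "d {r, v} - {\<phi> v}" W] that unfolding W_def by blast
    then show ?thesis by blast
  qed
  show False using K4_face[OF clique_drawing_subset[OF cd Y(2)] Y(1) 1 2 3] .
qed

lemma clique_drawing_image:
  fixes \<phi> :: "'a \<Rightarrow> 's::topological_space" and f :: "'s \<Rightarrow> 't::topological_space"
  assumes cd: "clique_drawing \<phi> d X" and f: "continuous_on (drawn d X) f" "inj_on f (drawn d X)" and X: "2 \<le> card X"
  shows "clique_drawing (f \<circ> \<phi>) (\<lambda>e. f ` d e) X"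
proof -
  have V: "\<phi> u \<in> drawn d X" if u: "u \<in> X" for u
  proof -
    have "X \<noteq> {u}" using X by auto
    then obtain v where v: "v \<in> X" "v \<noteq> u" using u by blast
    have "arc_between (d {u, v}) (\<phi> u) (\<phi> v)" by (rule clique_drawingD(1)[OF cd u v(1) v(2)[symmetric]])
    then have "\<phi> u \<in> d {u, v}" unfolding arc_between_def by (metis pathstart_in_path_image)
    then show ?thesis using edge_subset_drawn[of u X v d] u v by auto
  qed
  have ed: "d e \<subseteq> drawn d X" if "e \<subseteq> X" "card e = 2" for e
    using that edge_subset_drawn[of _ X _ d] by (auto simp: card_2_iff)
  have inj: "inj_on (f \<circ> \<phi>) X"
    using cd V f(2) unfolding clique_drawing_def by (auto simp: inj_on_def)
  have 1: "arc_between (f ` d {u, v}) ((f \<circ> \<phi>) u) ((f \<circ> \<phi>) v) \<and> f ` d {u, v} \<inter> (f \<circ> \<phi>) ` X = (f \<circ> \<phi>) ` {u, v}"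
    if uv: "u \<in> X" "v \<in> X" "u \<noteq> v" for u v
  proof
    have a: "arc_between (d {u, v}) (\<phi> u) (\<phi> v)" "d {u, v} \<inter> \<phi> ` X = \<phi> ` {u, v}"
      using cd uv by (simp_all add: clique_drawing_def)
    have s: "d {u, v} \<subseteq> drawn d X" using edge_subset_drawn uv by metis
    show "arc_between (f ` d {u, v}) ((f \<circ> \<phi>) u) ((f \<circ> \<phi>) v)"
      using arc_between_image[OF a(1)] continuous_on_subset[OF f(1) s] inj_on_subset[OF f(2) s] by simp
    have "f ` d {u, v} \<inter> f ` \<phi> ` X = f ` (d {u, v} \<inter> \<phi> ` X)"
      using V s by (intro inj_on_image_Int[OF f(2), symmetric]) auto
    then show "f ` d {u, v} \<inter> (f \<circ> \<phi>) ` X = (f \<circ> \<phi>) ` {u, v}" using a(2) by (simp only: image_comp[symmetric])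
  qed
  have 2: "f ` d e \<inter> f ` d g = (f \<circ> \<phi>) ` (e \<inter> g)" if "e \<subseteq> X" "g \<subseteq> X" "card e = 2" "card g = 2" "e \<noteq> g" for e g
  proof -
    have "f ` d e \<inter> f ` d g = f ` (d e \<inter> d g)"
      using ed that by (intro inj_on_image_Int[OF f(2), symmetric]) auto
    moreover have "d e \<inter> d g = \<phi> ` (e \<inter> g)" using cd that by (simp add: clique_drawing_def)
    ultimately show ?thesis by (simp only: image_comp)
  qed
  show ?thesis unfolding clique_drawing_def using inj 1 2 by simp
qed

lemma K5_drawing_not_planar:
  fixes \<phi> :: "'a \<Rightarrow> 's::topological_space" and f :: "'s \<Rightarrow> complex"
  assumes "clique_drawing \<phi> d X" "card X = 5" "continuous_on (drawn d X) f" "inj_on f (drawn d X)"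
  shows False
  using K5_not_in_plane[OF clique_drawing_image[OF assms(1,3,4)]] assms(2) by simp

section \<open>Arguments of circle-valued maps\<close>

text \<open>A lift of \<open>h\<close> through the universal cover of the circle. It plays the role
  of vanishing winding number along the closed curves in \<open>S\<close>.\<close>

definition has_arg :: "'s::topological_space set \<Rightarrow> ('s \<Rightarrow> complex) \<Rightarrow> bool" where
  "has_arg S h \<longleftrightarrow> (\<exists>\<theta>. continuous_on S \<theta> \<and> (\<forall>x\<in>S. h x = cis (\<theta> x)))"

lemma cis_eq_obtain_int:
  assumes "cis s = cis t" obtains k :: int where "s = t + 2 * pi * k"
proof -
  have "exp (\<i> * of_real s) = exp (\<i> * of_real t)" using assms by (simp add: cis_conv_exp)
  then obtain n :: int where n: "\<i> * of_real s = \<i> * of_real t + (of_int (2 * n) * pi) * \<i>"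
    by (auto simp: exp_eq)
  then have "Im (\<i> * of_real s) = Im (\<i> * of_real t + (of_int (2 * n) * pi) * \<i>)" by simp
  then have "s = t + 2 * pi * n" by simp
  then show ?thesis by (rule that)
qed

lemma cis_Arg_unit: "norm z = 1 \<Longrightarrow> cis (Arg z) = z"
  using cis_Arg[of z] by (cases "z = 0") (auto simp: sgn_eq)

lemma cis_add_int: "cis (t + 2 * pi * of_int k) = cis t"
  by (simp add: cis_mult[symmetric] cis_conv_exp[of "2 * pi * of_int k"] exp_eq_1)

lemma args_differ_by_constant:
  assumes "connected S" "continuous_on S \<theta>" "continuous_on S \<theta>'" "\<And>x. x \<in> S \<Longrightarrow> cis (\<theta> x) = cis (\<theta>' x)"
  obtains k :: int where "\<And>x. x \<in> S \<Longrightarrow> \<theta> x = \<theta>' x + 2 * pi * k"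
proof -
  have k: "\<exists>k :: int. \<theta> x = \<theta>' x + 2 * pi * k" if "x \<in> S" for x
    using cis_eq_obtain_int[OF assms(4)[OF that]] by metis
  let ?f = "\<lambda>x. (\<theta> x - \<theta>' x) / (2 * pi)"
  have Z: "?f x \<in> \<int>" if "x \<in> S" for x using k[OF that] by auto
  have "?f constant_on S"
  proof (rule continuous_discrete_range_constant[OF assms(1)])
    show "continuous_on S ?f" by (intro continuous_intros assms) auto
    show "\<exists>e>0. \<forall>y. y \<in> S \<and> ?f y \<noteq> ?f x \<longrightarrow> e \<le> norm (?f y - ?f x)" if "x \<in> S" for x
    proof (intro exI[of _ 1] conjI allI impI)
      fix y assume y: "y \<in> S \<and> ?f y \<noteq> ?f x"
      then have "?f y - ?f x \<in> \<int>" "?f y - ?f x \<noteq> 0" using Z that by (auto intro: Ints_diff)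
      then show "1 \<le> norm (?f y - ?f x)" by (metis Ints_nonzero_abs_ge1 real_norm_def)
    qed simp
  qed
  then obtain c where c: "\<And>x. x \<in> S \<Longrightarrow> ?f x = c" by (auto simp: constant_on_def)
  show ?thesis
  proof (cases "S = {}")
    case True then show ?thesis using that[of 0] by simp
  next
    case False
    then obtain x0 where x0: "x0 \<in> S" by auto
    then obtain k where "\<theta> x0 = \<theta>' x0 + 2 * pi * of_int k" using k by blast
    then have ck: "c = of_int k" using c[OF x0] by (simp add: field_simps)
    have "\<theta> x = \<theta>' x + 2 * pi * k" if "x \<in> S" for x using c[OF that] ck by (simp add: field_simps)
    then show ?thesis by (rule that)
  qed
qed

text \<open>On the connected intersection the two arguments differ by a constant multiple of
  \<open>2 * pi\<close>, so shifting one of them makes them fit together.\<close>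

lemma has_arg_Un:
  fixes S :: "'s::t2_space set"
  assumes "closed S" "closed T" "connected (S \<inter> T)" "has_arg S h" "has_arg T h"
  shows "has_arg (S \<union> T) h"
proof -
  obtain \<theta>1 \<theta>2 where t: "continuous_on S \<theta>1" "\<And>x. x \<in> S \<Longrightarrow> h x = cis (\<theta>1 x)"
    "continuous_on T \<theta>2" "\<And>x. x \<in> T \<Longrightarrow> h x = cis (\<theta>2 x)"
    using assms(4,5) unfolding has_arg_def by metis
  have "cis (\<theta>1 x) = cis (\<theta>2 x)" if "x \<in> S \<inter> T" for x using t(2)[of x] t(4)[of x] that by simp
  then obtain k :: int where k: "\<And>x. x \<in> S \<inter> T \<Longrightarrow> \<theta>1 x = \<theta>2 x + 2 * pi * k"
    using args_differ_by_constant[OF assms(3), of \<theta>1 \<theta>2] t continuous_on_subset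
    by (metis inf_le1 inf_le2)
  let ?\<theta> = "\<lambda>x. if x \<in> S then \<theta>1 x else \<theta>2 x + 2 * pi * k"
  have "continuous_on (S \<union> T) ?\<theta>"
    using k by (intro continuous_on_cases assms t continuous_intros) auto
  moreover have "h x = cis (?\<theta> x)" if "x \<in> S \<union> T" for x
    using that t by (auto simp: cis_add_int)
  ultimately show ?thesis unfolding has_arg_def by blast
qed

lemma path_has_arg:
  assumes "continuous_on {0..1} (h :: real \<Rightarrow> complex)" "\<And>t. t \<in> {0..1} \<Longrightarrow> norm (h t) = 1"
  shows "has_arg {0..1} h"
proof -
  have nz: "h t \<noteq> 0" if "t \<in> {0..1}" for t using assms(2)[OF that] by auto
  obtain l where l: "continuous_on {0..1} l" "\<And>t. t \<in> {0..1} \<Longrightarrow> h t = exp (l t)"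
    using continuous_logarithm_on_contractible[OF assms(1) convex_imp_contractible nz] by auto
  have "h t = cis (Im (l t))" if "t \<in> {0..1}" for t
  proof -
    have "exp (Re (l t)) = 1" using l(2)[OF that] assms(2)[OF that] by (metis norm_exp_eq_Re)
    then have "Re (l t) = 0" by simp
    then show ?thesis using l(2)[OF that] by (simp add: exp_eq_polar)
  qed
  moreover have "continuous_on {0..1} (\<lambda>t. Im (l t))" by (intro continuous_intros l)
  ultimately show ?thesis unfolding has_arg_def by blast
qed

text \<open>A continuous map from a compact space to a Hausdorff space is closed, hence a quotient
  map onto its image. This moves arguments from the parameter interval to the curve.\<close>

lemma descend_continuous:
  fixes c :: "'s::t2_space \<Rightarrow> 't::t2_space" and \<theta> :: "'s \<Rightarrow> real"
  assumes "compact K" "continuous_on K c" "continuous_on K \<theta>"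
    and "\<And>x y. x \<in> K \<Longrightarrow> y \<in> K \<Longrightarrow> c x = c y \<Longrightarrow> \<theta> x = \<theta> y"
  obtains \<eta> where "continuous_on (c ` K) \<eta>" "\<And>x. x \<in> K \<Longrightarrow> \<eta> (c x) = \<theta> x"
proof -
  define \<eta> where "\<eta> y = \<theta> (SOME x. x \<in> K \<and> c x = y)" for y
  have eta: "\<eta> (c x) = \<theta> x" if "x \<in> K" for x
  proof -
    have "(SOME z. z \<in> K \<and> c z = c x) \<in> K \<and> c (SOME z. z \<in> K \<and> c z = c x) = c x"
      by (rule someI[of _ x]) (use that in simp)
    then show ?thesis unfolding \<eta>_def using assms(4) that by blast
  qed
  have cl: "closed (c ` K)" using assms(1,2) by (intro compact_imp_closed compact_continuous_image)
  have "continuous_on (c ` K) \<eta>"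
    unfolding continuous_on_closed_vimage[OF cl]
  proof (intro allI impI)
    fix B :: "real set" assume B: "closed B"
    have "\<eta> -` B \<inter> c ` K = c ` (\<theta> -` B \<inter> K)" using eta by auto
    moreover have "closed (\<theta> -` B \<inter> K)"
      using B assms(3) continuous_on_closed_vimage[OF compact_imp_closed[OF assms(1)]] by blast
    then have "compact (K \<inter> (\<theta> -` B \<inter> K))" by (rule compact_Int_closed[OF assms(1)])
    then have "compact (\<theta> -` B \<inter> K)" by (simp add: inf_commute inf_left_idem)
    then have "compact (c ` (\<theta> -` B \<inter> K))"
      by (rule compact_continuous_image[OF continuous_on_subset[OF assms(2) Int_lower2]])
    ultimately show "closed (\<eta> -` B \<inter> c ` K)" by (simp add: compact_imp_closed)
  qed
  then show ?thesis using eta that by blast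
qed

lemma arc_has_arg:
  fixes A :: "'s::t2_space set"
  assumes "arc_between A a b" "continuous_on A h" "\<And>x. x \<in> A \<Longrightarrow> norm (h x) = 1"
  shows "has_arg A h"
proof -
  obtain g where g: "arc g" "g ` {0..1} = A"
    using assms(1) unfolding arc_between_def path_image_def by auto
  have cg: "continuous_on {0..1} g" and ig: "inj_on g {0..1}" using g(1) by (auto simp: arc_def path_def)
  have "continuous_on {0..1} (h \<circ> g)" using cg assms(2) g(2) by (intro continuous_on_compose) auto
  moreover have "norm ((h \<circ> g) t) = 1" if "t \<in> {0..1}" for t
    using assms(3)[of "g t"] g(2) that by auto
  ultimately have "has_arg {0..1} (h \<circ> g)" by (rule path_has_arg)
  then obtain \<theta> where t: "continuous_on {0..1} \<theta>" "\<And>t. t \<in> {0..1} \<Longrightarrow> h (g t) = cis (\<theta> t)"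
    unfolding has_arg_def by auto
  obtain \<eta> where "continuous_on (g ` {0..1}) \<eta>" "\<And>t. t \<in> {0..1} \<Longrightarrow> \<eta> (g t) = \<theta> t"
    using descend_continuous[OF compact_Icc cg t(1)] ig by (metis inj_onD)
  then show ?thesis unfolding has_arg_def using t(2) g(2) by (intro exI[of _ \<eta>]) auto
qed

lemma has_arg_mult_powi:
  assumes "has_arg S h" "has_arg S k"
  shows "has_arg S (\<lambda>x. h x powi a * k x powi b)"
proof -
  obtain \<theta>1 \<theta>2 where t: "continuous_on S \<theta>1" "\<And>x. x \<in> S \<Longrightarrow> h x = cis (\<theta>1 x)"
    "continuous_on S \<theta>2" "\<And>x. x \<in> S \<Longrightarrow> k x = cis (\<theta>2 x)"
    using assms unfolding has_arg_def by metis
  have "continuous_on S (\<lambda>x. of_int a * \<theta>1 x + of_int b * \<theta>2 x)" by (intro continuous_intros t)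
  moreover have "h x powi a * k x powi b = cis (of_int a * \<theta>1 x + of_int b * \<theta>2 x)" if "x \<in> S" for x
    using t that by (simp add: cis_power_int cis_mult)
  ultimately show ?thesis unfolding has_arg_def by blast
qed

lemma has_arg_cong: "(\<And>x. x \<in> S \<Longrightarrow> h x = k x) \<Longrightarrow> has_arg S h = has_arg S k"
  unfolding has_arg_def by auto

lemma powi_monomial:
  fixes z w :: complex
  assumes "z \<noteq> 0" "w \<noteq> 0"
  shows "(z powi a * w powi b) powi m * (z powi c * w powi e) powi n = z powi (a * m + c * n) * w powi (b * m + e * n)"
  using assms by (simp add: power_int_mult_distrib power_int_mult power_int_add)

text \<open>The exponents \<open>e\<close>, \<open>- b\<close>, \<open>- c\<close>, \<open>a\<close>
  are the entries of the inverse of the matrix with rows \<open>(a, b)\<close> and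
  \<open>(c, e)\<close>.\<close>

lemma powi_unimodular:
  fixes z w :: complex
  assumes "z \<noteq> 0" "w \<noteq> 0" "a * e - b * c = (1 :: int)"
  shows "(z powi a * w powi b) powi e * (z powi c * w powi e) powi (- b) = z"
    "(z powi a * w powi b) powi (- c) * (z powi c * w powi e) powi a = w"
proof -
  have "a * e + c * (- b) = 1" "b * e + e * (- b) = 0" "a * (- c) + c * a = 0" "b * (- c) + e * a = 1"
    using assms(3) by (simp_all add: algebra_simps)
  then show "(z powi a * w powi b) powi e * (z powi c * w powi e) powi (- b) = z"
    "(z powi a * w powi b) powi (- c) * (z powi c * w powi e) powi a = w"
    unfolding powi_monomial[OF assms(1,2)] by simp_all
qed

text \<open>On a simple closed curve two circle-valued maps have winding numbers \<open>m\<^sub>1\<close>, \<open>m\<^sub>2\<close>; a unimodular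
  substitution makes the second of them vanish.\<close>

lemma scc_unimodular_arg:
  fixes J :: "'s::t2_space set"
  assumes J: "simple_closed_curve J" and h: "continuous_on J h" "\<And>x. x \<in> J \<Longrightarrow> norm (h x) = 1"
    and k: "continuous_on J k" "\<And>x. x \<in> J \<Longrightarrow> norm (k x) = 1"
  obtains a b c e :: int where "a * e - b * c = 1" "has_arg J (\<lambda>x. h x powi c * k x powi e)"
proof -
  obtain p where p: "simple_path p" "pathfinish p = pathstart p" "path_image p = J"
    using J unfolding simple_closed_curve_def by auto
  have cp: "continuous_on {0..1} p" and im: "p ` {0..1} = J" and p01: "p 0 = p 1"
    using p by (auto simp: simple_path_def path_def path_image_def pathstart_def pathfinish_def)
  have lf: "s = t \<or> s = 0 \<and> t = 1 \<or> s = 1 \<and> t = 0" if "s \<in> {0..1}" "t \<in> {0..1}" "p s = p t" for s t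
    using p(1) that unfolding simple_path_def loop_free_def by blast
  have pI: "p t \<in> J" if "t \<in> {0..1}" for t using im that by auto
  have "continuous_on {0..1} (h \<circ> p)" using continuous_on_compose[OF cp, of h] h(1) im by simp
  then have "has_arg {0..1} (h \<circ> p)" by (rule path_has_arg) (use h(2) pI in auto)
  then obtain \<theta>1 where t1: "continuous_on {0..1} \<theta>1" "\<And>t. t \<in> {0..1} \<Longrightarrow> h (p t) = cis (\<theta>1 t)"
    unfolding has_arg_def by auto
  have "continuous_on {0..1} (k \<circ> p)" using continuous_on_compose[OF cp, of k] k(1) im by simp
  then have "has_arg {0..1} (k \<circ> p)" by (rule path_has_arg) (use k(2) pI in auto)
  then obtain \<theta>2 where t2: "continuous_on {0..1} \<theta>2" "\<And>t. t \<in> {0..1} \<Longrightarrow> k (p t) = cis (\<theta>2 t)"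
    unfolding has_arg_def by auto
  obtain m1 :: int where m1: "\<theta>1 1 = \<theta>1 0 + 2 * pi * m1"
    using t1(2)[of 0] t1(2)[of 1] p01 cis_eq_obtain_int[of "\<theta>1 1" "\<theta>1 0"] by auto
  obtain m2 :: int where m2: "\<theta>2 1 = \<theta>2 0 + 2 * pi * m2"
    using t2(2)[of 0] t2(2)[of 1] p01 cis_eq_obtain_int[of "\<theta>2 1" "\<theta>2 0"] by auto
  \<comment> \<open>The row \<open>(c, e)\<close> is \<open>(- m2, m1)\<close> divided by the gcd,
    and Bezout coefficients complete it to determinant 1. The combined argument then returns to its
    initial value, so it descends to the curve.\<close>
  obtain a b c e :: int where ab: "a * e - b * c = 1" "c * m1 + e * m2 = 0"
  proof (cases "m1 = 0 \<and> m2 = 0")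
    case True then show ?thesis using that[of 1 1 0 0] by simp
  next
    case False
    define g where "g = gcd m1 m2"
    have g: "g \<noteq> 0" using False by (auto simp: g_def)
    obtain m1' m2' where m': "m1 = m1' * g" "m2 = m2' * g" "coprime m1' m2'"
      using gcd_coprime_exists[of m1 m2] g unfolding g_def by blast
    obtain x y where "x * m1' + y * m2' = 1" using m'(3) bezout_int[of m1' m2'] by (auto simp: coprime_iff_gcd_eq_1)
    then show ?thesis using m' by (intro that[of x m1' y "- m2'"]) (auto simp: algebra_simps)
  qed
  let ?\<theta> = "\<lambda>t. of_int c * \<theta>1 t + of_int e * \<theta>2 t"
  have "?\<theta> 1 = ?\<theta> 0 + 2 * pi * of_int (c * m1 + e * m2)" by (simp add: m1 m2 algebra_simps)
  then have t01: "?\<theta> 1 = ?\<theta> 0" using ab(2) by simp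
  have cont: "continuous_on {0..1} ?\<theta>" by (intro continuous_intros t1 t2)
  have wd: "?\<theta> s = ?\<theta> t" if "s \<in> {0..1}" "t \<in> {0..1}" "p s = p t" for s t
    using lf[OF that] t01 by auto
  obtain \<eta> where eta: "continuous_on (p ` {0..1}) \<eta>" "\<And>t. t \<in> {0..1} \<Longrightarrow> \<eta> (p t) = ?\<theta> t"
    using descend_continuous[OF compact_Icc cp cont wd] by blast
  have "h x powi c * k x powi e = cis (\<eta> x)" if x: "x \<in> J" for x
  proof -
    obtain t where t: "t \<in> {0..1}" "x = p t" using im x by auto
    show ?thesis using eta(2)[OF t(1)] t1(2)[OF t(1)] t2(2)[OF t(1)] t(2)
      by (simp add: cis_power_int cis_mult)
  qed
  then have "has_arg J (\<lambda>x. h x powi c * k x powi e)" unfolding has_arg_def using eta(1) im by auto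
  then show ?thesis using that ab(1) by blast
qed


text \<open>The torus is only used through two circle-valued coordinates \<open>u\<^sub>1\<close>, \<open>u\<^sub>2\<close>, the second of which has an
  argument along the curve \<open>J\<close>, while the first does not. The curve \<open>S\<close> is the lift of \<open>J\<close> to the
  annular covering space, the punctured plane with deck transformation \<open>z \<mapsto> e\<^bsup>2\<pi>\<^esup> z\<close>.\<close>

locale essential_curve =
  fixes T J :: "'s::t2_space set" and u1 u2 :: "'s \<Rightarrow> complex" and \<theta> :: "'s \<Rightarrow> real"
  assumes J: "simple_closed_curve J" "J \<subseteq> T"
    and u: "continuous_on T u1" "continuous_on T u2"
    and norm_u: "\<And>x. x \<in> T \<Longrightarrow> norm (u1 x) = 1" "\<And>x. x \<in> T \<Longrightarrow> norm (u2 x) = 1"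
    and u_inj: "\<And>x y. x \<in> T \<Longrightarrow> y \<in> T \<Longrightarrow> u1 x = u1 y \<Longrightarrow> u2 x = u2 y \<Longrightarrow> x = y"
    and arg: "continuous_on J \<theta>" "\<And>x. x \<in> J \<Longrightarrow> u2 x = cis (\<theta> x)"
    and no_arg: "\<not> has_arg J u1"
begin

definition S :: "complex set" where
  "S = (\<lambda>x. u1 x * of_real (exp (\<theta> x))) ` J"

abbreviation sc :: "real \<Rightarrow> complex \<Rightarrow> complex" where
  "sc t z \<equiv> of_real (exp t) * z"

lemma norm_sc: "norm (sc t z) = exp t * norm z"
  by (simp add: norm_mult)

lemma sc_sc: "sc s (sc t z) = sc (s + t) z"
  by (simp add: exp_add mult.assoc)

lemma SI: "x \<in> J \<Longrightarrow> sc (\<theta> x) (u1 x) \<in> S"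
  by (auto simp: S_def mult.commute)

lemma SE: assumes "z \<in> S" obtains x where "x \<in> J" "z = sc (\<theta> x) (u1 x)"
  using assms by (auto simp: S_def mult.commute)

lemma polar_eq:
  assumes "x \<in> T" "y \<in> T" "sc s (u1 x) = sc t (u1 y)" shows "s = t" "u1 x = u1 y"
proof -
  have "exp s = exp t" using arg_cong[OF assms(3), of norm] assms(1,2) norm_u(1) by (simp add: norm_mult)
  then show "s = t" by simp
  then show "u1 x = u1 y" using assms(3) by simp
qed

lemma scc_S: "simple_closed_curve S"
  unfolding S_def
proof (rule simple_closed_curve_image[OF J(1)])
  show "continuous_on J (\<lambda>x. u1 x * of_real (exp (\<theta> x)))"
    by (intro continuous_intros arg continuous_on_subset[OF u(1) J(2)])
  show "inj_on (\<lambda>x. u1 x * of_real (exp (\<theta> x))) J"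
  proof (rule inj_onI)
    fix x y assume a: "x \<in> J" "y \<in> J" "u1 x * of_real (exp (\<theta> x)) = u1 y * of_real (exp (\<theta> y))"
    have "x \<in> T" "y \<in> T" using a J by auto
    then have "\<theta> x = \<theta> y" "u1 x = u1 y" using polar_eq[of x y "\<theta> x" "\<theta> y"] a by (simp_all add: mult.commute)
    then show "x = y" using u_inj[of x y] arg(2) a J by auto
  qed
qed

lemmas Jordan_S = Jordan_curve_inside_outside[OF scc_S]

lemma S_compact: "compact S" "connected S" "S \<noteq> {}"
  using simple_closed_curveD[OF scc_S] by auto

lemma zero_notin_S: "0 \<notin> S"
proof
  assume "0 \<in> S"
  then obtain x where "x \<in> J" "0 = sc (\<theta> x) (u1 x)" by (rule SE)
  then show False using norm_u(1)[of x] J(2) by auto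
qed

text \<open>If 0 were not enclosed, radial projection from 0 would be inessential on
  \<open>S\<close> and have a continuous logarithm there. Radial projection undoes the scaling, so
  this would be an argument of \<open>u1\<close> on \<open>J\<close>.\<close>

lemma zero_inside_S: "0 \<in> inside S"
proof (rule ccontr)
  assume "0 \<notin> inside S"
  then have "\<not> bounded (connected_component_set (- S) 0)" using zero_notin_S by (auto simp: inside_def)
  then obtain c where "homotopic_with_canon (\<lambda>x. True) S (sphere 0 1)
      (\<lambda>x. inverse (norm (x - 0)) *\<^sub>R (x - 0)) (\<lambda>x. c)"
    using Borsuk_map_essential_bounded_component[OF S_compact(1) zero_notin_S] by blast
  then obtain l where l: "continuous_on S l"
    "\<And>z. z \<in> S \<Longrightarrow> inverse (norm (z - 0)) *\<^sub>R (z - 0) = exp (\<i> * of_real (l z))"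
    using inessential_eq_continuous_logarithm_circle[of S "\<lambda>x. inverse (norm (x - 0)) *\<^sub>R (x - 0)"] by blast
  let ?g = "\<lambda>x. u1 x * of_real (exp (\<theta> x))"
  have "continuous_on J (l \<circ> ?g)"
    by (intro continuous_on_compose continuous_intros arg continuous_on_subset[OF u(1) J(2)])
      (use l(1) in \<open>simp add: S_def\<close>)
  moreover have "u1 x = cis ((l \<circ> ?g) x)" if x: "x \<in> J" for x
  proof -
    have n: "norm (u1 x) = 1" using norm_u(1) J(2) x by auto
    have "?g x \<in> S" using x by (auto simp: S_def)
    then have "inverse (norm (?g x)) *\<^sub>R ?g x = cis (l (?g x))" using l(2) by (simp add: cis_conv_exp)
    moreover have "inverse (norm (?g x)) *\<^sub>R ?g x = u1 x"
      unfolding norm_mult n by (simp add: scaleR_conv_of_real field_simps)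
    ultimately show ?thesis by simp
  qed
  ultimately have "has_arg J u1" unfolding has_arg_def by blast
  then show False using no_arg by simp
qed

lemma sc_S_disjoint:
  assumes "k \<noteq> 0" shows "sc (2 * pi * of_int k) ` S \<inter> S = {}"
proof (rule ccontr)
  assume "sc (2 * pi * of_int k) ` S \<inter> S \<noteq> {}"
  then obtain z where z: "z \<in> S" "sc (2 * pi * of_int k) z \<in> S" by auto
  obtain x where x: "x \<in> J" "z = sc (\<theta> x) (u1 x)" using z(1) by (rule SE)
  obtain y where y: "y \<in> J" "sc (2 * pi * of_int k) z = sc (\<theta> y) (u1 y)" using z(2) by (rule SE)
  have xy: "x \<in> T" "y \<in> T" using x y J by auto
  have "sc (2 * pi * of_int k + \<theta> x) (u1 x) = sc (\<theta> y) (u1 y)" using x y by (simp only: sc_sc)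
  from polar_eq[OF xy this] have e: "\<theta> y = \<theta> x + 2 * pi * of_int k" "u1 x = u1 y" by auto
  then have "u2 x = u2 y" using arg(2) x y by (simp add: cis_add_int)
  then have "x = y" using u_inj[OF xy e(2)] by simp
  then show False using e(1) assms by simp
qed

lemma sc_image:
  assumes "connected R" shows "connected (sc t ` R)"
  by (intro connected_continuous_image assms continuous_intros)

text \<open>The point of \<open>S\<close> nearest to 0 is moved into a disc about 0 that misses
  \<open>S\<close>, and connectedness takes the rest of the translate along. For outward translates
  the farthest point is used.\<close>

lemma sc_S_inside:
  assumes "k < 0" shows "sc (2 * pi * of_int k) ` S \<subseteq> inside S"
proof -
  obtain s where s: "s \<in> S" "\<And>z. z \<in> S \<Longrightarrow> norm s \<le> norm z"
    using continuous_attains_inf[OF S_compact(1,3), of norm] by (auto intro: continuous_intros)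
  have s0: "s \<noteq> 0" using s(1) zero_notin_S by auto
  have "x \<notin> S" if "x \<in> ball 0 (norm s)" for x using s(2)[of x] that by auto
  then have "ball 0 (norm s) \<inter> S = {}" by blast
  then have b: "ball 0 (norm s) \<subseteq> inside S"
    using zero_inside_S s0 by (intro connected_inside_or_outside[of _ _ 0]) auto
  have neg: "2 * pi * of_int k < 0" using assms by (simp add: mult_pos_neg)
  have "norm (sc (2 * pi * of_int k) s) < norm s" unfolding norm_sc using neg s0 by simp
  then have "sc (2 * pi * of_int k) s \<in> inside S" using b by auto
  then show ?thesis
    using s(1) sc_S_disjoint[of k] assms sc_image[OF S_compact(2)]
    by (intro connected_inside_or_outside[of _ _ "sc (2 * pi * of_int k) s"]) auto
qed

lemma sc_S_outside:
  assumes "k > 0" shows "sc (2 * pi * of_int k) ` S \<subseteq> outside S"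
proof (rule ccontr)
  assume "\<not> ?thesis"
  then obtain z where z: "z \<in> S" "sc (2 * pi * of_int k) z \<notin> outside S" by auto
  have "sc (2 * pi * of_int k) z \<notin> S" using z(1) sc_S_disjoint[of k] assms by auto
  then have zi: "sc (2 * pi * of_int k) z \<in> inside S" using z(2) outside_inside[of S] by blast
  have sub: "sc (2 * pi * of_int k) ` S \<subseteq> inside S"
    using z(1) sc_S_disjoint[of k] assms sc_image[OF S_compact(2)]
    by (intro connected_inside_or_outside[OF _ _ _ zi]) auto
  obtain s where s: "s \<in> S" "\<And>z. z \<in> S \<Longrightarrow> norm z \<le> norm s"
    using continuous_attains_sup[OF S_compact(1,3), of norm] by (auto intro: continuous_intros)
  have s0: "s \<noteq> 0" using s(1) zero_notin_S by auto
  have "S \<subseteq> cball 0 (norm s)" using s(2) by auto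
  then have "- cball 0 (norm s) \<subseteq> outside S" by (intro outside_subset_convex) auto
  moreover have "norm (sc (2 * pi * of_int k) s) > norm s" unfolding norm_sc using assms s0 by simp
  ultimately have "sc (2 * pi * of_int k) s \<in> outside S" by auto
  then show False using sub s(1) inside_Int_outside[of S] by blast
qed

text \<open>The scaled inside contains 0 and cannot meet \<open>S\<close>: scaling back would put a
  point of \<open>inside S\<close> on an outward translate of \<open>S\<close>.\<close>

lemma sc_inside:
  assumes "k < 0" "z \<in> inside S" shows "sc (2 * pi * of_int k) z \<in> inside S"
proof -
  let ?t = "2 * pi * real_of_int k"
  have "sc ?t ` inside S \<inter> S = {}"
  proof (rule ccontr)
    assume "sc ?t ` inside S \<inter> S \<noteq> {}"
    then obtain w where w: "w \<in> inside S" "sc ?t w \<in> S" by auto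
    have "0 < - k" using assms(1) by simp
    then have "sc (2 * pi * of_int (- k)) (sc ?t w) \<in> outside S" using sc_S_outside w(2) by blast
    moreover have "sc (2 * pi * of_int (- k)) (sc ?t w) = w" unfolding sc_sc by simp
    ultimately have "w \<in> outside S" by (simp only:)
    then show False using w(1) inside_Int_outside[of S] by blast
  qed
  then have "sc ?t ` inside S \<subseteq> inside S"
    using zero_inside_S by (intro connected_inside_or_outside[of _ _ 0] sc_image Jordan_S(3)) (auto intro: image_eqI[of _ _ 0])
  then show ?thesis using assms(2) by blast
qed

text \<open>A complementary point of \<open>J\<close> has exactly one lift between \<open>e\<^bsup>-2\<pi>\<^esup> S\<close> and \<open>S\<close>.\<close>

definition lift_arg :: "'s \<Rightarrow> real \<Rightarrow> bool" where
  "lift_arg m \<tau> \<longleftrightarrow> u2 m = cis \<tau> \<and> sc \<tau> (u1 m) \<in> inside S \<and> sc (\<tau> + 2 * pi) (u1 m) \<in> outside S"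

lemma lift_notin_S:
  assumes "m \<in> T - J" "u2 m = cis \<tau>" shows "sc \<tau> (u1 m) \<noteq> sc (2 * pi * of_int k + \<theta> x) (u1 x) \<or> x \<notin> J"
proof (rule ccontr)
  assume "\<not> ?thesis"
  then have x: "x \<in> J" "x \<in> T" "sc \<tau> (u1 m) = sc (2 * pi * of_int k + \<theta> x) (u1 x)" using J(2) by auto
  have mT: "m \<in> T" using assms(1) by simp
  have e: "\<tau> = \<theta> x + 2 * pi * of_int k" "u1 m = u1 x" using polar_eq[OF mT x(2,3)] by simp_all
  have "u2 m = u2 x" unfolding assms(2) arg(2)[OF x(1)] e(1) by (rule cis_add_int)
  then have "m = x" by (rule u_inj[OF mT x(2) e(2)])
  then show False using x assms by simp
qed

lemma lift_in_or_out:
  assumes "m \<in> T - J" "u2 m = cis \<tau>" shows "sc \<tau> (u1 m) \<in> inside S \<or> sc \<tau> (u1 m) \<in> outside S"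
proof -
  have "sc \<tau> (u1 m) \<notin> S"
  proof
    assume "sc \<tau> (u1 m) \<in> S"
    then obtain x where "x \<in> J" "sc \<tau> (u1 m) = sc (\<theta> x) (u1 x)" by (rule SE)
    then show False using lift_notin_S[OF assms, of 0 x] by simp
  qed
  then show ?thesis using outside_inside[of S] by blast
qed

text \<open>The lifts of \<open>m\<close> have radii \<open>exp\<close> of an arithmetic
  progression. Those near 0 lie inside \<open>S\<close>, while not all larger ones can since the
  inside is bounded; so at some index the lifts leave the inside.\<close>

lemma lift_arg_exists:
  assumes m: "m \<in> T - J" shows "\<exists>\<tau>. lift_arg m \<tau>"
proof -
  have "norm (u2 m) = 1" using norm_u(2) m by simp
  then have t0: "u2 m = cis (Arg (u2 m))" by (simp add: cis_Arg_unit)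
  let ?t = "\<lambda>k :: int. Arg (u2 m) + 2 * pi * of_int k"
  have tk: "u2 m = cis (?t k)" for k using t0 by (simp only: cis_add_int)
  let ?I = "\<lambda>k. sc (?t k) (u1 m) \<in> inside S"
  have n: "norm (sc t (u1 m)) = exp t" for t using norm_u(1) m by (simp add: norm_mult)
  have "\<exists>k. ?I k \<and> \<not> ?I (k + 1)"
  proof (rule ccontr)
    assume "\<not> ?thesis"
    then have step: "?I (k + 1)" if "?I k" for k using that by blast
    obtain e where e: "e > 0" "ball 0 e \<subseteq> inside S"
      using zero_inside_S Jordan_S(2) openE by blast
    obtain N :: int where N: "of_int N < (ln e - Arg (u2 m)) / (2 * pi)"
      using ex_of_int_less by blast
    have "?t N < ln e" using N by (simp add: field_simps)
    then have "exp (?t N) < e" using e(1) by (metis exp_less_cancel_iff exp_ln)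
    then have IN: "?I N" using e(2) n by (auto simp del: norm_mult)
    have all: "?I k" if "k \<ge> N" for k
      using that by (induct k rule: int_ge_induct) (use IN in simp, rule step)
    obtain B where B: "\<And>z. z \<in> inside S \<Longrightarrow> norm z \<le> B" "B > 0"
      using Jordan_S(6) unfolding bounded_pos by auto
    obtain M :: int where M: "(ln B - Arg (u2 m)) / (2 * pi) < of_int M" using ex_less_of_int by blast
    let ?k = "max M N"
    have "(ln B - Arg (u2 m)) / (2 * pi) < of_int ?k" using M by (simp add: less_max_iff_disj)
    then have "ln B < ?t ?k" by (simp add: field_simps)
    then have "B < exp (?t ?k)" using B(2) by (metis exp_less_cancel_iff exp_ln)
    moreover have "exp (?t ?k) \<le> B" using B(1)[OF all[of ?k]] n by simp
    ultimately show False by simp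
  qed
  then obtain k where k: "?I k" "\<not> ?I (k + 1)" by blast
  have e: "?t (k + 1) = ?t k + 2 * pi" by (simp add: algebra_simps)
  have "sc (?t k + 2 * pi) (u1 m) \<in> outside S" using lift_in_or_out[OF m tk, of "k + 1"] k(2) unfolding e by blast
  then show ?thesis unfolding lift_arg_def using k(1) tk by blast
qed

text \<open>If \<open>s\<close> exceeded \<open>t\<close> by \<open>k > 0\<close> periods, scaling
  the lift at \<open>s\<close> down by \<open>k - 1\<close> periods would keep it inside
  \<open>S\<close>; but it would arrive at \<open>t + 2 * pi\<close>, which gives a point
  outside.\<close>

lemma lift_arg_unique:
  assumes m: "m \<in> T - J" and a: "lift_arg m s" "lift_arg m t" shows "s = t"
proof -
  have no: False if a: "lift_arg m s" "lift_arg m t" and k: "s = t + 2 * pi * of_int k" "k > 0" for s t k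
  proof -
    have "sc (2 * pi * of_int (1 - k)) (sc s (u1 m)) \<in> inside S"
    proof (cases "k = 1")
      case True then show ?thesis using a(1) by (simp add: lift_arg_def)
    next
      case False then show ?thesis using sc_inside[of "1 - k"] k a(1) by (simp add: lift_arg_def)
    qed
    moreover have "sc (2 * pi * of_int (1 - k)) (sc s (u1 m)) = sc (t + 2 * pi) (u1 m)"
      unfolding sc_sc k(1) by (simp add: algebra_simps)
    ultimately have "sc (t + 2 * pi) (u1 m) \<in> inside S" by (simp only:)
    then show False using a(2) inside_Int_outside[of S] unfolding lift_arg_def by blast
  qed
  have "cis s = cis t" using a by (simp add: lift_arg_def)
  then obtain k :: int where k: "s = t + 2 * pi * of_int k" by (rule cis_eq_obtain_int)
  then have k': "t = s + 2 * pi * of_int (- k)" by simp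
  show ?thesis
  proof (cases "k = 0")
    case False
    then have "k > 0 \<or> - k > 0" by linarith
    then show ?thesis using no[OF a k] no[OF a(2,1) k'] by blast
  qed (use k in simp)
qed

definition \<tau> :: "'s \<Rightarrow> real" where "\<tau> m = (SOME t. lift_arg m t)"

text \<open>The torus cut open along \<open>J\<close> becomes a piece of the annulus between
  \<open>S\<close> and its next inward translate.\<close>

definition f :: "'s \<Rightarrow> complex" where "f m = sc (\<tau> m) (u1 m)"

lemma \<tau>: assumes "m \<in> T - J" shows "lift_arg m (\<tau> m)"
  unfolding \<tau>_def using lift_arg_exists[OF assms] by (rule someI_ex)

text \<open>Near \<open>m\<close> the candidate \<open>\<tau> m + Arg (u2 x / u2 m)\<close> is an
  argument of \<open>u2 x\<close>, continuous at \<open>m\<close> because the quotient tends to 1.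
  Inside and outside of \<open>S\<close> are open, so the candidate satisfies
  \<open>lift_arg\<close>, and uniqueness identifies it with \<open>\<tau> x\<close>.\<close>

lemma continuous_\<tau>: "continuous_on (T - J) \<tau>"
  unfolding continuous_on_def
proof
  fix m assume m: "m \<in> T - J"
  let ?F = "at m within (T - J)"
  have u1: "(u1 \<longlongrightarrow> u1 m) ?F" and u2: "(u2 \<longlongrightarrow> u2 m) ?F"
    using u m unfolding continuous_on_def by (auto intro: tendsto_within_subset)
  have n: "norm (u2 m) = 1" using norm_u(2) m by simp
  then have nz: "u2 m \<noteq> 0" by auto
  let ?\<tau> = "\<lambda>x. \<tau> m + Arg (u2 x / u2 m)"
  have "((\<lambda>x. u2 x / u2 m) \<longlongrightarrow> 1) ?F" using tendsto_divide[OF u2 tendsto_const nz] nz by simp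
  moreover have "isCont Arg 1" using continuous_at_Arg[of 1] by simp
  ultimately have "((\<lambda>x. Arg (u2 x / u2 m)) \<longlongrightarrow> Arg 1) ?F" by (rule isCont_tendsto_compose[rotated])
  then have t: "(?\<tau> \<longlongrightarrow> \<tau> m) ?F" using tendsto_add[OF tendsto_const[of "\<tau> m"]] by fastforce
  have lim: "((\<lambda>x. sc (?\<tau> x + a) (u1 x)) \<longlongrightarrow> sc (\<tau> m + a) (u1 m)) ?F" for a
    by (intro tendsto_intros t u1)
  have l: "lift_arg m (\<tau> m)" by (rule \<tau>[OF m])
  have "\<forall>\<^sub>F x in ?F. sc (?\<tau> x + 0) (u1 x) \<in> inside S"
    by (rule topological_tendstoD[OF lim Jordan_S(2)]) (use l in \<open>simp add: lift_arg_def\<close>)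
  moreover have "\<forall>\<^sub>F x in ?F. sc (?\<tau> x + 2 * pi) (u1 x) \<in> outside S"
    by (rule topological_tendstoD[OF lim Jordan_S(4)]) (use l in \<open>simp add: lift_arg_def\<close>)
  moreover have "\<forall>\<^sub>F x in ?F. x \<in> T - J" by (auto simp: eventually_at_topological intro: exI[of _ UNIV])
  ultimately have "\<forall>\<^sub>F x in ?F. ?\<tau> x = \<tau> x"
  proof eventually_elim
    case (elim x)
    have nx: "norm (u2 x / u2 m) = 1" using norm_u(2) elim(3) n by (simp add: norm_divide)
    then have "cis (Arg (u2 x / u2 m)) = u2 x / u2 m" by (rule cis_Arg_unit)
    then have "cis (?\<tau> x) = u2 x" using l nz by (simp add: cis_mult[symmetric] lift_arg_def)
    then have "lift_arg x (?\<tau> x)" using elim by (simp add: lift_arg_def)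
    then show ?case using lift_arg_unique[OF elim(3) _ \<tau>[OF elim(3)]] by blast
  qed
  then show "(\<tau> \<longlongrightarrow> \<tau> m) ?F" using t by (rule Lim_transform_eventually[rotated])
qed

lemma continuous_f: "continuous_on (T - J) f"
  unfolding f_def by (intro continuous_intros continuous_\<tau> continuous_on_subset[OF u(1)]) auto

lemma inj_f: "inj_on f (T - J)"
proof (rule inj_onI)
  fix x y assume xy: "x \<in> T - J" "y \<in> T - J" "f x = f y"
  then have e: "\<tau> x = \<tau> y" "u1 x = u1 y" using polar_eq[of x y] by (auto simp: f_def)
  then have "u2 x = u2 y" using \<tau>[OF xy(1)] \<tau>[OF xy(2)] by (simp add: lift_arg_def)
  then show "x = y" using u_inj[of x y] xy e by auto
qed

text \<open>Cutting along \<open>J\<close> doubles each of its points: \<open>end0 x\<close> is the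
  copy of \<open>x\<close> on \<open>S\<close>, and \<open>end1 x\<close> the copy on the next
  inward translate.\<close>

definition end0 :: "'s \<Rightarrow> complex" where "end0 x = sc (\<theta> x) (u1 x)"
definition end1 :: "'s \<Rightarrow> complex" where "end1 x = sc (2 * pi * of_int (- 1) + \<theta> x) (u1 x)"

lemma ends_distinct: "x \<in> J \<Longrightarrow> end0 x \<noteq> end1 x"
  using polar_eq(1)[of x x "\<theta> x" "2 * pi * of_int (- 1) + \<theta> x"] J(2) by (auto simp: end0_def end1_def)

lemma ends_notin:
  assumes "x \<in> J" shows "end0 x \<notin> f ` (T - J)" "end1 x \<notin> f ` (T - J)"
proof -
  have *: "f m \<noteq> sc (2 * pi * of_int k + \<theta> x) (u1 x)" if m: "m \<in> T - J" for m k
    using lift_notin_S[OF m, of "\<tau> m" k x] \<tau>[OF m] assms by (simp add: f_def lift_arg_def)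
  show "end1 x \<notin> f ` (T - J)"
  proof
    assume "end1 x \<in> f ` (T - J)"
    then obtain m where "m \<in> T - J" "f m = end1 x" by (metis imageE)
    then show False using *[of m "- 1"] unfolding end1_def by simp
  qed
  show "end0 x \<notin> f ` (T - J)"
  proof
    assume "end0 x \<in> f ` (T - J)"
    then obtain m where "m \<in> T - J" "f m = end0 x" by (metis imageE)
    then show False using *[of m 0] unfolding end0_def by simp
  qed
qed

text \<open>Along the arc \<open>u2\<close> has an argument, from which \<open>\<tau>\<close>
  differs by a constant, so \<open>f\<close> extends continuously to \<open>x\<close> with a lift of
  \<open>x\<close> as value. Quantifying over \<open>B\<close> lets one copy of \<open>x\<close>
  serve every part of the arc that accumulates at \<open>x\<close>, such as the edge without its
  other end.\<close>

lemma edge_limit: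
  assumes A: "arc_between A a x" "x \<in> J" "A - {x} \<subseteq> T - J"
  shows "\<exists>\<sigma>\<in>{end0 x, end1 x}. \<forall>B\<subseteq>A - {x}. x \<in> closure B \<longrightarrow> \<sigma> \<in> closure (f ` B)"
proof -
  have AT: "A \<subseteq> T" using A J(2) by auto
  have "has_arg A u2" using norm_u(2) AT by (intro arc_has_arg[OF A(1)] continuous_on_subset[OF u(2)]) auto
  then obtain \<beta> where b: "continuous_on A \<beta>" "\<And>y. y \<in> A \<Longrightarrow> u2 y = cis (\<beta> y)" unfolding has_arg_def by auto
  note half = arc_between_half[OF A(1)]
  obtain n :: int where n: "\<And>y. y \<in> A - {x} \<Longrightarrow> \<tau> y = \<beta> y + 2 * pi * n"
  proof (rule args_differ_by_constant[OF half(1)])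
    show "continuous_on (A - {x}) \<tau>" by (rule continuous_on_subset[OF continuous_\<tau> A(3)])
    show "continuous_on (A - {x}) \<beta>" by (rule continuous_on_subset[OF b(1)]) auto
    show "cis (\<tau> y) = cis (\<beta> y)" if "y \<in> A - {x}" for y
      using \<tau>[of y] b(2)[of y] A(3) that by (auto simp: lift_arg_def)
  qed auto
  have xA: "x \<in> A" using arc_betweenD(2)[OF A(1)] .
  have "cis (\<beta> x) = cis (\<theta> x)" using b(2)[OF xA] arg(2)[OF A(2)] by simp
  then obtain k0 :: int where k0: "\<beta> x = \<theta> x + 2 * pi * k0" by (rule cis_eq_obtain_int)
  define k where "k = k0 + n"
  \<comment> \<open>\<open>h\<close> continues \<open>f\<close> over the end point, where its value
    is the translate of \<open>end0 x\<close> by \<open>k\<close> periods.\<close>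
  define h where "h y = sc (\<beta> y + 2 * pi * of_int n) (u1 y)" for y
  have ch: "continuous_on A h" unfolding h_def
    by (intro continuous_intros b continuous_on_subset[OF u(1) AT])
  have hf: "h y = f y" if "y \<in> A - {x}" for y unfolding h_def f_def n[OF that] ..
  have hx: "h x = sc (2 * pi * of_int k + \<theta> x) (u1 x)" unfolding h_def k0 k_def by (simp add: algebra_simps)
  have cl: "h x \<in> closure (h ` B)" if "B \<subseteq> A - {x}" "x \<in> closure B" for B
  proof -
    have "h ` (A \<inter> closure B) \<subseteq> closure (h ` B)"
    proof -
      have "continuous_on (A \<inter> closure B) h" by (rule continuous_on_subset[OF ch]) auto
      moreover have "A \<inter> closure B = closure B"
        using closure_minimal[of B A] that(1) compact_imp_closed[OF arc_betweenD(5)[OF A(1)]] by auto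
      ultimately have "h ` closure B \<subseteq> closure (h ` B)"
        by (intro image_closure_subset) (auto simp: closure_subset)
      then show ?thesis by auto
    qed
    then show ?thesis using that xA by blast
  qed
  have fin: "f ` (A - {x}) \<subseteq> inside S" and fout: "sc (2 * pi) ` f ` (A - {x}) \<subseteq> outside S"
    using \<tau> A(3) by (auto simp: lift_arg_def f_def sc_sc add.commute)
  have eq: "h ` (A - {x}) = f ` (A - {x})" using hf by (auto simp: image_iff)
  have "h x \<in> closure (f ` (A - {x}))" using cl[of "A - {x}"] half(3) eq by auto
  then have h1: "h x \<in> S \<union> inside S" using closure_mono[OF fin] Jordan_S(9) by auto
  have "sc (2 * pi) ` closure (f ` (A - {x})) \<subseteq> closure (sc (2 * pi) ` f ` (A - {x}))"
    by (intro image_closure_subset continuous_intros) (auto simp: closure_subset)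
  then have "sc (2 * pi) (h x) \<in> closure (outside S)"
    using \<open>h x \<in> closure (f ` (A - {x}))\<close> closure_mono[OF fout] by blast
  then have h2: "sc (2 * pi) (h x) \<in> S \<union> outside S" using Jordan_S(10) by simp
  have hk: "sc (2 * pi * of_int j) (h x) = sc (2 * pi * of_int (k + j)) (sc (\<theta> x) (u1 x))" for j :: int
    unfolding hx sc_sc by (simp add: algebra_simps)
  have io: "inside S \<inter> outside S = {}" "inside S \<inter> S = {}" "outside S \<inter> S = {}"
    using inside_Int_outside by auto
  \<comment> \<open>\<open>h x\<close> is a limit of points inside \<open>S\<close> whose next
    outward translates lie outside \<open>S\<close>. A lift with \<open>k > 0\<close> violates the
    first condition, one with \<open>k < - 1\<close> the second.\<close>
  have "\<not> k > 0"
  proof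
    assume "k > 0"
    then have "h x \<in> outside S" using sc_S_outside[of k] SI[OF A(2)] hk[of 0] by auto
    then show False using h1 io by blast
  qed
  moreover have "\<not> k < - 1"
  proof
    assume "k < - 1"
    then have "sc (2 * pi) (h x) \<in> inside S" using sc_S_inside[of "k + 1"] SI[OF A(2)] hk[of 1] by auto
    then show False using h2 io by blast
  qed
  ultimately have "k = 0 \<or> k = - 1" by linarith
  then have "h x \<in> {end0 x, end1 x}" unfolding hx end0_def end1_def by auto
  moreover have "h x \<in> closure (f ` B)" if B: "B \<subseteq> A - {x}" "x \<in> closure B" for B
  proof -
    have "h ` B = f ` B" using hf B(1) by (intro image_cong) auto
    then show ?thesis using cl[OF B] by simp
  qed
  ultimately show ?thesis by blast
qed

end

section \<open>Curves on the torus\<close>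

type_synonym torus_point = "complex \<times> complex"

text \<open>Equivalently, the inclusion of \<open>K\<close> into the torus lifts to the universal
  cover, the plane.\<close>

definition null_on :: "torus_point set \<Rightarrow> bool" where
  "null_on K \<longleftrightarrow> has_arg K fst \<and> has_arg K snd"

lemma torusD:
  assumes "x \<in> torus" shows "norm (fst x) = 1" "norm (snd x) = 1" "fst x \<noteq> 0" "snd x \<noteq> 0"
proof -
  show "norm (fst x) = 1" "norm (snd x) = 1" using assms by (auto simp: torus_def)
  then show "fst x \<noteq> 0" "snd x \<noteq> 0" by auto
qed

text \<open>A unimodular change of the circle coordinates makes the second one have an argument
  along \<open>J\<close>. The change is invertible, so if the first one had an argument too,
  \<open>J\<close> would be null; hence the setting of \<open>essential_curve\<close> is
  reached.\<close>

lemma essential_complement: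
  assumes J: "simple_closed_curve J" "J \<subseteq> torus" "\<not> null_on J"
  obtains f e0 e1 :: "torus_point \<Rightarrow> complex" where
    "continuous_on (torus - J) f" "inj_on f (torus - J)"
    "\<And>x. x \<in> J \<Longrightarrow> e0 x \<noteq> e1 x \<and> e0 x \<notin> f ` (torus - J) \<and> e1 x \<notin> f ` (torus - J)"
    "\<And>A a x. arc_between A a x \<Longrightarrow> x \<in> J \<Longrightarrow> A - {x} \<subseteq> torus - J \<Longrightarrow>
      \<exists>\<sigma>\<in>{e0 x, e1 x}. \<forall>B\<subseteq>A - {x}. x \<in> closure B \<longrightarrow> \<sigma> \<in> closure (f ` B)"
proof -
  have n: "norm (fst x) = 1" "norm (snd x) = 1" "fst x \<noteq> 0" "snd x \<noteq> 0" if "x \<in> torus" for x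
    using torusD[OF that] by auto
  have nJ: "norm (fst x) = 1" "norm (snd x) = 1" "fst x \<noteq> 0" "snd x \<noteq> 0" if "x \<in> J" for x
    using n[OF subsetD[OF J(2) that]] by auto
  have cJ: "continuous_on J fst" "continuous_on J snd" by (intro continuous_intros)+
  obtain a b c e :: int where ab: "a * e - b * c = 1" and ha: "has_arg J (\<lambda>x. fst x powi c * snd x powi e)"
    by (rule scc_unimodular_arg[OF J(1) cJ(1) nJ(1) cJ(2) nJ(2)])
  define u1 u2 where "u1 x = fst x powi a * snd x powi b" and "u2 x = fst x powi c * snd x powi e"
    for x :: torus_point
  obtain \<theta> where th: "continuous_on J \<theta>" "\<And>x. x \<in> J \<Longrightarrow> u2 x = cis (\<theta> x)"
    using ha unfolding has_arg_def u2_def by auto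
  have inv: "fst x = u1 x powi e * u2 x powi (- b)" "snd x = u1 x powi (- c) * u2 x powi a" if "x \<in> torus" for x
    using powi_unimodular[OF n(3,4)[OF that] ab] by (simp_all only: u1_def u2_def)
  have no: "\<not> has_arg J u1"
  proof
    assume h1: "has_arg J u1"
    have h2: "has_arg J u2" using ha by (simp add: u2_def[abs_def])
    have "has_arg J fst" using has_arg_mult_powi[OF h1 h2, of e "- b"] inv(1) J(2)
      by (subst has_arg_cong[of J fst]) auto
    moreover have "has_arg J snd" using has_arg_mult_powi[OF h1 h2, of "- c" a] inv(2) J(2)
      by (subst has_arg_cong[of J snd]) auto
    ultimately show False using J(3) by (simp add: null_on_def)
  qed
  interpret E: essential_curve torus J u1 u2 \<theta>
  proof
    show "continuous_on torus u1" "continuous_on torus u2" unfolding u1_def u2_def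
      using n(3,4) by (auto intro!: continuous_intros)
    show "norm (u1 x) = 1" "norm (u2 x) = 1" if "x \<in> torus" for x
      using n[OF that] by (simp_all add: u1_def u2_def norm_mult norm_power_int)
    show "x = y" if "x \<in> torus" "y \<in> torus" "u1 x = u1 y" "u2 x = u2 y" for x y
      using inv[OF that(1)] inv[OF that(2)] that(3,4) by (simp add: prod_eq_iff)
  qed (use J th no in auto)
  show ?thesis
    using E.continuous_f E.inj_f E.ends_distinct E.ends_notin E.edge_limit
    by (intro that[of E.f E.end0 E.end1]) blast+
qed

section \<open>Discs bounded by null-homotopic curves\<close>

definition plane_to_torus :: "complex \<Rightarrow> torus_point" where
  "plane_to_torus w = (cis (Re w), cis (Im w))"

text \<open>The two properties of a disc \<open>U\<close> bounded by \<open>J\<close> that the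
  arguments need: connected sets cannot leave \<open>U\<close> without crossing \<open>J\<close>,
  and \<open>U\<close> with its boundary embeds in the plane.\<close>

definition encloses :: "torus_point set \<Rightarrow> torus_point set \<Rightarrow> bool" where
  "encloses J U \<longleftrightarrow> (\<forall>Z. connected Z \<longrightarrow> Z \<subseteq> torus \<longrightarrow> Z \<inter> J = {} \<longrightarrow> Z \<inter> U \<noteq> {} \<longrightarrow> Z \<subseteq> U) \<and>
     (\<exists>g :: torus_point \<Rightarrow> complex. continuous_on (U \<union> J) g \<and> inj_on g (U \<union> J))"

lemma plane_to_torus_eq:
  assumes "plane_to_torus v = plane_to_torus w"
  obtains k l :: int where "v = w + Complex (2 * pi * k) (2 * pi * l)"
proof -
  have e: "cis (Re v) = cis (Re w)" "cis (Im v) = cis (Im w)" using assms by (auto simp: plane_to_torus_def)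
  obtain k :: int where k: "Re v = Re w + 2 * pi * k" using cis_eq_obtain_int[OF e(1)] by blast
  obtain l :: int where l: "Im v = Im w + 2 * pi * l" using cis_eq_obtain_int[OF e(2)] by blast
  have "v = w + Complex (2 * pi * k) (2 * pi * l)" using k l by (simp add: complex_eq_iff)
  then show ?thesis by (rule that)
qed

lemma plane_to_torus_add: "plane_to_torus (w + Complex (2 * pi * of_int k) (2 * pi * of_int l)) = plane_to_torus w"
  by (simp add: plane_to_torus_def cis_add_int)

lemma continuous_plane_to_torus: "continuous_on X plane_to_torus"
  unfolding plane_to_torus_def cis_conv_exp by (intro continuous_intros)

text \<open>The lift of \<open>J\<close> bounds a plane region that is disjoint, boundary included,
  from its translates by nonzero periods. Hence the covering map is injective on it, and compactness
  makes its inverse continuous.\<close>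

lemma null_disc:
  assumes J: "simple_closed_curve J" and psi: "continuous_on J \<psi>" "\<And>x. x \<in> J \<Longrightarrow> plane_to_torus (\<psi> x) = x"
  shows "encloses J (plane_to_torus ` inside (\<psi> ` J))"
proof -
  define S where "S = \<psi> ` J"
  define tr :: "int \<Rightarrow> int \<Rightarrow> complex" where "tr k l = Complex (2 * pi * k) (2 * pi * l)" for k l
  have inj: "inj_on \<psi> J" by (rule inj_on_inverseI[of _ plane_to_torus]) (rule psi(2))
  have scc: "simple_closed_curve S" unfolding S_def by (rule simple_closed_curve_image[OF J psi(1) inj])
  note JS = Jordan_curve_inside_outside[OF scc] and CS = simple_closed_curveD[OF scc]
  have trP: "plane_to_torus (w + tr k l) = plane_to_torus w" for w k l
    unfolding tr_def by (rule plane_to_torus_add)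
  have tr_disj: "s + tr k l \<notin> S" if "s \<in> S" "tr k l \<noteq> 0" for s k l
  proof
    assume a: "s + tr k l \<in> S"
    have id: "\<psi> (plane_to_torus z) = z" if "z \<in> S" for z using that psi(2) by (auto simp: S_def)
    have "s + tr k l = s" using id[OF a] id[OF that(1)] by (simp add: trP)
    then show False using that(2) by simp
  qed
  \<comment> \<open>The point of \<open>S\<close> farthest in the direction of the translation
    leaves a half-plane containing \<open>S\<close>, so its translate is outside; being connected
    and disjoint from \<open>S\<close>, the whole translate is.\<close>
  have tr_out: "s + tr k l \<in> outside S" if s: "s \<in> S" and nz: "tr k l \<noteq> 0" for s k l
  proof -
    let ?t = "tr k l"
    have "continuous_on S (\<lambda>z. z \<bullet> ?t)" by (intro continuous_intros)
    then obtain m where m: "m \<in> S" "\<And>z. z \<in> S \<Longrightarrow> z \<bullet> ?t \<le> m \<bullet> ?t"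
      using continuous_attains_sup[OF CS(1,3)] by blast
    have "convex {z. z \<bullet> ?t \<le> m \<bullet> ?t}" using convex_halfspace_le[of ?t "m \<bullet> ?t"] by (simp add: inner_commute)
    then have "- {z. z \<bullet> ?t \<le> m \<bullet> ?t} \<subseteq> outside S" using m(2) by (intro outside_subset_convex) auto
    moreover have "(m + ?t) \<bullet> ?t > m \<bullet> ?t" using nz by (simp add: inner_add_left)
    ultimately have mo: "m + ?t \<in> outside S" by auto
    show ?thesis
    proof (rule ccontr)
      assume "s + ?t \<notin> outside S"
      then have "s + ?t \<in> inside S" using tr_disj[OF s nz] outside_inside[of S] by blast
      moreover have "connected ((\<lambda>z. z + ?t) ` S)" by (intro connected_continuous_image continuous_intros CS)
      ultimately have "(\<lambda>z. z + ?t) ` S \<subseteq> inside S"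
        using s tr_disj nz by (intro connected_inside_or_outside[of _ _ "s + ?t"]) auto
      then show False using m(1) mo inside_Int_outside[of S] by blast
    qed
  qed
  have neg: "tr (- k) (- l) = - tr k l" for k l by (simp add: tr_def complex_eq_iff)
  \<comment> \<open>Otherwise the translation would map the inside of \<open>S\<close> into itself,
    and iterating it contradicts boundedness.\<close>
  have no: False if z: "z \<in> inside S \<union> S" "z + tr k l \<in> inside S \<union> S" and nz: "tr k l \<noteq> 0" for z k l
  proof -
    let ?t = "tr k l"
    have nz': "tr (- k) (- l) \<noteq> 0" using nz by (simp add: neg)
    have io: "inside S \<inter> outside S = {}" "S \<inter> outside S = {}"
      using inside_Int_outside[of S] outside_no_overlap[of S] by blast+
    have 1: "z \<notin> S" using tr_out[of z k l] nz z(2) io by blast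
    have shift_out: "w \<in> outside S" if "w + ?t \<in> S" for w using tr_out[OF that nz'] by (simp add: neg)
    have 2: "z + ?t \<notin> S" using shift_out[of z] z(1) io by blast
    have zi: "z \<in> inside S" "z + ?t \<in> inside S" using 1 2 z by auto
    have "w + ?t \<notin> S" if "w \<in> inside S" for w
      using shift_out[of w] that io by blast
    then have "(\<lambda>w. w + ?t) ` inside S \<inter> S = {}" by auto
    moreover have "connected ((\<lambda>z. z + ?t) ` inside S)" by (intro connected_continuous_image continuous_intros JS)
    ultimately have sub: "(\<lambda>w. w + ?t) ` inside S \<subseteq> inside S"
      using zi by (intro connected_inside_or_outside[of _ _ "z + ?t"]) auto
    have it: "z + of_nat i * ?t \<in> inside S" for i
    proof (induct i)
      case (Suc i)
      then have "z + of_nat i * ?t + ?t \<in> inside S" using sub by blast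
      then show ?case by (simp add: algebra_simps)
    qed (use zi in simp)
    obtain B where B: "\<And>w. w \<in> inside S \<Longrightarrow> norm w \<le> B" using JS(6) unfolding bounded_iff by auto
    obtain i :: nat where i: "of_nat i * norm ?t > B + norm z" using nz ex_less_of_nat_mult[of "norm ?t" "B + norm z"] by auto
    have "of_nat i * norm ?t = norm (of_nat i * ?t)" by (simp add: norm_mult)
    also have "\<dots> \<le> norm (z + of_nat i * ?t) + norm z" using norm_triangle_ineq4[of "z + of_nat i * ?t" z] by simp
    also have "\<dots> \<le> B + norm z" using B[OF it] by simp
    finally show False using i by simp
  qed
  have injP: "inj_on plane_to_torus (inside S \<union> S)"
  proof (rule inj_onI)
    fix v w assume a: "v \<in> inside S \<union> S" "w \<in> inside S \<union> S" "plane_to_torus v = plane_to_torus w"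
    obtain k l :: int where vw: "v = w + tr k l" unfolding tr_def by (rule plane_to_torus_eq[OF a(3)])
    then show "v = w" using no[of w k l] a by (cases "tr k l = 0") auto
  qed
  define U where "U = plane_to_torus ` inside S"
  have PS: "plane_to_torus ` S = J" unfolding S_def using psi(2) by force
  have UJ: "U \<union> J = plane_to_torus ` (inside S \<union> S)" unfolding U_def PS[symmetric] by auto
  have "closed (inside S \<union> S)" using JS(9) by (metis Un_commute closed_closure)
  moreover have "bounded (inside S \<union> S)" using JS(6) CS(1) compact_imp_bounded by auto
  ultimately have comp: "compact (inside S \<union> S)" by (simp add: compact_eq_bounded_closed)
  have g: "\<exists>g :: torus_point \<Rightarrow> complex. continuous_on (U \<union> J) g \<and> inj_on g (U \<union> J)"
  proof (intro exI conjI)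
    let ?g = "inv_into (inside S \<union> S) plane_to_torus"
    show "continuous_on (U \<union> J) ?g" unfolding UJ
      by (rule continuous_on_inv[OF continuous_plane_to_torus comp]) (use injP in simp)
    show "inj_on ?g (U \<union> J)" unfolding UJ by (rule inj_on_inv_into) simp
  qed
  have clUJ: "closed (U \<union> J)" unfolding UJ
    by (intro compact_imp_closed compact_continuous_image continuous_plane_to_torus comp)
  have nbhd: "\<exists>e>0. \<forall>z\<in>torus. dist z z0 < e \<longrightarrow> z \<in> U" if z0: "z0 \<in> U" for z0
  proof -
    obtain w0 where w0: "w0 \<in> inside S" "z0 = plane_to_torus w0" using z0 by (auto simp: U_def)
    have n0: "norm (fst z0) = 1" "norm (snd z0) = 1" "fst z0 \<noteq> 0" "snd z0 \<noteq> 0" by (auto simp: w0 plane_to_torus_def)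
    \<comment> \<open>A local section of the covering through \<open>w0\<close>, built from
      principal arguments of quotients that tend to 1 at \<open>z0\<close>. It shows that
      \<open>U\<close> is open relative to the torus.\<close>
    define \<sigma> where "\<sigma> z = w0 + Complex (Arg (fst z / fst z0)) (Arg (snd z / snd z0))" for z
    have P: "plane_to_torus (\<sigma> z) = z" if "z \<in> torus" for z
    proof -
      have "norm (fst z / fst z0) = 1" "norm (snd z / snd z0) = 1" using torusD[OF that] n0 by (simp_all add: norm_divide)
      then have "cis (Arg (fst z / fst z0)) = fst z / fst z0" "cis (Arg (snd z / snd z0)) = snd z / snd z0"
        by (simp_all only: cis_Arg_unit)
      then show ?thesis using n0 by (simp add: plane_to_torus_def \<sigma>_def cis_mult[symmetric] w0(2) prod_eq_iff)
    qed
    let ?F = "at z0"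
    have A1: "isCont Arg 1" using continuous_at_Arg[of 1] by simp
    have l: "((\<lambda>z. fst z / fst z0) \<longlongrightarrow> 1) ?F" "((\<lambda>z. snd z / snd z0) \<longlongrightarrow> 1) ?F"
    proof -
      have "((\<lambda>z. fst z / fst z0) \<longlongrightarrow> fst z0 / fst z0) ?F" "((\<lambda>z. snd z / snd z0) \<longlongrightarrow> snd z0 / snd z0) ?F"
        using n0 by (intro tendsto_intros; simp)+
      then show "((\<lambda>z. fst z / fst z0) \<longlongrightarrow> 1) ?F" "((\<lambda>z. snd z / snd z0) \<longlongrightarrow> 1) ?F" using n0 by simp_all
    qed
    have "(\<sigma> \<longlongrightarrow> w0 + Complex (Arg 1) (Arg 1)) ?F" unfolding \<sigma>_def
      by (intro tendsto_intros tendsto_Complex isCont_tendsto_compose[OF A1] l)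
    moreover have "w0 + Complex (Arg 1) (Arg 1) = w0" by (simp add: complex_eq_iff)
    ultimately have "(\<sigma> \<longlongrightarrow> w0) ?F" by (simp only:)
    then have "\<forall>\<^sub>F z in ?F. \<sigma> z \<in> inside S" using JS(2) w0(1) by (rule topological_tendstoD)
    then obtain e where e: "e > 0" "\<And>z. z \<noteq> z0 \<Longrightarrow> dist z z0 < e \<Longrightarrow> \<sigma> z \<in> inside S"
      by (auto simp: eventually_at)
    have "z \<in> U" if z: "z \<in> torus" "dist z z0 < e" for z
    proof (cases "z = z0")
      case False
      then have "plane_to_torus (\<sigma> z) \<in> U" using e(2) z unfolding U_def by blast
      then show ?thesis using P[OF z(1)] by simp
    qed (use z0 in simp)
    then show ?thesis using e(1) by blast
  qed
  have "Z \<subseteq> U" if Z: "connected Z" "Z \<subseteq> torus" "Z \<inter> J = {}" "Z \<inter> U \<noteq> {}" for Z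
  proof -
    have "openin (top_of_set Z) (Z \<inter> U)"
      unfolding openin_euclidean_subtopology_iff using nbhd Z(2) by (metis IntD2 IntI inf_le1 subsetD)
    moreover have "closedin (top_of_set Z) (Z \<inter> U)"
    proof -
      have "Z \<inter> U = Z \<inter> (U \<union> J)" using Z(3) by auto
      then show ?thesis using clUJ by (metis closedin_closed_Int)
    qed
    ultimately have "Z \<inter> U = Z" using Z(1,4) unfolding connected_clopen by blast
    then show ?thesis by auto
  qed
  then show ?thesis unfolding encloses_def using g by (simp add: U_def S_def)
qed

section \<open>Drawings on the torus\<close>

locale torus_drawing =
  fixes \<phi> :: "'a \<Rightarrow> torus_point" and d :: "'a set \<Rightarrow> torus_point set" and V :: "'a set" and R :: "'a rel"
  assumes inj: "inj_on \<phi> V"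
    and ends: "\<And>u v. (u, v) \<in> R \<Longrightarrow> u \<in> V \<and> v \<in> V \<and> u \<noteq> v"
    and arcs: "\<And>u v. (u, v) \<in> R \<Longrightarrow> arc_between (d {u, v}) (\<phi> u) (\<phi> v) \<and> d {u, v} \<subseteq> torus"
    and verts: "\<And>u v. (u, v) \<in> R \<Longrightarrow> d {u, v} \<inter> \<phi> ` V = \<phi> ` {u, v}"
    and crossing: "\<And>u v u' v'. (u, v) \<in> R \<Longrightarrow> (u', v') \<in> R \<Longrightarrow> {u, v} \<noteq> {u', v'} \<Longrightarrow>
      d {u, v} \<inter> d {u', v'} = \<phi> ` ({u, v} \<inter> {u', v'})"
begin

definition is_clique :: "'a set \<Rightarrow> bool" where
  "is_clique X \<longleftrightarrow> X \<subseteq> V \<and> (\<forall>u\<in>X. \<forall>v\<in>X. u \<noteq> v \<longrightarrow> (u, v) \<in> R)"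

lemma is_clique_subset: "is_clique X \<Longrightarrow> Y \<subseteq> X \<Longrightarrow> is_clique Y"
  by (auto simp: is_clique_def)

lemma is_clique_drawing: assumes "is_clique X" shows "clique_drawing \<phi> d X"
  unfolding clique_drawing_def
proof (intro conjI allI impI ballI)
  have XV: "X \<subseteq> V" using assms by (simp add: is_clique_def)
  show "inj_on \<phi> X" using inj XV by (rule inj_on_subset)
  fix u v assume uv: "u \<in> X" "v \<in> X" "u \<noteq> v"
  then have r: "(u, v) \<in> R" using assms by (simp add: is_clique_def)
  then show "arc_between (d {u, v}) (\<phi> u) (\<phi> v)" using arcs by blast
  have "d {u, v} \<inter> \<phi> ` V = \<phi> ` {u, v}" using verts r by blast
  then show "d {u, v} \<inter> \<phi> ` X = \<phi> ` {u, v}" using XV uv by blast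
next
  fix e f assume a: "e \<subseteq> X" "f \<subseteq> X" "card e = 2" "card f = 2" "e \<noteq> f"
  obtain u v where e: "e = {u, v}" "u \<noteq> v" using a(3) by (meson card_2_iff)
  obtain u' v' where f: "f = {u', v'}" "u' \<noteq> v'" using a(4) by (meson card_2_iff)
  have "(u, v) \<in> R" "(u', v') \<in> R" using a e f assms by (auto simp: is_clique_def)
  then show "d e \<inter> d f = \<phi> ` (e \<inter> f)" using crossing a(5) e f by blast
qed

lemma drawn_torus: "is_clique X \<Longrightarrow> drawn d X \<subseteq> torus"
  using arcs unfolding drawn_def is_clique_def by blast

lemma edge_drawn_Int:
  assumes "(u, v) \<in> R" "is_clique X" "\<not> {u, v} \<subseteq> X"
  shows "d {u, v} \<inter> drawn d X \<subseteq> \<phi> ` ({u, v} \<inter> X)"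
proof
  fix z assume "z \<in> d {u, v} \<inter> drawn d X"
  then obtain s t where st: "s \<in> X" "t \<in> X" "s \<noteq> t" "z \<in> d {s, t}" "z \<in> d {u, v}" by (auto simp: drawn_def)
  have "(s, t) \<in> R" using st assms(2) by (simp add: is_clique_def)
  moreover have "{u, v} \<noteq> {s, t}" using assms(3) st by auto
  ultimately have "z \<in> \<phi> ` ({u, v} \<inter> {s, t})" using crossing[OF assms(1)] st by blast
  then show "z \<in> \<phi> ` ({u, v} \<inter> X)" using st by auto
qed

lemma drawn_Int:
  assumes "is_clique X" "is_clique Y" "X \<inter> Y = {}" shows "drawn d X \<inter> drawn d Y = {}"
proof -
  have "d {u, v} \<inter> drawn d Y = {}" if "u \<in> X" "v \<in> X" "u \<noteq> v" for u v
    using edge_drawn_Int[of u v Y] that assms by (auto simp: is_clique_def)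
  then show ?thesis unfolding drawn_def[of d X] by blast
qed

lemma vertex_drawn: assumes "is_clique X" "u \<in> X" "2 \<le> card X" shows "\<phi> u \<in> drawn d X"
proof -
  have "X \<noteq> {u}" using assms(3) by auto
  then obtain v where "v \<in> X" "u \<noteq> v" using assms(2) by blast
  then show ?thesis using half_edge(2)[OF is_clique_drawing[OF assms(1)] assms(2)] edge_subset_drawn[of u X v d] assms(2) by blast
qed

lemma connected_drawn: assumes "is_clique X" "2 \<le> card X" shows "connected (drawn d X)"
proof -
  note D = clique_drawingD(1)[OF is_clique_drawing[OF assms(1)]]
  obtain r where r: "r \<in> X" using assms(2) by fastforce
  have A: "\<phi> u \<in> d {u, v}" "\<phi> v \<in> d {u, v}" "connected (d {u, v})" if "u \<in> X" "v \<in> X" "u \<noteq> v" for u v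
    using arc_betweenD[OF D[OF that]] by auto
  define S where "S = (\<Union>v\<in>X - {r}. d {r, v})"
  have S: "connected S" unfolding S_def
    by (rule connected_Union) (use A r in blast)+
  define F where "F = {d {u, v} | u v. u \<in> X \<and> v \<in> X \<and> u \<noteq> v}"
  have "connected (S \<union> \<Union> F)"
  proof (rule connected_Un_UN[OF S])
    fix e assume "e \<in> F"
    then obtain u v where e: "e = d {u, v}" "u \<in> X" "v \<in> X" "u \<noteq> v" by (auto simp: F_def)
    show "connected e" using A e by simp
    show "S \<inter> e \<noteq> {}"
    proof (cases "u = r")
      case True then show ?thesis using e A[of u v] by (auto simp: S_def)
    next
      case False
      then have "\<phi> u \<in> S" using A(2)[of r u] e r by (auto simp: S_def)
      then show ?thesis using A(1) e by blast
    qed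
  qed
  moreover have "S \<union> \<Union> F = drawn d X" using r by (auto simp: S_def F_def drawn_def)
  ultimately show ?thesis by simp
qed

lemma triangle_scc: assumes "is_clique X" "card X = 3" shows "simple_closed_curve (drawn d X)"
proof -
  obtain a b c where X: "X = {a, b, c}" "distinct [a, b, c]" using assms(2) by (auto simp: card_3_iff)
  note D = clique_drawingD[OF is_clique_drawing[OF assms(1)]]
  have m: "a \<in> X" "b \<in> X" "c \<in> X" using X by auto
  have ab: "arc_between (d {a, b}) (\<phi> a) (\<phi> b)" and ac: "arc_between (d {a, c}) (\<phi> a) (\<phi> c)"
    and cb: "arc_between (d {c, b}) (\<phi> c) (\<phi> b)" using D(1) m X(2) by auto
  have i: "d {a, c} \<inter> d {c, b} = {\<phi> c}" "d {a, b} \<inter> d {a, c} = {\<phi> a}" "d {a, b} \<inter> d {c, b} = {\<phi> b}"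
    using D(4)[OF m(1,3,2)] D(4)[OF m(2,1,3)] D(4)[OF m(1,2,3)] X(2) by (auto simp: insert_commute)
  have "simple_closed_curve (d {a, b} \<union> (d {a, c} \<union> d {c, b}))"
    by (rule simple_closed_curve_Un[OF ab arc_between_join[OF ac cb i(1)]])
      (simp only: Int_Un_distrib i, auto)
  moreover have "drawn d X = d {a, b} \<union> (d {a, c} \<union> d {c, b})"
    unfolding X(1) drawn3[OF X(2)] by (auto simp: insert_commute)
  ultimately show ?thesis by simp
qed

lemma no_plane_K5:
  fixes g :: "torus_point \<Rightarrow> complex"
  assumes "is_clique Q" "card Q = 5" "drawn d Q \<subseteq> D" "continuous_on D g" "inj_on g D"
  shows False
  by (rule K5_drawing_not_planar[OF is_clique_drawing[OF assms(1)] assms(2) continuous_on_subset[OF assms(4,3)]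
    inj_on_subset[OF assms(5,3)]])

lemma triangle_null:
  assumes X: "is_clique X" "card X = 3" and Q: "is_clique Q" "card Q = 5" "X \<inter> Q = {}"
  shows "null_on (drawn d X)"
proof (rule ccontr)
  assume n: "\<not> ?thesis"
  obtain f e0 e1 :: "torus_point \<Rightarrow> complex" where f: "continuous_on (torus - drawn d X) f" "inj_on f (torus - drawn d X)"
    by (rule essential_complement[OF triangle_scc[OF X] drawn_torus[OF X(1)] n]) blast
  have "drawn d Q \<subseteq> torus - drawn d X" using drawn_torus[OF Q(1)] drawn_Int[OF X(1) Q(1,3)] by auto
  then show False using no_plane_K5[OF Q(1,2) _ f] by blast
qed

text \<open>The three triangles at \<open>a\<close> cover all edges. The first two meet in the edge
  \<open>ab\<close>, and their union meets the third in the path \<open>cae\<close>; both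
  intersections are connected, so arguments can be glued.\<close>

lemma K4_null:
  assumes X: "is_clique X" "X = {a, b, c, e}" "distinct [a, b, c, e]"
    and n: "null_on (drawn d {a, b, c})" "null_on (drawn d {a, b, e})" "null_on (drawn d {a, c, e})"
  shows "null_on (drawn d X)"
proof -
  note cd = is_clique_drawing[OF X(1)]
  note D = clique_drawingD[OF cd]
  have m: "a \<in> X" "b \<in> X" "c \<in> X" "e \<in> X" using X by auto
  have A: "connected (d {u, v})" "closed (d {u, v})" if "u \<in> X" "v \<in> X" "u \<noteq> v" for u v
    using arc_betweenD[OF D(1)[OF that]] compact_imp_closed by auto
  have c: "d {c, b} = d {b, c}" "d {e, b} = d {b, e}" "d {e, c} = d {c, e}" "d {c, a} = d {a, c}" "d {b, a} = d {a, b}"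
    "d {e, a} = d {a, e}" by (simp_all add: insert_commute)
  have t: "drawn d {a, b, c} = d {a, b} \<union> d {b, c} \<union> d {a, c}" "drawn d {a, b, e} = d {a, b} \<union> d {b, e} \<union> d {a, e}"
    "drawn d {a, c, e} = d {a, c} \<union> d {c, e} \<union> d {a, e}" by (rule drawn3; use X(3) in simp)+
  have i: "d {a, b} \<inter> d {b, e} = {\<phi> b}" "d {a, b} \<inter> d {a, e} = {\<phi> a}" "d {b, c} \<inter> d {a, b} = {\<phi> b}"
    "d {b, c} \<inter> d {b, e} = {\<phi> b}" "d {b, c} \<inter> d {a, e} = {}" "d {a, c} \<inter> d {a, b} = {\<phi> a}"
    "d {a, c} \<inter> d {b, e} = {}" "d {a, c} \<inter> d {a, e} = {\<phi> a}"
    "d {a, b} \<inter> d {a, c} = {\<phi> a}" "d {a, b} \<inter> d {c, e} = {}" "d {b, c} \<inter> d {a, c} = {\<phi> c}"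
    "d {b, c} \<inter> d {c, e} = {\<phi> c}" "d {a, c} \<inter> d {c, e} = {\<phi> c}" "d {b, e} \<inter> d {a, c} = {}"
    "d {b, e} \<inter> d {c, e} = {\<phi> e}" "d {b, e} \<inter> d {a, e} = {\<phi> e}" "d {a, e} \<inter> d {a, c} = {\<phi> a}" "d {a, e} \<inter> d {c, e} = {\<phi> e}"
    using D(4)[OF m(1,2,4)] D(4)[OF m(2,1,4)] D(4)[OF m(3,2,1)] D(4)[OF m(3,2,4)] D(5)[OF m(2,3,1,4)] D(4)[OF m(3,1,2)]
      D(5)[OF m(1,3,2,4)] D(4)[OF m(3,1,4)] D(4)[OF m(2,1,3)] D(5)[OF m(1,2,3,4)] D(4)[OF m(2,3,1)] D(4)[OF m(2,3,4)]
      D(4)[OF m(1,3,4)] D(5)[OF m(2,4,1,3)] D(4)[OF m(2,4,3)] D(4)[OF m(2,4,1)] D(4)[OF m(4,1,3)] D(4)[OF m(1,4,3)] X(3)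
    by (auto simp: c)
  have pts: "\<phi> a \<in> d {a, b}" "\<phi> b \<in> d {a, b}" "\<phi> a \<in> d {a, c}" "\<phi> c \<in> d {a, c}" "\<phi> a \<in> d {a, e}" "\<phi> e \<in> d {a, e}"
    using arc_betweenD(1,2)[OF D(1)] m X(3) by auto
  have 1: "drawn d {a, b, c} \<inter> drawn d {a, b, e} = d {a, b}"
    unfolding t Int_Un_distrib Int_Un_distrib2 i using pts by auto
  have 2: "(drawn d {a, b, c} \<union> drawn d {a, b, e}) \<inter> drawn d {a, c, e} = d {a, c} \<union> d {a, e}"
    unfolding t Int_Un_distrib Int_Un_distrib2 i using pts by auto
  have cl: "closed (drawn d {a, b, c})" "closed (drawn d {a, b, e})" "closed (drawn d {a, c, e})"
    unfolding t using A m X(3) by (auto intro!: closed_Un)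
  have con: "connected (d {a, b})" "connected (d {a, c} \<union> d {a, e})"
    using A m X(3) pts by (auto intro!: connected_Un)
  have all: "drawn d X = (drawn d {a, b, c} \<union> drawn d {a, b, e}) \<union> drawn d {a, c, e}"
    unfolding X(2) drawn4[OF X(3)] t by blast
  have "has_arg (drawn d X) h" if "has_arg (drawn d {a, b, c}) h" "has_arg (drawn d {a, b, e}) h" "has_arg (drawn d {a, c, e}) h" for h
    unfolding all
    by (intro has_arg_Un cl closed_Un that) (simp_all only: 1 2 con)
  then show ?thesis using n unfolding null_on_def by blast
qed

text \<open>A null-homotopic drawing of \<open>K\<^sub>4\<close> lifts to the plane, where one vertex is enclosed by the
  triangle on the others.\<close>

lemma K4_trap:
  assumes X: "is_clique X" "X = {a, b, c, e}" "distinct [a, b, c, e]" and n: "null_on (drawn d X)"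
  obtains v U where "v \<in> X" "\<phi> v \<in> U" "encloses (drawn d (X - {v})) U"
proof -
  obtain \<theta>1 \<theta>2 where t: "continuous_on (drawn d X) \<theta>1" "\<And>x. x \<in> drawn d X \<Longrightarrow> fst x = cis (\<theta>1 x)"
    "continuous_on (drawn d X) \<theta>2" "\<And>x. x \<in> drawn d X \<Longrightarrow> snd x = cis (\<theta>2 x)"
    using n unfolding null_on_def has_arg_def by metis
  define \<psi> where "\<psi> x = Complex (\<theta>1 x) (\<theta>2 x)" for x
  have P: "plane_to_torus (\<psi> x) = x" if "x \<in> drawn d X" for x
    using t(2,4)[OF that] by (simp add: plane_to_torus_def \<psi>_def prod_eq_iff)
  have cont: "continuous_on (drawn d X) \<psi>" unfolding \<psi>_def Complex_eq by (intro continuous_intros t)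
  have inj: "inj_on \<psi> (drawn d X)" by (rule inj_on_inverseI[of _ plane_to_torus]) (rule P)
  have c4: "card X = 4" unfolding X(2) using X(3) by simp
  have "clique_drawing (\<psi> \<circ> \<phi>) (\<lambda>e. \<psi> ` d e) X"
    by (rule clique_drawing_image[OF is_clique_drawing[OF X(1)] cont inj]) (use c4 in simp)
  then obtain v where v: "v \<in> X" "\<psi> (\<phi> v) \<in> inside (drawn (\<lambda>e. \<psi> ` d e) (X - {v}))"
    using K4_vertex_inside[OF _ X(2,3)] by fastforce
  have dr: "drawn (\<lambda>e. \<psi> ` d e) Y = \<psi> ` drawn d Y" for Y unfolding drawn_def by blast
  let ?J = "drawn d (X - {v})"
  have k: "is_clique (X - {v})" by (rule is_clique_subset[OF X(1)]) auto
  have sub: "?J \<subseteq> drawn d X" by (rule drawn_mono) auto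
  have fX: "finite X" using X(2) by simp
  have scc: "simple_closed_curve ?J" by (rule triangle_scc[OF k]) (use c4 v(1) fX in simp)
  have enc: "encloses ?J (plane_to_torus ` inside (\<psi> ` ?J))"
    by (rule null_disc[OF scc continuous_on_subset[OF cont sub]]) (use P sub in blast)
  have "\<phi> v \<in> drawn d X" by (rule vertex_drawn[OF X(1) v(1)]) (use c4 in simp)
  then have "\<phi> v \<in> plane_to_torus ` inside (\<psi> ` ?J)" using v(2) P unfolding dr by (metis image_eqI)
  then show ?thesis using that v(1) enc by blast
qed

end

section \<open>Incompatible copies of K5 on the torus\<close>

lemma card_4_obtain:
  assumes "card X = 4" obtains a b c e where "X = {a, b, c, e}" "distinct [a, b, c, e]"
proof -
  have "card X = Suc 3" using assms by simp
  then obtain x S where S: "X = insert x S" "x \<notin> S" "card S = 3" using iffD1[OF card_Suc_eq] by blast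
  then obtain p q r where "S = {p, q, r}" "distinct [p, q, r]" by (auto simp: card_3_iff)
  then show ?thesis using S by (intro that[of x p q r]) auto
qed

lemma continuous_on_closure_point:
  fixes f :: "'s::metric_space \<Rightarrow> 't::metric_space"
  assumes "continuous_on X f" "x \<in> X" "B \<subseteq> X" "x \<in> closure B"
  shows "f x \<in> closure (f ` B)"
  unfolding closure_approachable
proof (intro allI impI)
  fix e :: real assume "e > 0"
  then obtain k where k: "k > 0" "\<And>y. y \<in> X \<Longrightarrow> dist y x < k \<Longrightarrow> dist (f y) (f x) < e"
    using assms(1,2) unfolding continuous_on_iff by meson
  obtain y where "y \<in> B" "dist y x < k" using assms(4) k(1) unfolding closure_approachable by meson
  then show "\<exists>z\<in>f ` B. dist z (f x) < e" using k(2) assms(3) by blast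
qed

context torus_drawing
begin

lemma no_K5_enclosed:
  assumes "encloses J U" "is_clique Q" "card Q = 5" "drawn d Q \<subseteq> U \<union> J" shows False
proof -
  obtain g :: "torus_point \<Rightarrow> complex" where "continuous_on (U \<union> J) g" "inj_on g (U \<union> J)"
    using assms(1) unfolding encloses_def by auto
  then show False by (rule no_plane_K5[OF assms(2-4)])
qed

lemma enclosed:
  "encloses J U \<Longrightarrow> connected Z \<Longrightarrow> Z \<subseteq> torus \<Longrightarrow> Z \<inter> J = {} \<Longrightarrow> z \<in> Z \<Longrightarrow> z \<in> U \<Longrightarrow> Z \<subseteq> U"
  unfolding encloses_def by blast

lemma edge_facts:
  assumes "(u, v) \<in> R"
  shows "connected (d {u, v})" "d {u, v} \<subseteq> torus" "\<phi> u \<in> d {u, v}" "\<phi> v \<in> d {u, v}"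
    "connected (d {u, v} - {\<phi> v})" "\<phi> u \<in> d {u, v} - {\<phi> v}" "\<phi> v \<in> closure (d {u, v} - {\<phi> v})"
    "connected (d {u, v} - {\<phi> u, \<phi> v})" "\<phi> u \<in> closure (d {u, v} - {\<phi> u, \<phi> v})"
    "\<phi> v \<in> closure (d {u, v} - {\<phi> u, \<phi> v})" "\<phi> u \<noteq> \<phi> v"
proof -
  have a: "arc_between (d {u, v}) (\<phi> u) (\<phi> v)" and t: "d {u, v} \<subseteq> torus" using arcs[OF assms] by auto
  show "connected (d {u, v})" "d {u, v} \<subseteq> torus" "\<phi> u \<in> d {u, v}" "\<phi> v \<in> d {u, v}"
    "connected (d {u, v} - {\<phi> v})" "\<phi> u \<in> d {u, v} - {\<phi> v}" "\<phi> v \<in> closure (d {u, v} - {\<phi> v})"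
    "connected (d {u, v} - {\<phi> u, \<phi> v})" "\<phi> u \<in> closure (d {u, v} - {\<phi> u, \<phi> v})"
    "\<phi> v \<in> closure (d {u, v} - {\<phi> u, \<phi> v})" "\<phi> u \<noteq> \<phi> v"
    using arc_betweenD[OF a] arc_between_half[OF a] arc_between_interior[OF a] t by blast+
qed

lemma is_cliqueD: "is_clique X \<Longrightarrow> u \<in> X \<Longrightarrow> v \<in> X \<Longrightarrow> u \<noteq> v \<Longrightarrow> (u, v) \<in> R"
  by (simp add: is_clique_def)

lemma edge_drawn_disjoint:
  assumes "(u, v) \<in> R" "is_clique X" "u \<notin> X" "v \<notin> X" shows "d {u, v} \<inter> drawn d X = {}"
  using edge_drawn_Int[OF assms(1,2)] assms(3,4) by auto

text \<open>The triangles of the K4 \<open>A - {x}\<close> are disjoint from \<open>Q\<close>, hence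
  null, so one of its vertices \<open>v\<close> is trapped by the other three. The edge
  \<open>xv\<close> brings \<open>x\<close> into the disc, \<open>Z\<close> follows, and with it the
  K5 on \<open>Q\<close>.\<close>

lemma K5_connected_to_disjoint_K5:
  assumes A: "is_clique A" "card A = 5" "x \<in> A"
    and Z: "connected Z" "Z \<subseteq> torus" "\<phi> x \<in> Z" "Z \<inter> drawn d (A - {x}) = {}"
    and Q: "is_clique Q" "card Q = 5" "drawn d Q \<subseteq> Z" "(A - {x}) \<inter> Q = {}"
  shows False
proof -
  have fA: "finite A" using A(2) by (metis card.infinite zero_neq_numeral)
  have c4: "card (A - {x}) = 4" using A fA by simp
  obtain a b c e where X: "A - {x} = {a, b, c, e}" "distinct [a, b, c, e]" by (rule card_4_obtain[OF c4])
  have k: "is_clique (A - {x})" by (rule is_clique_subset[OF A(1)]) auto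
  have tri: "null_on (drawn d Y)" if "Y \<subseteq> A - {x}" "card Y = 3" for Y
    using that Q(4) by (intro triangle_null[OF is_clique_subset[OF k that(1)] that(2) Q(1,2)]) auto
  have "null_on (drawn d (A - {x}))"
    by (rule K4_null[OF k X]; rule tri) (use X in auto)
  then obtain v U where v: "v \<in> A - {x}" "\<phi> v \<in> U" "encloses (drawn d (A - {x} - {v})) U"
    by (rule K4_trap[OF k X])
  have xv: "(x, v) \<in> R" using is_cliqueD[OF A(1,3)] v(1) by auto
  note E = edge_facts[OF xv]
  have kv: "is_clique (A - {x} - {v})" by (rule is_clique_subset[OF k]) auto
  have "d {x, v} \<inter> drawn d (A - {x} - {v}) = {}" by (rule edge_drawn_disjoint[OF xv kv]) auto
  then have "d {x, v} \<subseteq> U" by (rule enclosed[OF v(3) E(1,2) _ E(4) v(2)])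
  then have xU: "\<phi> x \<in> U" using E(3) by blast
  have "drawn d (A - {x} - {v}) \<subseteq> drawn d (A - {x})" by (rule drawn_mono) auto
  then have "Z \<inter> drawn d (A - {x} - {v}) = {}" using Z(4) by blast
  then have "Z \<subseteq> U" by (rule enclosed[OF v(3) Z(1,2) _ Z(3) xU])
  then show False using no_K5_enclosed[OF v(3) Q(1,2)] Q(3) by blast
qed

text \<open>Among the triangles at \<open>x\<close> one is essential: otherwise the \<open>K\<^sub>4\<close> on \<open>T \<union> {x}\<close> is null-homotopic, and
  the triangle enclosing one of its vertices traps the other copy of \<open>K\<^sub>5\<close>.\<close>

lemma essential_triangle:
  assumes T: "card T = 3" "card T' = 3" "is_clique (T \<union> {x, y})" "is_clique (T' \<union> {x, y})"
    and dis: "x \<noteq> y" "x \<notin> T" "y \<notin> T" "x \<notin> T'" "y \<notin> T'" "T \<inter> T' = {}"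
  obtains p q where "p \<in> T" "q \<in> T" "p \<noteq> q" "\<not> null_on (drawn d {x, p, q})"
proof (rule ccontr)
  assume neg: "\<not> thesis"
  note found = that
  have n: "null_on (drawn d {x, p, q})" if "p \<in> T" "q \<in> T" "p \<noteq> q" for p q
    using neg found[OF that] by (rule contrapos_np)
  obtain a b c where abc: "T = {a, b, c}" "distinct [a, b, c]" using T(1) by (auto simp: card_3_iff)
  define X where "X = insert x T"
  have X: "X = {x, a, b, c}" "distinct [x, a, b, c]" using abc dis(2) by (auto simp: X_def)
  have kX: "is_clique X" by (rule is_clique_subset[OF T(3)]) (auto simp: X_def)
  have "null_on (drawn d X)"
    by (rule K4_null[OF kX X]; rule n) (use abc in auto)
  then obtain v U where v: "v \<in> X" "\<phi> v \<in> U" "encloses (drawn d (X - {v})) U"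
    by (rule K4_trap[OF kX X])
  define Q where "Q = T' \<union> {x, y}"
  have fT: "finite T'" using T(2) by (metis card.infinite zero_neq_numeral)
  have Q: "is_clique Q" "card Q = 5" using T(2,4) dis fT by (auto simp: Q_def)
  have kv: "is_clique (X - {v})" by (rule is_clique_subset[OF kX]) auto
  show False
  proof (cases "v = x")
    case True
    then have XT: "X - {v} = T" using dis(2) by (auto simp: X_def)
    have "drawn d Q \<inter> drawn d (X - {v}) = {}"
      by (rule drawn_Int[OF Q(1) kv]) (use dis XT in \<open>auto simp: Q_def\<close>)
    moreover have "\<phi> x \<in> drawn d Q" by (rule vertex_drawn[OF Q(1)]) (use Q(2) in \<open>auto simp: Q_def\<close>)
    moreover have "connected (drawn d Q)" by (rule connected_drawn[OF Q(1)]) (use Q(2) in simp)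
    ultimately have "drawn d Q \<subseteq> U" using enclosed[OF v(3) _ drawn_torus[OF Q(1)]] v(2) True by blast
    then show False using no_K5_enclosed[OF v(3) Q] by blast
  next
    case False
    then have vT: "v \<in> T" using v(1) by (auto simp: X_def)
    \<comment> \<open>The edge \<open>vy\<close> brings \<open>y\<close> into \<open>U\<close>, and
      the K4 on \<open>T' \<union> {y}\<close> follows. As \<open>x\<close> lies on the enclosing
      triangle, the remaining edges, those at \<open>x\<close>, stay in the closed disc.\<close>
    have vy: "(v, y) \<in> R" using is_cliqueD[OF T(3), of v y] vT dis by auto
    note E = edge_facts[OF vy]
    have "d {v, y} \<inter> drawn d (X - {v}) = {}"
      by (rule edge_drawn_disjoint[OF vy kv]) (use dis in \<open>auto simp: X_def\<close>)
    then have "d {v, y} \<subseteq> U" by (rule enclosed[OF v(3) E(1,2) _ E(3) v(2)])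
    then have yU: "\<phi> y \<in> U" using E(4) by blast
    define M where "M = T' \<union> {y}"
    have M: "is_clique M" "2 \<le> card M" using is_clique_subset[OF T(4), of M] T(2) dis fT by (auto simp: M_def)
    have "drawn d M \<inter> drawn d (X - {v}) = {}"
      by (rule drawn_Int[OF M(1) kv]) (use dis in \<open>auto simp: M_def X_def\<close>)
    moreover have "\<phi> y \<in> drawn d M" by (rule vertex_drawn[OF M(1) _ M(2)]) (simp add: M_def)
    ultimately have MU: "drawn d M \<subseteq> U"
      using enclosed[OF v(3) connected_drawn[OF M] drawn_torus[OF M(1)]] yU by blast
    have xJ: "\<phi> x \<in> drawn d (X - {v})"
      by (rule vertex_drawn[OF kv]) (use False X v(1) in \<open>auto simp: X_def card_Diff_singleton\<close>)
    have eU: "d {w, x} \<subseteq> U \<union> drawn d (X - {v})" if w: "w \<in> M" for w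
    proof -
      have "w \<noteq> x" "w \<notin> X - {v}" using w dis by (auto simp: M_def X_def)
      have wx: "(w, x) \<in> R" using is_cliqueD[OF Q(1), of w x] w \<open>w \<noteq> x\<close> by (auto simp: M_def Q_def)
      note F = edge_facts[OF wx]
      have "d {w, x} \<inter> drawn d (X - {v}) \<subseteq> {\<phi> x}"
        using edge_drawn_Int[OF wx kv] \<open>w \<notin> X - {v}\<close> by auto
      then have "(d {w, x} - {\<phi> x}) \<inter> drawn d (X - {v}) = {}" by auto
      moreover have "\<phi> w \<in> U" using vertex_drawn[OF M(1) w M(2)] MU by blast
      ultimately have "d {w, x} - {\<phi> x} \<subseteq> U" using enclosed[OF v(3) F(5) _ _ F(6)] F(2) by blast
      then show ?thesis using xJ by auto
    qed
    have "d {s, t} \<subseteq> U \<union> drawn d (X - {v})" if st: "s \<in> Q" "t \<in> Q" "s \<noteq> t" for s t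
    proof -
      consider "s \<in> M" "t \<in> M" | "s \<in> M" "t = x" | "s = x" "t \<in> M" using st by (auto simp: Q_def M_def)
      then show ?thesis
      proof cases
        case 1
        then have "d {s, t} \<subseteq> drawn d M" by (rule edge_subset_drawn[OF _ _ st(3)])
        then show ?thesis using MU by blast
      next
        case 2 then show ?thesis using eU by blast
      next
        case 3 then show ?thesis using eU[of t] by (simp add: insert_commute)
      qed
    qed
    then have "drawn d Q \<subseteq> U \<union> drawn d (X - {v})" unfolding drawn_def[of d Q] by blast
    then show False by (rule no_K5_enclosed[OF v(3) Q])
  qed
qed

text \<open>Cutting the torus along an essential triangle \<open>xpq\<close> splits \<open>x\<close> into two points \<open>s\<^sub>0\<close>, \<open>s\<^sub>1\<close> of the plane
  (\<open>\<sigma> w\<close> is the one reached from \<open>w\<close>). What remains of the other two copies of \<open>K\<^sub>5\<close> always contains a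
  connected set attached to all four vertices of a \<open>K\<^sub>4\<close>.\<close>

lemma no_three_K5_on_edge:
  assumes T: "card T1 = 3" "card T2 = 3" "card T3 = 3"
    and k: "is_clique (T1 \<union> {x, y})" "is_clique (T2 \<union> {x, y})" "is_clique (T3 \<union> {x, y})"
    and dis: "x \<noteq> y" "x \<notin> T1" "y \<notin> T1" "x \<notin> T2" "y \<notin> T2" "x \<notin> T3" "y \<notin> T3"
      "T1 \<inter> T2 = {}" "T1 \<inter> T3 = {}" "T2 \<inter> T3 = {}"
  shows False
proof -
  obtain p q where pq: "p \<in> T3" "q \<in> T3" "p \<noteq> q" and ess: "\<not> null_on (drawn d {x, p, q})"
    by (rule essential_triangle[OF T(3,1) k(3,1)]) (use dis in auto)
  define J where "J = drawn d {x, p, q}"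
  have kJ: "is_clique {x, p, q}" by (rule is_clique_subset[OF k(3)]) (use pq in auto)
  have "x \<noteq> p" "x \<noteq> q" using pq dis(6) by blast+
  then have cJ: "card {x, p, q} = 3" using pq(3) by simp
  obtain f e0 e1 :: "torus_point \<Rightarrow> complex" where
    f: "continuous_on (torus - J) f" "inj_on f (torus - J)"
    and e: "\<And>z. z \<in> J \<Longrightarrow> e0 z \<noteq> e1 z \<and> e0 z \<notin> f ` (torus - J) \<and> e1 z \<notin> f ` (torus - J)"
    and lim: "\<And>A a z. arc_between A a z \<Longrightarrow> z \<in> J \<Longrightarrow> A - {z} \<subseteq> torus - J \<Longrightarrow>
      \<exists>\<sigma>\<in>{e0 z, e1 z}. \<forall>B\<subseteq>A - {z}. z \<in> closure B \<longrightarrow> \<sigma> \<in> closure (f ` B)"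
    using essential_complement[OF triangle_scc[OF kJ cJ] drawn_torus[OF kJ] ess] unfolding J_def by metis
  have xJ: "\<phi> x \<in> J" unfolding J_def by (rule vertex_drawn[OF kJ]) (use cJ in auto)
  define s0 s1 where "s0 = e0 (\<phi> x)" and "s1 = e1 (\<phi> x)"
  have s: "s0 \<notin> f ` (torus - J)" "s1 \<notin> f ` (torus - J)" using e[OF xJ] by (auto simp: s0_def s1_def)
  \<comment> \<open>The vertices other than \<open>x\<close> of the two copies of K5 that do not
    contain the cut triangle.\<close>
  define Y where "Y = T1 \<union> T2 \<union> {y}"
  have wx: "(w, x) \<in> R" if "w \<in> Y" for w
    using that is_cliqueD[OF k(1), of w x] is_cliqueD[OF k(2), of w x] dis by (auto simp: Y_def)
  have YJ: "Y \<inter> {x, p, q} = {}" using pq dis by (auto simp: Y_def)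
  have wJ: "d {w, x} \<inter> J \<subseteq> {\<phi> x}" if "w \<in> Y" for w
    using edge_drawn_Int[OF wx[OF that] kJ] YJ that unfolding J_def by auto
  have off: "d {w, x} - {\<phi> x} \<subseteq> torus - J" if "w \<in> Y" for w
    using wJ[OF that] edge_facts(2)[OF wx[OF that]] by auto
  have "\<exists>\<sigma>\<in>{s0, s1}. \<forall>B\<subseteq>d {w, x} - {\<phi> x}. \<phi> x \<in> closure B \<longrightarrow> \<sigma> \<in> closure (f ` B)" if "w \<in> Y" for w
    unfolding s0_def s1_def using arcs[OF wx[OF that]] by (intro lim[OF _ xJ off[OF that]]) blast
  then obtain \<sigma> where sig: "\<And>w. w \<in> Y \<Longrightarrow> \<sigma> w \<in> {s0, s1}"
    and sig_cl: "\<And>w B. w \<in> Y \<Longrightarrow> B \<subseteq> d {w, x} - {\<phi> x} \<Longrightarrow> \<phi> x \<in> closure B \<Longrightarrow> \<sigma> w \<in> closure (f ` B)"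
    by metis
  \<comment> \<open>\<open>B w\<close> is the open edge from \<open>w\<close> to \<open>x\<close>
    and \<open>h w\<close> its plane image; \<open>g w\<close> adds the image of \<open>w\<close>
    and the copy of \<open>x\<close> reached from it, both limit points, so connectedness is
    kept.\<close>
  define B where "B w = d {w, x} - {\<phi> w, \<phi> x}" for w
  define h where "h w = f ` B w" for w
  define g where "g w = h w \<union> {\<sigma> w, f (\<phi> w)}" for w
  have BT: "B w \<subseteq> torus - J" if "w \<in> Y" for w using off[OF that] by (auto simp: B_def)
  have vT: "\<phi> w \<in> torus - J" if "w \<in> Y" for w using off[OF that] edge_facts(6)[OF wx[OF that]] by blast
  have hcon: "connected (h w)" if "w \<in> Y" for w unfolding h_def
    using edge_facts(8)[OF wx[OF that]]
    by (intro connected_continuous_image continuous_on_subset[OF f(1) BT[OF that]]) (simp add: B_def)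
  have hs: "\<sigma> w \<in> closure (h w)" if "w \<in> Y" for w unfolding h_def
    using edge_facts(10)[OF wx[OF that]] by (intro sig_cl[OF that]) (auto simp: B_def)
  have hv: "f (\<phi> w) \<in> closure (h w)" if "w \<in> Y" for w unfolding h_def
    using edge_facts(9)[OF wx[OF that]]
    by (intro continuous_on_closure_point[OF f(1) vT[OF that] BT[OF that]]) (simp add: B_def)
  have gcon: "connected (g w)" "connected (h w \<union> {\<sigma> w})" if "w \<in> Y" for w
    unfolding g_def using hs[OF that] hv[OF that] closure_subset[of "h w"]
    by (auto intro!: connected_intermediate_closure[OF hcon[OF that]])
  have sig_off: "\<sigma> w \<notin> f ` D" if "w \<in> Y" "D \<subseteq> torus - J" for w D using sig[OF that(1)] s that(2) by auto
  have fdis: "f ` D \<inter> f ` E = {}" if "D \<subseteq> torus - J" "E \<subseteq> torus - J" "D \<inter> E = {}" for D E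
    using inj_on_image_Int[OF f(2) that(1,2)] that(3) by simp
  \<comment> \<open>\<open>W0\<close> is attached to \<open>w\<close> if it accumulates there, or if
    it contains the copy of \<open>x\<close> from which the edge \<open>xw\<close> leads on to
    \<open>w\<close>. Adding these edges to \<open>W0\<close> gives a connected set that
    \<open>K4_face\<close> forbids.\<close>
  have core: False
    if X: "is_clique X" "card X = 4" "X \<subseteq> Y"
      and W0: "connected W0" "W0 \<inter> f ` drawn d X = {}" "\<And>w. w \<in> X \<Longrightarrow> \<sigma> w \<in> W0 \<or> f (\<phi> w) \<in> closure W0"
    for X W0
  proof -
    have XJ: "X \<inter> {x, p, q} = {}" using X(3) YJ by auto
    have dX: "drawn d X \<subseteq> torus - J"
      using drawn_torus[OF X(1)] drawn_Int[OF X(1) kJ XJ] unfolding J_def by auto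
    have cd: "clique_drawing (f \<circ> \<phi>) (\<lambda>e. f ` d e) X"
      by (rule clique_drawing_image[OF is_clique_drawing[OF X(1)] continuous_on_subset[OF f(1) dX] inj_on_subset[OF f(2) dX]])
        (use X(2) in simp)
    have dr: "drawn (\<lambda>e. f ` d e) X = f ` drawn d X" unfolding drawn_def by blast
    define F where "F = {h w \<union> {\<sigma> w} | w. w \<in> X \<and> \<sigma> w \<in> W0}"
    have 1: "connected (W0 \<union> \<Union> F)"
      by (rule connected_Un_UN[OF W0(1)]) (use gcon(2) X(3) in \<open>auto simp: F_def\<close>)
    have hX: "h w \<inter> f ` drawn d X = {}" if w: "w \<in> X" for w
    proof -
      have wY: "w \<in> Y" using w X(3) by auto
      have "d {w, x} \<inter> drawn d X \<subseteq> {\<phi> w}"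
        using edge_drawn_Int[OF wx[OF wY] X(1)] XJ by auto
      then have "B w \<inter> drawn d X = {}" by (auto simp: B_def)
      then show ?thesis unfolding h_def by (rule fdis[OF BT[OF wY] dX])
    qed
    have 2: "(W0 \<union> \<Union> F) \<inter> drawn (\<lambda>e. f ` d e) X = {}"
      unfolding dr F_def using W0(2) hX by blast
    have "f (\<phi> w) \<in> closure (W0 \<union> \<Union> F)" if w: "w \<in> X" for w
    proof (cases "\<sigma> w \<in> W0")
      case True
      then have "h w \<subseteq> W0 \<union> \<Union> F" using w by (auto simp: F_def)
      then show ?thesis using hv[of w] w X(3) closure_mono by blast
    next
      case False
      then show ?thesis using W0(3)[OF w] closure_mono[of W0 "W0 \<union> \<Union> F"] by blast
    qed
    then have 3: "(f \<circ> \<phi>) ` X \<subseteq> closure (W0 \<union> \<Union> F)" by auto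
    show False by (rule K4_face[OF cd X(2) 1 2 3])
  qed
  \<comment> \<open>\<open>\<sigma>\<close> is constant on \<open>T'\<close>: otherwise the triangle
    \<open>T'\<close> with its edges to \<open>x\<close> contains both copies of \<open>x\<close>,
    and so is attached to the whole K4 on \<open>T \<union> {y}\<close>.\<close>
  have side: False
    if T: "card T = 3" "card T' = 3" "is_clique (T \<union> {x, y})" "is_clique (T' \<union> {x, y})" "y \<notin> T" "x \<notin> T" "x \<notin> T'" "y \<notin> T'"
        "T \<inter> T' = {}" "T \<union> T' \<subseteq> Y"
      and ww: "w \<in> T'" "w' \<in> T'" "\<sigma> w \<noteq> \<sigma> w'" for T T' w w'
  proof -
    define X where "X = T \<union> {y}"
    have fin: "finite T" using T(1) by (metis card.infinite zero_neq_numeral)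
    have X: "is_clique X" "card X = 4" "X \<subseteq> Y" using is_clique_subset[OF T(3), of X] T fin by (auto simp: X_def Y_def)
    have kT: "is_clique T'" by (rule is_clique_subset[OF T(4)]) auto
    have TX: "T' \<inter> X = {}" using T by (auto simp: X_def)
    have T'J: "T' \<inter> {x, p, q} = {}" "X \<inter> {x, p, q} = {}" using T(10) X(3) YJ by auto
    have dT: "drawn d T' \<subseteq> torus - J" "drawn d X \<subseteq> torus - J"
      using drawn_torus[OF kT] drawn_Int[OF kT kJ T'J(1)] drawn_torus[OF X(1)] drawn_Int[OF X(1) kJ T'J(2)]
      unfolding J_def by auto
    have vd: "\<phi> w \<in> drawn d T'" if "w \<in> T'" for w by (rule vertex_drawn[OF kT that]) (use T(2) in simp)
    define W0 where "W0 = f ` drawn d T' \<union> \<Union> (g ` T')"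
    have "connected (f ` drawn d T')"
      using T(2) by (intro connected_continuous_image continuous_on_subset[OF f(1) dT(1)] connected_drawn[OF kT]) simp
    then have 1: "connected W0" unfolding W0_def
      by (rule connected_Un_UN) (use gcon(1) vd T(10) in \<open>auto simp: g_def\<close>)
    have gX: "g w \<inter> f ` drawn d X = {}" if w: "w \<in> T'" for w
    proof -
      have wY: "w \<in> Y" using w T(10) by auto
      have "d {w, x} \<inter> drawn d X = {}"
        using edge_drawn_disjoint[OF wx[OF wY] X(1)] TX T'J(2) w by auto
      then have "B w \<inter> drawn d X = {}" by (auto simp: B_def)
      then have "h w \<inter> f ` drawn d X = {}" unfolding h_def by (rule fdis[OF BT[OF wY] dT(2)])
      moreover have "f (\<phi> w) \<notin> f ` drawn d X"
        using fdis[OF dT drawn_Int[OF kT X(1) TX]] vd[OF w] by blast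
      ultimately show ?thesis using sig_off[OF wY dT(2)] by (auto simp: g_def)
    qed
    have 2: "W0 \<inter> f ` drawn d X = {}"
      unfolding W0_def using gX fdis[OF dT drawn_Int[OF kT X(1) TX]] by blast
    have "\<sigma> w \<in> W0" "\<sigma> w' \<in> W0" using ww by (auto simp: W0_def g_def)
    moreover have "\<sigma> w \<in> {s0, s1}" "\<sigma> w' \<in> {s0, s1}" using sig ww T(10) by auto
    ultimately have "s0 \<in> W0" "s1 \<in> W0" using ww(3) by auto
    then have "\<sigma> v \<in> W0" if "v \<in> X" for v using sig[of v] that X(3) by auto
    then show False using core[OF X 1 2] by blast
  qed
  have yY: "y \<in> Y" by (simp add: Y_def)
  \<comment> \<open>If all of \<open>T\<close> agreed with \<open>y\<close>, the single point
    \<open>\<sigma> y\<close> would be attached to the K4 on \<open>T \<union> {y}\<close>.\<close>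
  have const: "\<exists>w\<in>T. \<sigma> w \<noteq> \<sigma> y" if T: "card T = 3" "is_clique (T \<union> {x, y})" "x \<notin> T" "y \<notin> T" "T \<subseteq> Y" for T
  proof (rule ccontr)
    assume n: "\<not> ?thesis"
    have fin: "finite T" using T(1) by (metis card.infinite zero_neq_numeral)
    have X: "is_clique (T \<union> {y})" "card (T \<union> {y}) = 4" "T \<union> {y} \<subseteq> Y"
      using is_clique_subset[OF T(2), of "T \<union> {y}"] T fin yY by auto
    have dX: "drawn d (T \<union> {y}) \<subseteq> torus - J"
      using drawn_torus[OF X(1)] drawn_Int[OF X(1) kJ] X(3) YJ unfolding J_def by blast
    show False
      by (rule core[OF X, of "{\<sigma> y}"]) (use sig_off[OF yY dX] n in auto)
  qed
  have sub: "T1 \<subseteq> Y" "T2 \<subseteq> Y" by (auto simp: Y_def)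
  obtain a where a: "a \<in> T1" "\<sigma> a \<noteq> \<sigma> y" using const[OF T(1) k(1) dis(2,3) sub(1)] by blast
  obtain b where b: "b \<in> T2" "\<sigma> b \<noteq> \<sigma> y" using const[OF T(2) k(2) dis(4,5) sub(2)] by blast
  have same1: "\<sigma> w = \<sigma> a" if "w \<in> T1" for w
    using side[OF T(2,1) k(2,1) dis(5,4,2,3) _ _ that a(1)] dis(8) sub by blast
  have bY: "b \<in> Y" using b sub by auto
  \<comment> \<open>There are only two copies of \<open>x\<close>, and both \<open>a\<close> and
    \<open>b\<close> reach the one that \<open>y\<close> does not.\<close>
  have ab: "\<sigma> a = \<sigma> b" using sig[of a] sig[OF bY] sig[OF yY] a b sub by auto
  define X where "X = T1 \<union> {y}"
  have fin: "finite T1" using T(1) by (metis card.infinite zero_neq_numeral)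
  have X: "is_clique X" "card X = 4" "X \<subseteq> Y" using is_clique_subset[OF k(1), of X] T(1) dis fin by (auto simp: X_def Y_def)
  have XJ: "X \<inter> {x, p, q} = {}" using X(3) YJ by auto
  have dX: "drawn d X \<subseteq> torus - J"
    using drawn_torus[OF X(1)] drawn_Int[OF X(1) kJ XJ] unfolding J_def by auto
  have bX: "b \<notin> X" "x \<notin> X" using b dis by (auto simp: X_def)
  have byR: "(b, y) \<in> R" using is_cliqueD[OF k(2), of b y] b dis by auto
  note E = edge_facts[OF byR]
  define H where "H = d {b, y} - {\<phi> y}"
  have dbyX: "d {b, y} \<inter> drawn d X \<subseteq> {\<phi> y}"
    using edge_drawn_Int[OF byR X(1)] bX(1) by auto
  have HX: "H \<inter> drawn d X = {}" using dbyX by (auto simp: H_def)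
  have "d {b, y} \<inter> J = {}" unfolding J_def
    by (rule edge_drawn_disjoint[OF byR kJ]) (use YJ bY yY in auto)
  then have dT: "d {b, y} \<subseteq> torus - J" "H \<subseteq> torus - J" using E(2) by (auto simp: H_def)
  \<comment> \<open>Two edges at \<open>b\<close> suffice: the one to \<open>x\<close> supplies the
    copy of \<open>x\<close> attached to all of \<open>T1\<close>, and the one to \<open>y\<close>
    accumulates at \<open>y\<close>.\<close>
  define W0 where "W0 = g b \<union> f ` H"
  have "connected (f ` H)" using E(5) unfolding H_def[symmetric]
    by (intro connected_continuous_image continuous_on_subset[OF f(1) dT(2)])
  moreover have "f (\<phi> b) \<in> g b \<inter> f ` H" using E(6) by (auto simp: g_def H_def)
  ultimately have 1: "connected W0" unfolding W0_def by (intro connected_Un gcon(1) bY) auto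
  have "d {b, x} \<inter> drawn d X = {}" by (rule edge_drawn_disjoint[OF wx[OF bY] X(1) bX])
  then have "B b \<inter> drawn d X = {}" by (auto simp: B_def)
  then have "h b \<inter> f ` drawn d X = {}" unfolding h_def by (rule fdis[OF BT[OF bY] dX])
  moreover have fH: "f ` H \<inter> f ` drawn d X = {}" by (rule fdis[OF dT(2) dX HX])
  moreover have "f (\<phi> b) \<in> f ` H" using E(6) by (auto simp: H_def)
  ultimately have 2: "W0 \<inter> f ` drawn d X = {}"
    using sig_off[OF bY dX] unfolding W0_def g_def by blast
  have "f (\<phi> y) \<in> closure (f ` H)"
    by (rule continuous_on_closure_point[OF f(1) vT[OF yY] dT(2)]) (use E(7) in \<open>simp add: H_def\<close>)
  then have y0: "f (\<phi> y) \<in> closure W0" using closure_mono[of "f ` H" W0] by (auto simp: W0_def)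
  have "\<sigma> b \<in> W0" by (simp add: W0_def g_def)
  then have 3: "\<sigma> w \<in> W0 \<or> f (\<phi> w) \<in> closure W0" if "w \<in> X" for w
    using that same1[of w] ab y0 by (auto simp: X_def)
  show False by (rule core[OF X 1 2 3])
qed

end

text \<open>For \<open>e \<noteq> f\<close> choose \<open>y\<close> in \<open>e\<close> but not in
  \<open>f\<close>, and let \<open>x\<close> be the other element of \<open>e\<close>. Then
  \<open>A - {x}\<close> is disjoint from both \<open>B - {y}\<close> and \<open>C\<close>, and
  \<open>B - {y}\<close> connects \<open>x\<close> with \<open>C\<close> through a vertex of
  \<open>f\<close>.\<close>

lemma (in torus_drawing) no_K5_chain:
  assumes "K5_chain R A B C e f" shows False
proof -
  have c: "card A = 5" "card B = 5" "card C = 5" "card e = 2" "card f = 2"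
    and cl: "clique A \<subseteq> R" "clique B \<subseteq> R" "clique C \<subseteq> R"
    and i: "A \<inter> B = e" "B \<inter> C = f" "A \<inter> C = e \<inter> f" using assms by (auto simp: K5_chain_def)
  have cliq: "is_clique X" if "card X = 5" "clique X \<subseteq> R" for X
  proof -
    have r: "(u, v) \<in> R" if "u \<in> X" "v \<in> X" "u \<noteq> v" for u v
      using that \<open>clique X \<subseteq> R\<close> by (auto simp: clique_sub)
    have "u \<in> V" if u: "u \<in> X" for u
    proof -
      have "X \<noteq> {u}" using \<open>card X = 5\<close> by auto
      then obtain v where "v \<in> X" "u \<noteq> v" using u by blast
      then show ?thesis using ends[OF r[OF u]] by blast
    qed
    then show ?thesis using r by (auto simp: is_clique_def)
  qed
  note k = cliq[OF c(1) cl(1)] cliq[OF c(2) cl(2)] cliq[OF c(3) cl(3)]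
  have fin: "finite A" "finite B" "finite C" using c by (metis card.infinite zero_neq_numeral)+
  show False
  proof (cases "e = f")
    case True
    obtain x y where e: "e = {x, y}" "x \<noteq> y" using c(4) by (meson card_2_iff)
    have m: "{x, y} \<subseteq> A" "{x, y} \<subseteq> B" "{x, y} \<subseteq> C" using i e True by auto
    have card: "card (X - {x, y}) = 3" if "{x, y} \<subseteq> X" "card X = 5" for X
      using that e(2) by (subst card_Diff_subset) auto
    have un: "X - {x, y} \<union> {x, y} = X" if "{x, y} \<subseteq> X" for X using that by auto
    have k': "is_clique (A - {x, y} \<union> {x, y})" "is_clique (B - {x, y} \<union> {x, y})" "is_clique (C - {x, y} \<union> {x, y})"
      unfolding un[OF m(1)] un[OF m(2)] un[OF m(3)] by (fact k)+
    have "(A - {x, y}) \<inter> (B - {x, y}) = {}" "(A - {x, y}) \<inter> (C - {x, y}) = {}" "(B - {x, y}) \<inter> (C - {x, y}) = {}"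
      using i e(1) True by blast+
    then show False
      using no_three_K5_on_edge[OF card[OF m(1) c(1)] card[OF m(2) c(2)] card[OF m(3) c(3)] k' e(2)] by simp
  next
    case False
    have "\<not> e \<subseteq> f"
    proof
      assume "e \<subseteq> f"
      moreover have "finite f" using c(5) by (metis card.infinite zero_neq_numeral)
      ultimately show False using card_subset_eq[of f e] c(4,5) False by simp
    qed
    then obtain y where y: "y \<in> e" "y \<notin> f" by blast
    obtain x where x: "e = {x, y}" "x \<noteq> y" using c(4) y(1) by (auto simp: card_2_iff)
    have mA: "x \<in> A" "y \<in> A" and mB: "x \<in> B" "y \<in> B" using i(1) x(1) by auto
    have "f \<noteq> {}" using c(5) by auto
    then obtain w where w: "w \<in> f" by auto
    have wBC: "w \<in> B - {y}" "w \<in> C" using w i(2) y(2) by auto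
    have kB: "is_clique (B - {y})" "card (B - {y}) = 4" using is_clique_subset[OF k(2)] c(2) mB fin by auto
    have kA: "is_clique (A - {x})" by (rule is_clique_subset[OF k(1)]) auto
    define Z where "Z = drawn d (B - {y}) \<union> drawn d C"
    have "\<phi> w \<in> drawn d (B - {y}) \<inter> drawn d C"
      using vertex_drawn[OF kB(1) wBC(1)] vertex_drawn[OF k(3) wBC(2)] kB(2) c(3) by auto
    then have "connected Z" unfolding Z_def
      using kB(2) c(3) by (intro connected_Un connected_drawn kB(1) k(3)) auto
    moreover have "Z \<subseteq> torus" unfolding Z_def using drawn_torus[OF kB(1)] drawn_torus[OF k(3)] by auto
    moreover have "\<phi> x \<in> Z" unfolding Z_def using vertex_drawn[OF kB(1), of x] kB(2) mB x(2) by auto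
    moreover have dC: "(A - {x}) \<inter> C = {}" using i(3) x(1) y(2) by auto
    moreover have "(A - {x}) \<inter> (B - {y}) = {}" using i(1) x(1) by auto
    then have "Z \<inter> drawn d (A - {x}) = {}"
      unfolding Z_def using drawn_Int[OF kA kB(1)] drawn_Int[OF kA k(3) dC] by blast
    moreover have "drawn d C \<subseteq> Z" by (simp add: Z_def)
    ultimately show False using K5_connected_to_disjoint_K5[OF k(1) c(1) mA(1), of Z C] k(3) c(3) by blast
  qed
qed

section \<open>Counting and conclusion\<close>

lemma K5tree_card_mod: "K5tree V R \<Longrightarrow> card V mod 3 = 2"
proof (induct rule: K5tree.induct)
  case (glue V R p q a b c)
  have "card (V \<union> {a, b, c}) = card V + 3"
    using glue(4,5) K5tree_finite(1)[OF glue(1)] by (subst card_Un_disjoint) auto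
  then show ?case using glue(2) by simp
qed simp

lemma card_parcs_uedges:
  assumes "pair_graph G" shows "card (parcs G) = 2 * card (uedges G)"
proof -
  interpret G: pair_graph G by fact
  let ?h = "\<lambda>(u, v). {u, v}"
  have im: "uedges G = ?h ` parcs G" by (auto simp: uedges_def image_iff)
  have two: "card {a. a \<in> parcs G \<and> ?h a = e} = 2" if e: "e \<in> uedges G" for e
  proof -
    obtain u v where uv: "e = {u, v}" "(u, v) \<in> parcs G" using e by (auto simp: uedges_def)
    then have "{a. a \<in> parcs G \<and> ?h a = e} = {(u, v), (v, u)}"
      using G.arcs_symmetric by (auto simp: doubleton_eq_iff)
    moreover have "u \<noteq> v" using uv(2) G.no_loops' by blast
    ultimately show ?thesis by simp
  qed
  have "card (parcs G) = (\<Sum>a\<in>parcs G. 1)" by simp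
  also have "\<dots> = (\<Sum>e\<in>uedges G. \<Sum>a\<in>{a. a \<in> parcs G \<and> ?h a = e}. 1)"
    by (rule sum.group[symmetric]) (use im G.pair_finite_arcs in auto)
  also have "\<dots> = (\<Sum>e\<in>uedges G. card {a. a \<in> parcs G \<and> ?h a = e})" by simp
  also have "\<dots> = (\<Sum>e\<in>uedges G. 2)" by (rule sum.cong[OF refl two])
  finally show ?thesis by simp
qed

lemma toroidal_obtains_drawing:
  assumes "pair_graph G" "toroidal G"
  obtains \<phi> d where "torus_drawing \<phi> d (pverts G) (parcs G)"
proof -
  interpret G: pair_graph G by fact
  obtain \<phi> :: "'a \<Rightarrow> complex \<times> complex" and \<gamma> :: "'a set \<Rightarrow> real \<Rightarrow> complex \<times> complex" where
    emb: "inj_on \<phi> (pverts G) \<and> \<phi> ` pverts G \<subseteq> torus \<and>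
      (\<forall>e \<in> uedges G.
        arc (\<gamma> e) \<and> path_image (\<gamma> e) \<subseteq> torus \<and>
        {pathstart (\<gamma> e), pathfinish (\<gamma> e)} = \<phi> ` e \<and>
        path_image (\<gamma> e) \<inter> \<phi> ` pverts G = \<phi> ` e) \<and>
      (\<forall>e \<in> uedges G. \<forall>f \<in> uedges G. e \<noteq> f \<longrightarrow>
        path_image (\<gamma> e) \<inter> path_image (\<gamma> f) = \<phi> ` (e \<inter> f))"
    using assms(2) unfolding toroidal_def embeddable_in_def by (elim exE) (rule that)
  have inj: "inj_on \<phi> (pverts G)" using emb by (rule conjunct1)
  have a: "arc (\<gamma> e) \<and> path_image (\<gamma> e) \<subseteq> torus \<and>
        {pathstart (\<gamma> e), pathfinish (\<gamma> e)} = \<phi> ` e \<and> path_image (\<gamma> e) \<inter> \<phi> ` pverts G = \<phi> ` e"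
    if "e \<in> uedges G" for e by (rule bspec[OF conjunct1[OF conjunct2[OF conjunct2[OF emb]]] that])
  have b: "path_image (\<gamma> e) \<inter> path_image (\<gamma> f) = \<phi> ` (e \<inter> f)"
    if "e \<in> uedges G" "f \<in> uedges G" "e \<noteq> f" for e f
    by (rule mp[OF bspec[OF bspec[OF conjunct2[OF conjunct2[OF conjunct2[OF emb]]] that(1)] that(2)] that(3)])
  have e: "{u, v} \<in> uedges G" if "(u, v) \<in> parcs G" for u v using that by (auto simp: uedges_def)
  have "torus_drawing \<phi> (\<lambda>e. path_image (\<gamma> e)) (pverts G) (parcs G)"
  proof
    fix u v assume uv: "(u, v) \<in> parcs G"
    show "u \<in> pverts G \<and> v \<in> pverts G \<and> u \<noteq> v" using uv G.wellformed' G.no_loops' by blast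
    show "path_image (\<gamma> {u, v}) \<inter> \<phi> ` pverts G = \<phi> ` {u, v}" using a[OF e[OF uv]] by blast
    have "arc_between (path_image (\<gamma> {u, v})) (pathstart (\<gamma> {u, v})) (pathfinish (\<gamma> {u, v}))"
      using a[OF e[OF uv]] unfolding arc_between_def by blast
    moreover have "{pathstart (\<gamma> {u, v}), pathfinish (\<gamma> {u, v})} = {\<phi> u, \<phi> v}" using a[OF e[OF uv]] by simp
    ultimately have "arc_between (path_image (\<gamma> {u, v})) (\<phi> u) (\<phi> v)"
      using arc_between_sym by (auto simp: doubleton_eq_iff)
    then show "arc_between (path_image (\<gamma> {u, v})) (\<phi> u) (\<phi> v) \<and> path_image (\<gamma> {u, v}) \<subseteq> torus"
      using a[OF e[OF uv]] by blast
  next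
    fix u v u' v' assume "(u, v) \<in> parcs G" "(u', v') \<in> parcs G" "{u, v} \<noteq> {u', v'}"
    then show "path_image (\<gamma> {u, v}) \<inter> path_image (\<gamma> {u', v'}) = \<phi> ` ({u, v} \<inter> {u', v'})"
      using b[OF e e] by blast
  qed (rule inj)
  then show ?thesis by (rule that)
qed

theorem proposition5:
  fixes G :: "'a pair_pre_digraph" and n m :: nat
  assumes "pair_graph G"
    and "\<not> planar G"
    and "K33_subdivision_free G"
    and "toroidal G"
    and "n = card (pverts G)"
    and "m = card (uedges G)"
  shows "(n = 5 \<or> n = 8 \<longrightarrow> m \<le> 3 * n - 5) \<and> (n \<ge> 6 \<and> n \<noteq> 8 \<longrightarrow> m \<le> 3 * n - 6)"
proof -
  have g: "graph_on (pverts G) (parcs G)" by (rule pair_graph_graph_on[OF assms(1)])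
  have nm: "\<not> K33_minor (pverts G) (parcs G)"
    by (rule K33_subdivision_free_imp_no_minor[OF assms(1,3)])
  have cm: "card (parcs G) = 2 * m" using card_parcs_uedges[OF assms(1)] assms(6) by simp
  have tree: "K5tree (pverts G) (parcs G)" if "2 \<le> n" "6 * n \<le> 2 * m + 10"
    using K5tree_if_many_edges[OF g] that nm cm assms(5) by simp
  have tight: "2 * m + 10 = 6 * n" if "2 \<le> n" "6 * n \<le> 2 * m + 10"
    using K5tree_graph[OF tree[OF that]] cm assms(5) by simp
  have no11: False if n: "11 \<le> n" "6 * n \<le> 2 * m + 10"
  proof -
    have "K5tree (pverts G) (parcs G)" using tree n by simp
    then obtain A B C e f where chain: "K5_chain (parcs G) A B C e f"
      using K5tree_chain n(1) assms(5) by blast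
    obtain \<phi> d where "torus_drawing \<phi> d (pverts G) (parcs G)"
      by (rule toroidal_obtains_drawing[OF assms(1,4)])
    then show False using torus_drawing.no_K5_chain chain by blast
  qed
  show ?thesis
  proof (intro conjI impI)
    assume n: "n = 5 \<or> n = 8"
    show "m \<le> 3 * n - 5"
    proof (rule ccontr)
      assume "\<not> m \<le> 3 * n - 5"
      then have "6 * n + 2 \<le> 2 * m + 10" using n by auto
      then show False using tight n by auto
    qed
  next
    assume n: "6 \<le> n \<and> n \<noteq> 8"
    show "m \<le> 3 * n - 6"
    proof (rule ccontr)
      assume "\<not> m \<le> 3 * n - 6"
      then have m: "6 * n \<le> 2 * m + 10" using n by linarith
      then have "K5tree (pverts G) (parcs G)" using tree n by simp
      then have "n mod 3 = 2" using K5tree_card_mod assms(5) by blast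
      \<comment> \<open>With 8 excluded, 11 is the first number from 6 on that is 2 modulo
        3.\<close>
      then have "11 \<le> n" using n by presburger
      then show False using no11 m by blast
    qed
  qed
qed

end
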